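(* The complex Cholesky-Jacobi (CJ) method is globally convergent under the class of generalized serial pivot strategies: for every pair $(A,B)$ of $n\times n$ complex Hermitian matrices with $B$ positive definite and every cyclic pivot strategy $I_{\mathcal{O}}$ with $\mathcal{O}\in\mathcal{C}_{sg}^{(n)}$, the sequences generated by the CJ method satisfy $A^{(k)}\to\Lambda$ and $B^{(k)}\to I_n$ as $k\to\infty$, where $\Lambda$ is a diagonal matrix of the eigenvalues of $(A,B)$.
   Context: Positive definite generalized eigenvalue problem: $Ax=\lambda Bx$, $x\ne0$, with $A,B\in\mathbb{C}^{n\times n}$ Hermitian, $B$ positive definite. $\imath=\sqrt{-1}$. The CJ method: first set $A^{(0)}=DAD$, $B^{(0)}=DBD$ with $D=\mathrm{diag}(b_{11}^{-1/2},\dots,b_{nn}^{-1/2})$, so $B^{(0)}$ has unit diagonal. Then for $k\ge0$, with pivot pair $(i,j)=(i(k),j(k))$, $i<j$, set $A^{(k+1)}=Z_k^*A^{(k)}Z_k$, $B^{(k+1)}=Z_k^*B^{(k)}Z_k$, where $Z_k$ equals $I_n$ except for its pivot submatrix (rows/columns $i,j$) $\hat Z_k=\hat C\hat J$ defined as follows. Write $a_{rs}=a^{(k)}_{rs}$, $b=b^{(k)}_{ij}$ and $\beta=\sqrt{1-|b|^2}$. If $a_{ii}\le a_{jj}$, $\hat C=\frac1\beta\begin{bmatrix}\beta&-b\\0&1\end{bmatrix}$ (inverse conjugate transpose of the Cholesky factor $\hat L$ of $\hat B=\hat L\hat L^*$, $\hat L$ lower triangular); if $a_{ii}>a_{jj}$,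 $\hat C=\frac1\beta\begin{bmatrix}1&0\\-\bar b&\beta\end{bmatrix}$ (from $\hat B=\hat R\hat R^*$, $\hat R$ upper triangular). Let $M=\hat C^*\hat A\hat C=(m_{rs})_{r,s=1}^2$ where $\hat A$ is the pivot submatrix of $A^{(k)}$. Then $\hat J=\begin{bmatrix}\cos\phi&-e^{\imath\alpha}\sin\phi\\ e^{-\imath\alpha}\sin\phi&\cos\phi\end{bmatrix}$ with $\alpha=\arg(m_{12})$ and $\phi\in[-\pi/4,\pi/4]$ satisfying $\tan(2\phi)=2|m_{12}|/(m_{11}-m_{22})$, chosen as $\phi=0$ when $m_{12}=0$ and $m_{11}=m_{22}$; thus $\hat J^*M\hat J$ is diagonal, and the pivot submatrix of $B^{(k+1)}$ is $I_2$. Pivot strategies: $\mathcal{P}_n=\{(r,s):1\le r<s\le n\}$, $N=n(n-1)/2$; an ordering is a sequence listing each element of $\mathcal{P}_n$ exactly once; for an ordering $\mathcal{O}=(i_0,j_0),\dots,(i_{N-1},j_{N-1})$, the cyclic strategy is $I_{\mathcal{O}}(k)=(i_{k\bmod N},j_{k\bmod N})$. An admissible transposition swaps two adjacent pairs with disjoint index sets; $\mathcal{O}\sim\mathcal{O}'$ if related by finitely many admissible transpositions; $\mathcal{O}\stackrel{\mathsf{s}}{\sim}\mathcal{O}'$ if $\mathcal{O}=[\mathcal{O}_1,\mathcal{O}_2]$, $\mathcal{O}'=[\mathcal{O}_2,\mathcal{O}_1]$; $\mathcal{O}\stackrel{\mathsf{w}}{\sim}\mathcal{O}'$ if there is a chain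 of orderings from $\mathcal{O}$ to $\mathcal{O}'$ with adjacent terms $\sim$ or $\stackrel{\mathsf{s}}{\sim}$, in canonical form if these alternate; $\mathcal{O}\stackrel{\mathsf{p}}{\sim}\mathcal{O}'$ if for a permutation $\mathsf{q}$ of $\{1,\dots,n\}$, $\mathcal{O}'$ arises by replacing each pair $(i_k,j_k)$ by the pair with entries $\mathsf{q}(i_k),\mathsf{q}(j_k)$ in increasing order. $\mathcal{C}_c^{(n)}$: orderings $(1,2),(\tau_3(1),3),(\tau_3(2),3),\dots,(\tau_n(1),n),\dots,(\tau_n(n-1),n)$, $\tau_j$ a permutation of $\{1,\dots,j-1\}$; $\mathcal{C}_r^{(n)}$: orderings $(n-1,n),(n-2,\tau_{n-2}(n-1)),(n-2,\tau_{n-2}(n)),\dots,(1,\tau_1(2)),\dots,(1,\tau_1(n))$, $\tau_i$ a permutation of $\{i+1,\dots,n\}$; $\overleftarrow{\mathcal{C}}_c^{(n)},\overleftarrow{\mathcal{C}}_r^{(n)}$ the sets of orderings whose reversed sequences lie in $\mathcal{C}_c^{(n)}$, $\mathcal{C}_r^{(n)}$; $\mathcal{C}_{sp}^{(n)}$ the union of these four sets. $\mathcal{C}_{sg}^{(n)}$ is the set of orderings $\mathcal{O}$ with $\mathcal{O}\stackrel{\mathsf{p}}{\sim}\mathcal{O}'\stackrel{\mathsf{w}}{\sim}\mathcal{O}''$ or $\mathcal{O}\stackrel{\mathsf{w}}{\sim}\mathcal{O}'\stackrel{\mathsf{p}}{\sim}\mathcal{O}''$ for some ordering $\mathcal{O}'$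 and some $\mathcal{O}''\in\mathcal{C}_{sp}^{(n)}$, weak equivalence in canonical form. *)

theory Defs
  imports Complex_Main "Jordan_Normal_Form.Determinant"
begin

text \<open>Square matrices of order n are represented as functions nat => nat => complex,
  indexed 1-based by i, j in {1..n}; entries outside that range are irrelevant.\<close>

type_synonym cmat = "nat \<Rightarrow> nat \<Rightarrow> complex"

definition mmult :: "nat \<Rightarrow> cmat \<Rightarrow> cmat \<Rightarrow> cmat" where
  "mmult n X Y = (\<lambda>i j. \<Sum>k = 1..n. X i k * Y k j)"

definition cadj :: "cmat \<Rightarrow> cmat" where
  "cadj X = (\<lambda>i j. cnj (X j i))"

definition idm :: cmat where
  "idm = (\<lambda>i j. if i = j then 1 else 0)"

definition cdet :: "nat \<Rightarrow> cmat \<Rightarrow> complex" where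
  "cdet n X = Determinant.det (mat n n (\<lambda>(i, j). X (Suc i) (Suc j)))"

definition hermitian_n :: "nat \<Rightarrow> cmat \<Rightarrow> bool" where
  "hermitian_n n A \<longleftrightarrow> (\<forall>i\<in>{1..n}. \<forall>j\<in>{1..n}. A j i = cnj (A i j))"

definition pos_def_n :: "nat \<Rightarrow> cmat \<Rightarrow> bool" where
  "pos_def_n n B \<longleftrightarrow> hermitian_n n B \<and>
     (\<forall>x :: nat \<Rightarrow> complex. (\<exists>i\<in>{1..n}. x i \<noteq> 0) \<longrightarrow>
        0 < Re (\<Sum>i = 1..n. \<Sum>j = 1..n. cnj (x i) * B i j * x j))"

definition is_diagonal_n :: "nat \<Rightarrow> cmat \<Rightarrow> bool" where
  "is_diagonal_n n L \<longleftrightarrow> (\<forall>i\<in>{1..n}. \<forall>j\<in>{1..n}. i \<noteq> j \<longrightarrow> L i j = 0)"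

text \<open>Lambda is a diagonal matrix of the eigenvalues (with multiplicities) of the pencil (A,B):
  its diagonal entries are the roots of det(A - lambda B) = det B * prod (Lambda_ii - lambda).\<close>
definition diag_of_eigenvalues :: "nat \<Rightarrow> cmat \<Rightarrow> cmat \<Rightarrow> cmat \<Rightarrow> bool" where
  "diag_of_eigenvalues n A B L \<longleftrightarrow> is_diagonal_n n L \<and>
     (\<forall>z::complex. cdet n (\<lambda>i j. A i j - z * B i j) = cdet n B * (\<Prod>i = 1..n. (L i i - z)))"

definition cj_scale :: "cmat \<Rightarrow> cmat \<Rightarrow> cmat" where
  "cj_scale B M = (\<lambda>i j. M i j / (complex_of_real (sqrt (Re (B i i))) * complex_of_real (sqrt (Re (B j j)))))"

definition cj_C :: "cmat \<Rightarrow> cmat \<Rightarrow> nat \<Rightarrow> nat \<Rightarrow> complex \<times> complex \<times> complex \<times> complex" where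
  "cj_C A B i j =
    (let b = B i j; \<beta> = complex_of_real (sqrt (1 - (cmod b)\<^sup>2)) in
     if Re (A i i) \<le> Re (A j j) then (1, - b / \<beta>, 0, 1 / \<beta>)
     else (1 / \<beta>, 0, - cnj b / \<beta>, 1))"

definition cj_M :: "cmat \<Rightarrow> cmat \<Rightarrow> nat \<Rightarrow> nat \<Rightarrow> complex \<times> complex \<times> complex \<times> complex" where
  "cj_M A B i j =
    (case cj_C A B i j of (c11, c12, c21, c22) \<Rightarrow>
     let a11 = A i i; a12 = A i j; a21 = A j i; a22 = A j j;
         t11 = a11 * c11 + a12 * c21; t12 = a11 * c12 + a12 * c22;
         t21 = a21 * c11 + a22 * c21; t22 = a21 * c12 + a22 * c22
     in (cnj c11 * t11 + cnj c21 * t21, cnj c11 * t12 + cnj c21 * t22,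
         cnj c12 * t11 + cnj c22 * t21, cnj c12 * t12 + cnj c22 * t22))"

definition cj_phi :: "complex \<Rightarrow> complex \<Rightarrow> complex \<Rightarrow> real" where
  "cj_phi m11 m12 m22 =
    (if Re m11 = Re m22 then (if m12 = 0 then 0 else pi / 4)
     else arctan (2 * cmod m12 / (Re m11 - Re m22)) / 2)"

definition cj_Zhat :: "cmat \<Rightarrow> cmat \<Rightarrow> nat \<Rightarrow> nat \<Rightarrow> complex \<times> complex \<times> complex \<times> complex" where
  "cj_Zhat A B i j =
    (case cj_C A B i j of (c11, c12, c21, c22) \<Rightarrow>
     case cj_M A B i j of (m11, m12, m21, m22) \<Rightarrow>
     let \<alpha> = Arg m12; \<phi> = cj_phi m11 m12 m22;
         co = complex_of_real (cos \<phi>); si = complex_of_real (sin \<phi>);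
         j11 = co; j12 = - cis \<alpha> * si; j21 = cis (- \<alpha>) * si; j22 = co
     in (c11 * j11 + c12 * j21, c11 * j12 + c12 * j22,
         c21 * j11 + c22 * j21, c21 * j12 + c22 * j22))"

definition cj_Z :: "cmat \<Rightarrow> cmat \<Rightarrow> nat \<Rightarrow> nat \<Rightarrow> cmat" where
  "cj_Z A B i j =
    (case cj_Zhat A B i j of (z11, z12, z21, z22) \<Rightarrow>
      (\<lambda>r s. if r = i \<and> s = i then z11 else if r = i \<and> s = j then z12
             else if r = j \<and> s = i then z21 else if r = j \<and> s = j then z22
             else if r = s then 1 else 0))"

definition cj_step :: "nat \<Rightarrow> nat \<times> nat \<Rightarrow> cmat \<times> cmat \<Rightarrow> cmat \<times> cmat" where
  "cj_step n p AB =
    (case p of (i, j) \<Rightarrow> case AB of (A, B) \<Rightarrow>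
      let Z = cj_Z A B i j in
      (mmult n (mmult n (cadj Z) A) Z, mmult n (mmult n (cadj Z) B) Z))"

primrec cj_seq :: "nat \<Rightarrow> (nat \<Rightarrow> nat \<times> nat) \<Rightarrow> cmat \<Rightarrow> cmat \<Rightarrow> nat \<Rightarrow> cmat \<times> cmat" where
  "cj_seq n I A B 0 = (cj_scale B A, cj_scale B B)"
| "cj_seq n I A B (Suc k) = cj_step n (I k) (cj_seq n I A B k)"

definition pivot_set :: "nat \<Rightarrow> (nat \<times> nat) set" where
  "pivot_set n = {(r, s). 1 \<le> r \<and> r < s \<and> s \<le> n}"

definition is_ordering :: "nat \<Rightarrow> (nat \<times> nat) list \<Rightarrow> bool" where
  "is_ordering n Q \<longleftrightarrow> distinct Q \<and> set Q = pivot_set n"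

definition cyclic_strategy :: "(nat \<times> nat) list \<Rightarrow> nat \<Rightarrow> nat \<times> nat" where
  "cyclic_strategy Q k = Q ! (k mod length Q)"

definition adm_transposition :: "(nat \<times> nat) list \<Rightarrow> (nat \<times> nat) list \<Rightarrow> bool" where
  "adm_transposition Q Q1 \<longleftrightarrow> (\<exists>k. Suc k < length Q \<and>
      {fst (Q ! k), snd (Q ! k)} \<inter> {fst (Q ! Suc k), snd (Q ! Suc k)} = {} \<and>
      Q1 = Q[k := Q ! Suc k, Suc k := Q ! k])"

definition equiv_ord :: "(nat \<times> nat) list \<Rightarrow> (nat \<times> nat) list \<Rightarrow> bool" where
  "equiv_ord = adm_transposition\<^sup>*\<^sup>*"

definition shift_equiv :: "(nat \<times> nat) list \<Rightarrow> (nat \<times> nat) list \<Rightarrow> bool" where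
  "shift_equiv Q Q1 \<longleftrightarrow> (\<exists>P1 P2. Q = P1 @ P2 \<and> Q1 = P2 @ P1)"

text \<open>Weak equivalence in canonical form: a chain of orderings whose adjacent terms are
  alternately equivalent and shift-equivalent (both relations are reflexive, so a chain
  starting with a shift step is covered by a trivial first equivalence step).\<close>
definition weak_equiv_canon :: "nat \<Rightarrow> (nat \<times> nat) list \<Rightarrow> (nat \<times> nat) list \<Rightarrow> bool" where
  "weak_equiv_canon n Q Q1 \<longleftrightarrow> (\<exists>cs. cs \<noteq> [] \<and> hd cs = Q \<and> last cs = Q1 \<and>
      (\<forall>c\<in>set cs. is_ordering n c) \<and>
      (\<forall>t. Suc t < length cs \<longrightarrow>
         (if even t then equiv_ord (cs ! t) (cs ! Suc t) else shift_equiv (cs ! t) (cs ! Suc t))))"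

definition perm_equiv :: "nat \<Rightarrow> (nat \<times> nat) list \<Rightarrow> (nat \<times> nat) list \<Rightarrow> bool" where
  "perm_equiv n Q Q1 \<longleftrightarrow> (\<exists>q. bij_betw q {1..n} {1..n} \<and>
      Q1 = map (\<lambda>(i, j). (min (q i) (q j), max (q i) (q j))) Q)"

definition C_c :: "nat \<Rightarrow> (nat \<times> nat) list set" where
  "C_c n = {Q. \<exists>\<tau>. (\<forall>j\<in>{2..n}. bij_betw (\<tau> j) {1..j - 1} {1..j - 1}) \<and>
      Q = concat (map (\<lambda>j. map (\<lambda>r. (\<tau> j r, j)) [1..<j]) [2..<Suc n])}"

definition C_r :: "nat \<Rightarrow> (nat \<times> nat) list set" where
  "C_r n = {Q. \<exists>\<tau>. (\<forall>i\<in>{1..n - 1}. bij_betw (\<tau> i) {i + 1..n} {i + 1..n}) \<and>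
      Q = concat (map (\<lambda>i. map (\<lambda>s. (i, \<tau> i s)) [Suc i..<Suc n]) (rev [1..<n]))}"

definition C_sp :: "nat \<Rightarrow> (nat \<times> nat) list set" where
  "C_sp n = C_c n \<union> C_r n \<union> {Q. rev Q \<in> C_c n} \<union> {Q. rev Q \<in> C_r n}"

definition C_sg :: "nat \<Rightarrow> (nat \<times> nat) list set" where
  "C_sg n = {Q. is_ordering n Q \<and>
      (\<exists>Q1 Q2. Q2 \<in> C_sp n \<and>
         ((perm_equiv n Q Q1 \<and> weak_equiv_canon n Q1 Q2) \<or>
          (weak_equiv_canon n Q Q1 \<and> perm_equiv n Q1 Q2)))}"

end

theory Submission
  imports Defs "HOL-Computational_Algebra.Fundamental_Theorem_Algebra"
begin

text \<open>
  A step divides the determinant of \<open>B\<close> by \<open>1 - \<bar>b\<bar>\<^sup>2\<close>, where \<open>b\<close> is the pivot entry. As \<open>B\<close> keeps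
  its unit diagonal, the determinants stay bounded, hence the pivots \<open>b\<close> tend to zero and the
  transformations become asymptotically unitary, with diagonal entries bounded away from zero.
  Both \<open>A\<close> and \<open>B\<close> thus follow an asymptotically unitary Jacobi process in which each step
  annihilates the pivot entry, and such a process drives the off-norm to zero: otherwise a limit
  of windows of the process would be a nondiagonal \<^emph>\<open>flat\<close> sequence, that is, a sequence of plane
  congruences whose pivot entries vanish before and after every step.

  Flat sequences are diagonal for the serial orderings. When a new index \<open>w\<close> is paired with
  all indices of a set on which the matrix is already diagonal, the entries of column \<open>w\<close> are only
  multiplied by nonzero numbers until they become pivots, so they all vanish. Flatness is
  invariant under time reversal, relabelling of indices, and the exchange of disjoint pivots,
  which together with shifting the window gives all generalized serial orderings.

  Finally, the limit points of the diagonal of \<open>A\<close> lie in the finite set of eigenvalues, because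
  the pencil determinants are preserved up to a factor, and the diagonal increments tend to zero.
\<close>

section \<open>Flat sequences of plane congruences\<close>

text \<open>Two obstacles shape the proof. The blocks are not unitary, so the off-norm of the
  iterates of \<open>A\<close> need not decrease; this is why the pivots of \<open>B\<close> are
  driven to zero before any off-norm is looked at. And \<open>C_sg\<close> contains orderings of
  very different kinds, for which quantitative estimates per cycle would be laborious; compactness
  replaces such estimates by a question about exact zeros, at the price of giving no rate. The
  nonzero diagonal of the blocks comes from the restriction of \<phi> to [-pi/4, pi/4], which keeps
  cos \<phi> at or above sqrt 2 / 2. A block with zero diagonal interchanges two indices, and so
  could carry a nonzero entry away from the position that is about to become the pivot. The same
  restriction keeps eigenvalues from changing places on the diagonal in the end: once the
  off-diagonal entries are negligible, a step between well separated diagonal entries has one of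
  \<open>a\<close>, \<open>c\<close> and one of \<open>b\<close>, \<open>d\<close> close to zero,
  and the lower bound on the diagonal decides that these are \<open>c\<close> and
  \<open>b\<close>.\<close>

definition pcong :: "complex \<Rightarrow> complex \<Rightarrow> complex \<Rightarrow> complex \<Rightarrow> nat \<Rightarrow> nat \<Rightarrow> cmat \<Rightarrow> cmat" where
  "pcong a b c d p q X = (\<lambda>r s.
     let Y = (\<lambda>r. if s = p then X r p * a + X r q * c
                  else if s = q then X r p * b + X r q * d else X r s)
     in if r = p then cnj a * Y p + cnj c * Y q
        else if r = q then cnj b * Y p + cnj d * Y q else Y r)"

text \<open>Symmetry is asked of all index pairs, not of 1..n only, because \<open>pcong\<close>
  acts on functions over all pairs of naturals. Limit matrices are made to fit by setting them to
  zero outside the index range.\<close>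

definition herm :: "cmat \<Rightarrow> bool" where
  "herm X \<longleftrightarrow> (\<forall>r s. X s r = cnj (X r s))"

definition diag_on :: "nat set \<Rightarrow> cmat \<Rightarrow> bool" where
  "diag_on T X \<longleftrightarrow> (\<forall>r\<in>T. \<forall>s\<in>T. r \<noteq> s \<longrightarrow> X r s = 0)"

text \<open>This is what a step becomes in the limit of windows that lose no off-norm: the step
  annihilates its pivot, and a loss of zero means that the pivot was zero before. Of the block,
  \<open>d \<noteq> 0\<close> drives \<open>flat_star_column\<close>; reversal and exchange of
  \<open>p\<close> and \<open>q\<close> turn this condition into \<open>a \<noteq> 0\<close>, so
  both are included.\<close>

definition flat_step :: "nat \<times> nat \<Rightarrow> cmat \<Rightarrow> cmat \<Rightarrow> bool" where
  "flat_step pq X Y \<longleftrightarrow> (case pq of (p, q) \<Rightarrow> p \<noteq> q \<and> herm X \<and> X p q = 0 \<and> Y p q = 0 \<and>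
     (\<exists>a b c d. a \<noteq> 0 \<and> d \<noteq> 0 \<and> a * d - b * c \<noteq> 0 \<and> Y = pcong a b c d p q X))"

primrec flat :: "(nat \<times> nat) list \<Rightarrow> cmat \<Rightarrow> cmat \<Rightarrow> bool" where
  "flat [] X Y \<longleftrightarrow> X = Y"
| "flat (e # P) X Y \<longleftrightarrow> (\<exists>W. flat_step e X W \<and> flat P W Y)"

lemma flat_stepI:
  assumes "p \<noteq> q" "herm X" "X p q = 0" "Y p q = 0" "a \<noteq> 0" "d \<noteq> 0" "a * d - b * c \<noteq> 0"
    and "Y = pcong a b c d p q X"
  shows "flat_step (p, q) X Y"
  unfolding flat_step_def prod.case using assms by blast

lemma hermD: "herm X \<Longrightarrow> X s r = cnj (X r s)"
  unfolding herm_def by blast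

lemma herm_pcong:
  assumes "herm X"
  shows "herm (pcong a b c d p q X)"
proof -
  have "cnj (X r s) = X s r" for r s
    using hermD[OF assms, of s r] by simp
  then have "pcong a b c d p q X s r = cnj (pcong a b c d p q X r s)" for r s
    unfolding pcong_def Let_def by (auto simp: algebra_simps)
  then show ?thesis unfolding herm_def by blast
qed

text \<open>The inverse block is the adjugate divided by the determinant. The identities for rows
  are conjugates of those for columns.\<close>

lemma pcong_inverse:
  assumes "p \<noteq> q" "a * d - b * c \<noteq> 0"
  defines "D \<equiv> a * d - b * c"
  shows "pcong (d / D) (- b / D) (- c / D) (a / D) p q (pcong a b c d p q X) = X"
proof -
  have D: "D \<noteq> 0" using assms by simp
  have col1: "(x * a + y * c) * (d / D) + (x * b + y * d) * (- c / D) = x"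
    and col2: "(x * a + y * c) * (- b / D) + (x * b + y * d) * (a / D) = y" for x y
    using D by (simp_all add: field_simps) (simp_all add: D_def algebra_simps)
  have row1: "cnj (d / D) * (cnj a * x + cnj c * y) + cnj (- c / D) * (cnj b * x + cnj d * y) = x"
    and row2: "cnj (- b / D) * (cnj a * x + cnj c * y) + cnj (a / D) * (cnj b * x + cnj d * y) = y"
    for x y
    using arg_cong[OF col1[of "cnj x" "cnj y"], of cnj] arg_cong[OF col2[of "cnj x" "cnj y"], of cnj]
    by (simp_all add: algebra_simps)
  define Y where "Y = (\<lambda>r s. if s = p then X r p * a + X r q * c
                  else if s = q then X r p * b + X r q * d else X r s)"
  define W where "W = pcong a b c d p q X"
  have W: "W r s = (if r = p then cnj a * Y p s + cnj c * Y q s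
        else if r = q then cnj b * Y p s + cnj d * Y q s else Y r s)" for r s
    unfolding W_def pcong_def Y_def Let_def by simp
  \<comment> \<open>A congruence acts on columns and on rows independently: \<open>V\<close> undoes
    the column half on \<open>W\<close>, and what remains is \<open>X\<close> with the row half
    alone.\<close>
  define V where "V = (\<lambda>r s. if s = p then W r p * (d / D) + W r q * (- c / D)
                  else if s = q then W r p * (- b / D) + W r q * (a / D) else W r s)"
  have V: "V r s = (if r = p then cnj a * X p s + cnj c * X q s
        else if r = q then cnj b * X p s + cnj d * X q s else X r s)" for r s
  proof -
    have Yp: "Y r p = X r p * a + X r q * c" and Yq: "Y r q = X r p * b + X r q * d" for r
      using assms(1) by (auto simp: Y_def)
    have Wp: "W r p = (if r = p then cnj a * X p p + cnj c * X q p
        else if r = q then cnj b * X p p + cnj d * X q p else X r p) * a +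
        (if r = p then cnj a * X p q + cnj c * X q q
        else if r = q then cnj b * X p q + cnj d * X q q else X r q) * c"
      and Wq: "W r q = (if r = p then cnj a * X p p + cnj c * X q p
        else if r = q then cnj b * X p p + cnj d * X q p else X r p) * b +
        (if r = p then cnj a * X p q + cnj c * X q q
        else if r = q then cnj b * X p q + cnj d * X q q else X r q) * d"
      unfolding W Yp Yq by (simp_all add: algebra_simps)
    consider "s = p" | "s = q" "s \<noteq> p" | "s \<noteq> p" "s \<noteq> q" by blast
    then show ?thesis
    proof cases
      case 1 then show ?thesis unfolding V_def Wp Wq by (simp only: col1 if_True refl)
    next
      case 2
      then have "V r s = W r p * (- b / D) + W r q * (a / D)" by (simp add: V_def)
      then show ?thesis unfolding Wp Wq by (simp only: col2 2(1))
    next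
      case 3 then show ?thesis unfolding V_def W Y_def by simp
    qed
  qed
  have "pcong (d / D) (- b / D) (- c / D) (a / D) p q W r s = X r s" for r s
  proof -
    have "pcong (d / D) (- b / D) (- c / D) (a / D) p q W r s =
      (if r = p then cnj (d/D) * V p s + cnj (-c/D) * V q s
        else if r = q then cnj (-b/D) * V p s + cnj (a/D) * V q s else V r s)"
      unfolding pcong_def V_def Let_def by simp
    also have "\<dots> = X r s"
    proof -
      consider "r = p" | "r = q" "r \<noteq> p" | "r \<noteq> p" "r \<noteq> q" by blast
      then show ?thesis
      proof cases
        case 1
        then have "V p s = cnj a * X p s + cnj c * X q s" "V q s = cnj b * X p s + cnj d * X q s"
          using assms(1) by (simp_all add: V)
        then show ?thesis using 1 row1 by (simp only: if_True refl)
      next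
        case 2
        then have "V p s = cnj a * X p s + cnj c * X q s" "V q s = cnj b * X p s + cnj d * X q s"
          using assms(1) by (simp_all add: V)
        then show ?thesis using 2 row2 by (simp only: if_True if_False refl)
      next
        case 3 then show ?thesis by (simp add: V)
      qed
    qed
    finally show ?thesis .
  qed
  then show ?thesis unfolding W_def by blast
qed

lemma pcong_commute:
  assumes "p \<noteq> q" "p' \<noteq> q'" "{p, q} \<inter> {p', q'} = {}"
  shows "pcong a b c d p q (pcong a' b' c' d' p' q' X) =
    pcong a' b' c' d' p' q' (pcong a b c d p q X)"
proof (intro ext)
  fix r s
  have ne: "p \<noteq> q" "q \<noteq> p" "p' \<noteq> q'" "q' \<noteq> p'" "p \<noteq> p'" "p' \<noteq> p" "p \<noteq> q'" "q' \<noteq> p"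
    "q \<noteq> p'" "p' \<noteq> q" "q \<noteq> q'" "q' \<noteq> q"
    using assms by auto
  have "r = p \<or> r = q \<or> r = p' \<or> r = q' \<or> r \<noteq> p \<and> r \<noteq> q \<and> r \<noteq> p' \<and> r \<noteq> q'"
    "s = p \<or> s = q \<or> s = p' \<or> s = q' \<or> s \<noteq> p \<and> s \<noteq> q \<and> s \<noteq> p' \<and> s \<noteq> q'" by blast+
  then show "pcong a b c d p q (pcong a' b' c' d' p' q' X) r s =
    pcong a' b' c' d' p' q' (pcong a b c d p q X) r s"
    by (elim disjE) (simp_all add: pcong_def Let_def ne algebra_simps)
qed

lemma pcong_swap:
  "p \<noteq> q \<Longrightarrow> pcong d c b a q p X = pcong a b c d p q X"
  unfolding pcong_def Let_def by (auto simp: fun_eq_iff add.commute)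

lemma pcong_outside: "r \<notin> {p, q} \<Longrightarrow> s \<notin> {p, q} \<Longrightarrow> pcong a b c d p q X r s = X r s"
  unfolding pcong_def Let_def by auto

lemma pcong_col1: "r \<notin> {p, q} \<Longrightarrow> pcong a b c d p q X r p = X r p * a + X r q * c"
  unfolding pcong_def Let_def by auto

lemma pcong_col2: "p \<noteq> q \<Longrightarrow> r \<notin> {p, q} \<Longrightarrow> pcong a b c d p q X r q = X r p * b + X r q * d"
  unfolding pcong_def Let_def by auto

section \<open>Symmetries of flat steps and flat sequences\<close>

lemma flat_step_herm: "flat_step e X Y \<Longrightarrow> herm X \<and> herm Y"
  unfolding flat_step_def by (auto simp: herm_pcong)

text \<open>The two conditions on the pivot exchange their roles, and the inverse block has the
  diagonal entries d / D and a / D with D the determinant, so the nonvanishing conditions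
  persist.\<close>

lemma flat_step_sym: "flat_step e X Y \<Longrightarrow> flat_step e Y X"
proof -
  assume "flat_step e X Y"
  then obtain p q a b c d where e: "e = (p, q)" and pq: "p \<noteq> q" and h: "herm X" "X p q = 0" "Y p q = 0"
    and u: "a \<noteq> 0" "d \<noteq> 0" "a * d - b * c \<noteq> 0" and Y: "Y = pcong a b c d p q X"
    unfolding flat_step_def by (cases e) auto
  let ?D = "a * d - b * c"
  have "X = pcong (d / ?D) (- b / ?D) (- c / ?D) (a / ?D) p q Y"
    unfolding Y using pcong_inverse[OF pq u(3)] by simp
  moreover have "d / ?D \<noteq> 0" "a / ?D \<noteq> 0" using u by auto
  moreover have "(d / ?D) * (a / ?D) - (- b / ?D) * (- c / ?D) \<noteq> 0"
  proof -
    have "(d / ?D) * (a / ?D) - (- b / ?D) * (- c / ?D) = (d * a - b * c) / (?D * ?D)"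
      by (simp add: diff_divide_distrib)
    also have "\<dots> \<noteq> 0" using u(3) by (simp add: mult.commute)
    finally show ?thesis .
  qed
  ultimately show ?thesis
    using pq h herm_pcong[OF h(1)] Y unfolding e by (intro flat_stepI) auto
qed

lemma flat_step_swap: "flat_step (p, q) X Y \<longleftrightarrow> flat_step (q, p) X Y"
proof -
  have "flat_step (q, p) X Y" if H: "flat_step (p, q) X Y" for p q
  proof -
    obtain a b c d where pq: "p \<noteq> q" and h: "herm X" "X p q = 0" "Y p q = 0"
      and u: "a \<noteq> 0" "d \<noteq> 0" "a * d - b * c \<noteq> 0" and Y: "Y = pcong a b c d p q X"
      using H unfolding flat_step_def by auto
    have "Y = pcong d c b a q p X" using pcong_swap[OF pq] Y by simp
    moreover have "X q p = 0" "Y q p = 0"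
      using hermD[OF h(1), of q p] hermD[of Y q p] flat_step_herm[OF H] h by auto
    moreover have "d * a - c * b \<noteq> 0" using u by (simp add: mult.commute)
    ultimately show ?thesis unfolding flat_step_def using pq h(1) u by auto
  qed
  then show ?thesis by blast
qed

lemma flat_append: "flat (P @ P') X Y \<longleftrightarrow> (\<exists>W. flat P X W \<and> flat P' W Y)"
  by (induction P arbitrary: X) auto

lemma flat_rev: "flat (rev P) X Y \<Longrightarrow> flat P Y X"
proof (induction P arbitrary: Y)
  case Nil
  then show ?case by simp
next
  case (Cons e P)
  then obtain W where "flat (rev P) X W" "flat_step e W Y"
    by (auto simp: flat_append)
  then have "flat_step e Y W" "flat P W X" using Cons.IH flat_step_sym by blast+
  then show ?case by auto
qed

text \<open>Row orderings put the new index \<open>w\<close> first in each pair, whereas the star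
  argument expects it in second place.\<close>

lemma flat_map_swap: "flat (map (\<lambda>r. (w, f r)) L) X Y \<Longrightarrow> flat (map (\<lambda>r. (f r, w)) L) X Y"
proof (induction L arbitrary: X)
  case (Cons r L)
  then obtain W where "flat_step (w, f r) X W" "flat (map (\<lambda>r. (w, f r)) L) W Y" by auto
  then have "flat_step (f r, w) X W" "flat (map (\<lambda>r. (f r, w)) L) W Y"
    using Cons.IH flat_step_swap by blast+
  then show ?case by auto
qed simp

text \<open>For a row of \<open>T\<close> outside the pivot, the new entries in columns
  \<open>p\<close> and \<open>q\<close> combine entries that are already zero. Only the pivot
  position itself could fill in, and flatness forbids it.\<close>

lemma flat_step_diag_on:
  assumes st: "flat_step (p, q) X Y" and T: "p \<in> T" "q \<in> T" and X: "diag_on T X"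
  shows "diag_on T Y"
proof -
  obtain a b c d where pq: "p \<noteq> q" and Ypq: "Y p q = 0" and Y: "Y = pcong a b c d p q X"
    using st unfolding flat_step_def by auto
  have hY: "herm Y" using flat_step_herm[OF st] by simp
  have X0: "X r s = 0" if "r \<in> T" "s \<in> T" "r \<noteq> s" for r s
    using X that unfolding diag_on_def by blast
  have out: "Y r p = 0" "Y r q = 0" if "r \<in> T" "r \<notin> {p, q}" for r
    using that T pq X0 unfolding Y by (auto simp: pcong_col1 pcong_col2)
  have "Y r s = 0" if rs: "r \<in> T" "s \<in> T" "r \<noteq> s" for r s
  proof -
    consider "r \<notin> {p, q}" "s \<notin> {p, q}" | "r \<notin> {p, q}" "s \<in> {p, q}"
      | "r \<in> {p, q}" "s \<notin> {p, q}" | "r \<in> {p, q}" "s \<in> {p, q}" by blast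
    then show ?thesis
    proof cases
      case 1 then show ?thesis using X0[OF rs] unfolding Y by (subst pcong_outside) auto
    next
      case 2 then show ?thesis using out rs by auto
    next
      case 3 then show ?thesis using out[of s] rs hermD[OF hY, of r s] by auto
    next
      case 4 then show ?thesis using rs Ypq hermD[OF hY, of q p] by auto
    qed
  qed
  then show ?thesis unfolding diag_on_def by blast
qed

lemma flat_diag_on:
  assumes "flat P X Y" "\<forall>(p, q)\<in>set P. p \<in> T \<and> q \<in> T" "diag_on T X"
  shows "diag_on T Y"
  using assms by (induction P arbitrary: X) (auto intro: flat_step_diag_on)

lemma flat_diag_on_back:
  assumes "flat P X Y" "\<forall>(p, q)\<in>set P. p \<in> T \<and> q \<in> T" "diag_on T Y"
  shows "diag_on T X"
  using flat_diag_on[of "rev P" Y X T] flat_rev[of "rev P" X Y] assms by simp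

text \<open>Along such a block, the entries of column \<open>w\<close> that have not yet been pivots are only
  multiplied by the nonzero number \<open>d\<close>; as each of them vanishes on its turn, all of them
  vanish from the start.\<close>

lemma flat_star_column:
  assumes "flat (map (\<lambda>r. (r, w)) L) X Y" "distinct L" "w \<notin> set L" "diag_on (set L) X" "r \<in> set L"
  shows "X r w = 0"
  using assms
proof (induction L arbitrary: X r)
  case Nil
  then show ?case by simp
next
  case (Cons p L)
  then obtain W where st: "flat_step (p, w) X W" and fl: "flat (map (\<lambda>r. (r, w)) L) W Y" by auto
  obtain a b c d where pw: "p \<noteq> w" "X p w = 0" "d \<noteq> 0" and W: "W = pcong a b c d p w X"
    using st unfolding flat_step_def by auto
  show ?case
  proof (cases "r = p")
    case True
    then show ?thesis using pw by simp
  next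
    case False
    then have r: "r \<in> set L" using Cons.prems by simp
    have "diag_on (set L) W"
      unfolding diag_on_def
    proof (intro ballI impI)
      fix i j assume ij: "i \<in> set L" "j \<in> set L" "i \<noteq> j"
      then have "i \<notin> {p, w}" "j \<notin> {p, w}" using Cons.prems by auto
      then show "W i j = 0"
        unfolding W using Cons.prems(4) ij by (simp add: pcong_outside diag_on_def)
    qed
    then have "W r w = 0" using Cons.IH[OF fl] Cons.prems r by auto
    moreover have "r \<notin> {p, w}" using Cons.prems r False by auto
    ultimately have "X r p * b + X r w * d = 0" unfolding W by (simp add: pcong_col2 pw)
    \<comment> \<open>Diagonality of \<open>X\<close> on the block removes the contribution of
      column \<open>p\<close>, so that \<open>X r w * d = 0\<close> is left.\<close>
    moreover have "X r p = 0" using Cons.prems(4) r False unfolding diag_on_def by auto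
    ultimately show ?thesis using pw by simp
  qed
qed

text \<open>Column \<open>w\<close> vanishes at the start of the block, so \<open>X\<close> is
  already diagonal on the enlarged set, and flat steps with pivots inside that set keep it
  so.\<close>

lemma flat_star:
  assumes fl: "flat (map (\<lambda>r. (r, w)) L) X Y" and L: "distinct L" "w \<notin> set L"
    and X: "diag_on (set L) X"
  shows "diag_on (insert w (set L)) Y"
\<comment> \<open>The symmetry of \<open>X\<close> is read off from the first step, so the empty
  block is treated apart.\<close>
proof (cases "L = []")
  case True
  then show ?thesis by (simp add: diag_on_def)
next
  case False
  then obtain p L' where "L = p # L'" by (cases L) auto
  then have hX: "herm X" using fl flat_step_herm by auto
  have "X r w = 0" "X w r = 0" if "r \<in> set L" for r
    using flat_star_column[OF fl L X that] hermD[OF hX, of w r] by auto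
  then have "diag_on (insert w (set L)) X"
    using X unfolding diag_on_def by blast
  then show ?thesis using flat_diag_on[OF fl] by auto
qed

text \<open>Block \<open>j\<close> pairs the new index \<open>j\<close> with all of 1..j-1, so by
  \<open>flat_star\<close> each block enlarges the diagonal part by one index, in whatever order
  \<tau> lists the partners.\<close>

lemma flat_column_blocks:
  assumes "\<forall>j\<in>{2..n}. bij_betw (\<tau> j) {1..j - 1} {1..j - 1}"
    and "flat (concat (map (\<lambda>j. map (\<lambda>r. (\<tau> j r, j)) [1..<j]) [2..<Suc n])) X Y"
  shows "diag_on {1..n} Y"
  using assms
proof (induction n arbitrary: Y)
  case 0
  then show ?case by (simp add: diag_on_def)
next
  case (Suc n)
  show ?case
  proof (cases "n = 0")
    case True
    then show ?thesis by (simp add: diag_on_def)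
  next
    case False
    then have "[2..<Suc (Suc n)] = [2..<Suc n] @ [Suc n]" by simp
    then obtain W where W: "flat (concat (map (\<lambda>j. map (\<lambda>r. (\<tau> j r, j)) [1..<j]) [2..<Suc n])) X W"
      and WY: "flat (map (\<lambda>r. (\<tau> (Suc n) r, Suc n)) [1..<Suc n]) W Y"
      using Suc.prems(2) by (auto simp: flat_append simp del: upt_Suc)
    have dW: "diag_on {1..n} W" using Suc.IH[OF _ W] Suc.prems(1) by auto
    have bij: "bij_betw (\<tau> (Suc n)) {1..n} {1..n}"
      using Suc.prems(1)[rule_format, of "Suc n"] False by auto
    let ?L = "map (\<tau> (Suc n)) [1..<Suc n]"
    have eq: "set [1..<Suc n] = {1..n}" by auto
    have sL: "set ?L = {1..n}" using bij eq unfolding bij_betw_def by (metis set_map)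
    have dL: "distinct ?L" using bij eq unfolding bij_betw_def by (simp add: distinct_map del: upt_Suc)
    have "flat (map (\<lambda>r. (r, Suc n)) ?L) W Y" using WY by (simp add: comp_def del: upt_Suc)
    from flat_star[OF this dL] sL dW have "diag_on (insert (Suc n) {1..n}) Y" by auto
    moreover have "insert (Suc n) {1..n} = {1..Suc n}" by auto
    ultimately show ?thesis by simp
  qed
qed

text \<open>The mirror image of the column case: rows are treated from n-1 upwards to
  \<open>m\<close>, and the diagonal part {m..n} grows at its lower end. The variable
  \<open>m\<close> is there for the induction; \<open>m = 1\<close> is the full ordering.\<close>

lemma flat_row_blocks:
  assumes "\<forall>i\<in>{1..n - 1}. bij_betw (\<tau> i) {i + 1..n} {i + 1..n}"
    and "flat (concat (map (\<lambda>i. map (\<lambda>s. (i, \<tau> i s)) [Suc i..<Suc n]) (rev [m..<n]))) X Y"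
    and "1 \<le> m" "m \<le> n"
  shows "diag_on {m..n} Y"
  using assms(4,3,2)
proof (induction m arbitrary: Y rule: inc_induct)
  case base
  then show ?case by (simp add: diag_on_def)
next
  case (step m)
  have "rev [m..<n] = rev [Suc m..<n] @ [m]" using step.hyps by (simp add: upt_conv_Cons)
  then obtain W where W: "flat (concat (map (\<lambda>i. map (\<lambda>s. (i, \<tau> i s)) [Suc i..<Suc n]) (rev [Suc m..<n]))) X W"
      and WY: "flat (map (\<lambda>s. (m, \<tau> m s)) [Suc m..<Suc n]) W Y"
    using step.prems(2) by (auto simp: flat_append simp del: upt_Suc)
  have dW: "diag_on {Suc m..n} W" using step.IH[OF _ W] by auto
  have bij: "bij_betw (\<tau> m) {Suc m..n} {Suc m..n}"
    using assms(1)[rule_format, of m] step.hyps step.prems by auto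
  let ?L = "map (\<tau> m) [Suc m..<Suc n]"
  have eq: "set [Suc m..<Suc n] = {Suc m..n}" by auto
  have sL: "set ?L = {Suc m..n}" using bij eq unfolding bij_betw_def by (metis set_map)
  have dL: "distinct ?L" using bij eq unfolding bij_betw_def by (simp add: distinct_map del: upt_Suc)
  have "flat (map (\<lambda>r. (r, m)) ?L) W Y"
    using flat_map_swap[OF WY] by (simp add: comp_def del: upt_Suc)
  from flat_star[OF this dL] sL dW have "diag_on (insert m {Suc m..n}) Y" by auto
  moreover have "insert m {Suc m..n} = {m..n}" using step.hyps by auto
  ultimately show ?case by simp
qed

text \<open>Plane congruences with disjoint pivots commute, and neither changes the pivot entry of
  the other. Hence all four zero conditions are the same in either order.\<close>

lemma flat_transposition:
  assumes "{fst e, snd e} \<inter> {fst e', snd e'} = {}" "flat [e, e'] X Y"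
  shows "flat [e', e] X Y"
proof -
  obtain p q where e: "e = (p, q)" by (cases e)
  obtain p' q' where e': "e' = (p', q')" by (cases e')
  have dis: "{p, q} \<inter> {p', q'} = {}" using assms(1) by (simp add: e e')
  obtain W where W: "flat_step (p, q) X W" and Y: "flat_step (p', q') W Y"
    using assms(2) by (auto simp: e e')
  obtain a b c d where 1: "p \<noteq> q" "herm X" "X p q = 0" "W p q = 0" "a \<noteq> 0" "d \<noteq> 0"
      "a * d - b * c \<noteq> 0" "W = pcong a b c d p q X"
    using W unfolding flat_step_def by auto
  obtain a' b' c' d' where 2: "p' \<noteq> q'" "W p' q' = 0" "Y p' q' = 0" "a' \<noteq> 0" "d' \<noteq> 0"
      "a' * d' - b' * c' \<noteq> 0" "Y = pcong a' b' c' d' p' q' W"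
    using Y unfolding flat_step_def by auto
  define V where "V = pcong a' b' c' d' p' q' X"
  have YV: "Y = pcong a b c d p q V"
    unfolding V_def 2(7) 1(8) using pcong_commute[OF 1(1) 2(1) dis] by simp
  have "X p' q' = W p' q'" unfolding 1(8) using dis by (subst pcong_outside) auto
  moreover have "V p q = X p q" unfolding V_def using dis by (subst pcong_outside) auto
  moreover have "Y p q = W p q" unfolding 2(7) using dis by (subst pcong_outside) auto
  moreover have "V p' q' = Y p' q'" unfolding YV using dis by (subst pcong_outside) auto
  ultimately have z: "X p' q' = 0" "V p' q' = 0" "V p q = 0" "Y p q = 0" using 1 2 by auto
  have "herm V" unfolding V_def by (rule herm_pcong[OF 1(2)])
  then have "flat_step (p', q') X V" "flat_step (p, q) V Y"
    using flat_stepI[OF 2(1) 1(2) z(1,2) 2(4-6) V_def] flat_stepI[OF 1(1) _ z(3,4) 1(5-7) YV] by auto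
  then show ?thesis by (auto simp: e e')
qed

section \<open>Pivot orderings for which flat sequences are diagonal\<close>

text \<open>The number \<open>m\<close> of cycles is left free because every shift of an ordering
  costs one more cycle. For pivots in range, diagonality at the start of a flat window amounts to
  diagonality at any later point of it.\<close>

definition diagonalizing :: "nat \<Rightarrow> (nat \<times> nat) list \<Rightarrow> bool" where
  "diagonalizing n Q \<longleftrightarrow> (\<exists>m. \<forall>X Y. flat (concat (replicate m Q)) X Y \<longrightarrow> diag_on {1..n} X)"

abbreviation in_range :: "nat \<Rightarrow> (nat \<times> nat) list \<Rightarrow> bool" where
  "in_range n Q \<equiv> \<forall>(p, q)\<in>set Q. p \<in> {1..n} \<and> q \<in> {1..n}"

lemma is_ordering_in_range: "is_ordering n Q \<Longrightarrow> in_range n Q"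
  unfolding is_ordering_def pivot_set_def by auto

text \<open>One cycle is enough. The column and row orderings yield diagonality at the end of the
  cycle, which is then carried back to its start; for the reversed orderings time reversal makes
  this end the start of the cycle.\<close>

lemma diagonalizing_C_sp:
  assumes "1 \<le> n" "Q \<in> C_sp n" "in_range n Q"
  shows "diagonalizing n Q"
proof -
  have "diag_on {1..n} X" if fl: "flat Q X Y" for X Y
  proof -
    have end_diag: "diag_on {1..n} W" if "P \<in> C_c n \<union> C_r n" "flat P V W" for P V W
      using that flat_column_blocks[of n _ V W] flat_row_blocks[of n _ 1 V W] assms(1)
      unfolding C_c_def C_r_def by blast
    show ?thesis
    proof (cases "Q \<in> C_c n \<union> C_r n")
      case True
      then have "diag_on {1..n} Y" using end_diag fl by blast
      then show ?thesis using flat_diag_on_back[OF fl assms(3)] by blast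
    next
      case False
      then have "rev Q \<in> C_c n \<union> C_r n" using assms(2) unfolding C_sp_def by blast
      moreover have "flat (rev Q) Y X" using flat_rev[of "rev Q" X Y] fl by simp
      ultimately show ?thesis using end_diag by blast
    qed
  qed
  then show ?thesis unfolding diagonalizing_def by (intro exI[of _ 1]) auto
qed

section \<open>Stability of \<open>diagonalizing\<close> under equivalence, shift and
  relabelling\<close>

lemma flat_adm_transposition:
  assumes "adm_transposition Q Q'" "flat Q X Y"
  shows "flat Q' X Y"
proof -
  obtain k where k: "Suc k < length Q"
    "{fst (Q ! k), snd (Q ! k)} \<inter> {fst (Q ! Suc k), snd (Q ! Suc k)} = {}"
    "Q' = Q[k := Q ! Suc k, Suc k := Q ! k]"
    using assms(1) unfolding adm_transposition_def by blast
  define P R where "P = take k Q" and "R = drop (Suc (Suc k)) Q"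
  have Q: "Q = P @ [Q ! k, Q ! Suc k] @ R"
    unfolding P_def R_def using k(1)
    by (metis Cons_nth_drop_Suc Suc_lessD append_Cons append_Nil append_take_drop_id)
  have lP: "length P = k" unfolding P_def using k(1) by simp
  have Q': "Q' = P @ [Q ! Suc k, Q ! k] @ R"
    unfolding k(3) by (subst (1) Q) (simp add: list_update_append lP)
  have "flat (P @ [Q ! k, Q ! Suc k] @ R) X Y"
    using assms(2) by (simp only: Q[symmetric])
  then obtain V W where "flat P X V" "flat [Q ! k, Q ! Suc k] V W" "flat R W Y"
    unfolding flat_append by blast
  then show ?thesis
    unfolding Q' flat_append using flat_transposition[OF k(2)] by blast
qed

lemma flat_equiv_ord:
  assumes "equiv_ord Q Q'" "flat Q X Y"
  shows "flat Q' X Y"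
  using assms unfolding equiv_ord_def
  by (induction rule: rtranclp_induct) (auto intro: flat_adm_transposition)

lemma flat_replicate_mono:
  assumes "\<And>X Y. flat Q X Y \<Longrightarrow> flat Q' X Y" "flat (concat (replicate m Q)) X Y"
  shows "flat (concat (replicate m Q')) X Y"
  using assms(2)
proof (induction m arbitrary: X)
  case (Suc m)
  then show ?case by (simp add: flat_append) (metis assms(1))
qed simp

lemma diagonalizing_equiv_ord:
  assumes "equiv_ord Q Q'" "diagonalizing n Q'"
  shows "diagonalizing n Q"
  using assms(2) flat_replicate_mono[OF flat_equiv_ord[OF assms(1)]] unfolding diagonalizing_def by metis

lemma concat_replicate_shift:
  "concat (replicate (Suc m) (P @ R)) = P @ concat (replicate m (R @ P)) @ R"
  by (induction m) auto

text \<open>Among m+1 copies of PR lie m consecutive copies of RP. They give diagonality after the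
  prefix P, and flatness of P carries it back to the start.\<close>

lemma diagonalizing_shift_equiv:
  assumes "shift_equiv Q Q'" "diagonalizing n Q'" "in_range n Q"
  shows "diagonalizing n Q"
proof -
  obtain P R where Q: "Q = P @ R" and Q': "Q' = R @ P"
    using assms(1) unfolding shift_equiv_def by blast
  obtain m where m: "\<And>X Y. flat (concat (replicate m (R @ P))) X Y \<Longrightarrow> diag_on {1..n} X"
    using assms(2) unfolding diagonalizing_def Q' by blast
  have "diag_on {1..n} X" if "flat (concat (replicate (Suc m) Q)) X Y" for X Y
  proof -
    have "flat (P @ concat (replicate m (R @ P)) @ R) X Y"
      using that unfolding Q concat_replicate_shift .
    then obtain V W where "flat P X V" "flat (concat (replicate m (R @ P))) V W"
      unfolding flat_append by blast
    then show ?thesis using m flat_diag_on_back[of P X V "{1..n}"] assms(3) Q by auto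
  qed
  then show ?thesis unfolding diagonalizing_def by blast
qed

lemma diagonalizing_weak_equiv_canon:
  assumes "weak_equiv_canon n Q Q'" "diagonalizing n Q'"
  shows "diagonalizing n Q"
proof -
  obtain cs where cs: "cs \<noteq> []" "hd cs = Q" "last cs = Q'" "\<forall>c\<in>set cs. is_ordering n c"
    and step: "\<And>t. Suc t < length cs \<Longrightarrow>
         (if even t then equiv_ord (cs ! t) (cs ! Suc t) else shift_equiv (cs ! t) (cs ! Suc t))"
    using assms(1) unfolding weak_equiv_canon_def by blast
  \<comment> \<open>\<open>k\<close> counts from the end of the chain, where the property is known;
    parity of the position decides which of the two relations is used.\<close>
  have "diagonalizing n (cs ! (length cs - 1 - k))" if "k < length cs" for k
    using that
  proof (induction k)
    case 0
    then show ?case using assms(2) cs(1,3) by (simp add: last_conv_nth)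
  next
    case (Suc k)
    define t where "t = length cs - 1 - Suc k"
    have t: "Suc t < length cs" "Suc t = length cs - 1 - k" using Suc.prems by (auto simp: t_def)
    have g: "diagonalizing n (cs ! Suc t)" using Suc t by simp
    have "in_range n (cs ! t)" using cs(4) t(1) by (intro is_ordering_in_range) auto
    then have "diagonalizing n (cs ! t)"
      using step[OF t(1)] diagonalizing_equiv_ord[OF _ g] diagonalizing_shift_equiv[OF _ g] by (auto split: if_splits)
    then show ?case unfolding t_def .
  qed
  from this[of "length cs - 1"] show ?thesis using cs(1,2) by (simp add: hd_conv_nth)
qed

definition relabel :: "(nat \<Rightarrow> nat) \<Rightarrow> cmat \<Rightarrow> cmat" where
  "relabel \<sigma> X = (\<lambda>r s. X (\<sigma> r) (\<sigma> s))"

text \<open>Relabelling is congruence with a permutation matrix. Entries are read through \<sigma>,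
  so pivots move by its inverse \<pi>, and the pivot entry keeps its value.\<close>

lemma relabel_pcong:
  assumes "\<And>x. \<sigma> (\<pi> x) = x" "\<And>x. \<pi> (\<sigma> x) = x"
  shows "relabel \<sigma> (pcong a b c d p q X) = pcong a b c d (\<pi> p) (\<pi> q) (relabel \<sigma> X)"
proof -
  have "(\<sigma> r = p) = (r = \<pi> p)" for r p
    using assms by metis
  moreover have "(\<pi> r = \<pi> p) = (r = p)" for r p
    using assms by metis
  ultimately show ?thesis unfolding relabel_def pcong_def Let_def by (simp add: fun_eq_iff assms)
qed

lemma flat_step_relabel:
  assumes inv: "\<And>x. \<sigma> (\<pi> x) = x" "\<And>x. \<pi> (\<sigma> x) = x" and st: "flat_step (p, q) X Y"
  shows "flat_step (min (\<pi> p) (\<pi> q), max (\<pi> p) (\<pi> q)) (relabel \<sigma> X) (relabel \<sigma> Y)"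
proof -
  obtain a b c d where pq: "p \<noteq> q" and h: "herm X" "X p q = 0" "Y p q = 0"
    and u: "a \<noteq> 0" "d \<noteq> 0" "a * d - b * c \<noteq> 0" and Y: "Y = pcong a b c d p q X"
    using st unfolding flat_step_def by auto
  have ne: "\<pi> p \<noteq> \<pi> q" using pq inv by metis
  have st': "flat_step (\<pi> p, \<pi> q) (relabel \<sigma> X) (relabel \<sigma> Y)"
  proof (rule flat_stepI[OF ne _ _ _ u])
    show "herm (relabel \<sigma> X)" using h(1) unfolding herm_def relabel_def by blast
    show "relabel \<sigma> Y = pcong a b c d (\<pi> p) (\<pi> q) (relabel \<sigma> X)"
      unfolding Y by (rule relabel_pcong[OF inv])
  qed (simp_all add: relabel_def inv h)
  show ?thesis
  proof (cases "\<pi> p \<le> \<pi> q")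
    case True then show ?thesis using st' by (simp add: min_def max_def)
  next
    case False then show ?thesis using flat_step_swap st' by (simp add: min_def max_def)
  qed
qed

lemma flat_relabel:
  assumes inv: "\<And>x. \<sigma> (\<pi> x) = x" "\<And>x. \<pi> (\<sigma> x) = x" and "flat P X Y"
  shows "flat (map (\<lambda>(i, j). (min (\<pi> i) (\<pi> j), max (\<pi> i) (\<pi> j))) P) (relabel \<sigma> X) (relabel \<sigma> Y)"
  using assms(3)
proof (induction P arbitrary: X)
  case (Cons e P)
  then obtain W where "flat_step e X W" "flat P W Y" by auto
  then show ?case using Cons.IH[of W] flat_step_relabel[OF inv, of "fst e" "snd e" X W]
    by (cases e) auto
qed simp

lemma diagonalizing_perm_equiv:
  assumes "perm_equiv n Q Q'" "diagonalizing n Q'" "in_range n Q"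
  shows "diagonalizing n Q"
proof -
  obtain \<pi> where \<pi>: "bij_betw \<pi> {1..n} {1..n}"
    and Q': "Q' = map (\<lambda>(i, j). (min (\<pi> i) (\<pi> j), max (\<pi> i) (\<pi> j))) Q"
    using assms(1) unfolding perm_equiv_def by blast
  \<comment> \<open>The given permutation acts on 1..n only. Extending it by the identity makes it a
    bijection of all naturals, as \<open>relabel\<close> requires.\<close>
  define \<rho> where "\<rho> = (\<lambda>i. if i \<in> {1..n} then \<pi> i else i)"
  have "bij_betw \<rho> ({1..n} \<union> (- {1..n})) ({1..n} \<union> (- {1..n}))"
  proof (rule bij_betw_combine)
    show "bij_betw \<rho> {1..n} {1..n}" using \<pi> by (rule bij_betw_cong[THEN iffD1, rotated]) (simp add: \<rho>_def)
    have "bij_betw (\<lambda>i. i) (- {1..n}) (- {1..n})" by (simp add: bij_betw_def)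
    then show "bij_betw \<rho> (- {1..n}) (- {1..n})"
      by (rule bij_betw_cong[THEN iffD1, rotated]) (auto simp: \<rho>_def)
  qed auto
  then have bij: "bij \<rho>" by simp
  define \<sigma> where "\<sigma> = inv_into UNIV \<rho>"
  have inv: "\<sigma> (\<rho> x) = x" "\<rho> (\<sigma> x) = x" for x
    using bij unfolding \<sigma>_def by (simp_all add: bij_is_inj bij_is_surj surj_f_inv_f)
  have Q'\<rho>: "Q' = map (\<lambda>(i, j). (min (\<rho> i) (\<rho> j), max (\<rho> i) (\<rho> j))) Q"
    unfolding Q' using assms(3) by (intro map_cong) (auto simp: \<rho>_def)
  obtain m where m: "\<And>X Y. flat (concat (replicate m Q')) X Y \<Longrightarrow> diag_on {1..n} X"
    using assms(2) unfolding diagonalizing_def by blast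
  have "diag_on {1..n} X" if "flat (concat (replicate m Q)) X Y" for X Y
  proof -
    have "flat (concat (replicate m Q')) (relabel \<sigma> X) (relabel \<sigma> Y)"
      using flat_relabel[OF inv that] unfolding Q'\<rho> by (simp add: map_concat)
    then have d: "diag_on {1..n} (relabel \<sigma> X)" by (rule m)
    show ?thesis unfolding diag_on_def
    proof (intro ballI impI)
      fix r s assume rs: "r \<in> {1..n}" "s \<in> {1..n}" "r \<noteq> s"
      have "\<rho> r \<in> {1..n}" "\<rho> s \<in> {1..n}" using rs \<pi> unfolding \<rho>_def bij_betw_def by auto
      moreover have "\<rho> r \<noteq> \<rho> s" using rs bij by (simp add: bij_is_inj inj_eq)
      ultimately have "relabel \<sigma> X (\<rho> r) (\<rho> s) = 0" using d unfolding diag_on_def by blast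
      then show "X r s = 0" by (simp add: relabel_def inv)
    qed
  qed
  then show ?thesis unfolding diagonalizing_def by blast
qed

lemma diagonalizing_C_sg:
  assumes "1 \<le> n" "Q \<in> C_sg n"
  shows "diagonalizing n Q"
proof -
  obtain Q1 Q2 where Q: "is_ordering n Q" and Q2: "Q2 \<in> C_sp n"
    and alt: "perm_equiv n Q Q1 \<and> weak_equiv_canon n Q1 Q2 \<or>
      weak_equiv_canon n Q Q1 \<and> perm_equiv n Q1 Q2"
    using assms(2) unfolding C_sg_def by blast
  have last_ord: "is_ordering n R'" if "weak_equiv_canon n R R'" for R R'
    using that unfolding weak_equiv_canon_def by (metis last_in_set)
  show ?thesis
    using alt
  proof
    assume "perm_equiv n Q Q1 \<and> weak_equiv_canon n Q1 Q2"
    then show ?thesis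
      using diagonalizing_C_sp[OF assms(1) Q2] last_ord is_ordering_in_range diagonalizing_weak_equiv_canon
        diagonalizing_perm_equiv[of n Q Q1] Q by blast
  next
    assume H: "weak_equiv_canon n Q Q1 \<and> perm_equiv n Q1 Q2"
    then have Q1: "in_range n Q1" using last_ord is_ordering_in_range by blast
    obtain \<pi> where \<pi>: "bij_betw \<pi> {1..n} {1..n}"
      and Q2': "Q2 = map (\<lambda>(i, j). (min (\<pi> i) (\<pi> j), max (\<pi> i) (\<pi> j))) Q1"
      using H unfolding perm_equiv_def by blast
    have im: "\<pi> i \<in> {1..n}" if "i \<in> {1..n}" for i using \<pi> that unfolding bij_betw_def by blast
    \<comment> \<open>Here \<open>Q2\<close> is a relabelling and not the end of a chain of
      orderings, so its index range has to come from the permutation.\<close>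
    have "in_range n Q2"
    proof
      fix e assume "e \<in> set Q2"
      then obtain i j where "(i, j) \<in> set Q1" "e = (min (\<pi> i) (\<pi> j), max (\<pi> i) (\<pi> j))"
        unfolding Q2' by auto
      moreover from this have "i \<in> {1..n}" "j \<in> {1..n}" using Q1 by blast+
      ultimately show "case e of (p, q) \<Rightarrow> p \<in> {1..n} \<and> q \<in> {1..n}"
        using im[of i] im[of j] by (auto simp: min_def max_def)
    qed
    then show ?thesis
      using diagonalizing_C_sp[OF assms(1) Q2] H diagonalizing_weak_equiv_canon diagonalizing_perm_equiv Q1 by blast
  qed
qed

section \<open>Windows of a cyclic strategy\<close>

lemma map_cyclic_strategy_cycles:
  assumes "Q \<noteq> []"
  shows "map (cyclic_strategy Q) [l * length Q..<l * length Q + m * length Q] = concat (replicate m Q)"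
proof (induction m)
  case (Suc m)
  let ?N = "length Q"
  have "map (cyclic_strategy Q) [k * ?N..<k * ?N + ?N] = Q" for k
    by (rule nth_equalityI) (auto simp: cyclic_strategy_def)
  from this[of "l + m"]
  have one: "map (cyclic_strategy Q) [l * ?N + m * ?N..<l * ?N + m * ?N + ?N] = Q"
    by (simp add: algebra_simps)
  have "[l * ?N..<l * ?N + Suc m * ?N] =
      [l * ?N..<l * ?N + m * ?N] @ [l * ?N + m * ?N..<l * ?N + m * ?N + ?N]"
    using upt_add_eq_append[of "l * ?N" "l * ?N + m * ?N" ?N] by (simp add: algebra_simps)
  then have "map (cyclic_strategy Q) [l * ?N..<l * ?N + Suc m * ?N] = concat (replicate m Q) @ Q"
    using Suc one by simp
  also have "\<dots> = concat (replicate (Suc m) Q)"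
    by (metis append_Nil2 concat.simps concat_append replicate_Suc replicate_append_same)
  finally show ?case .
qed simp

text \<open>A window may start anywhere inside a cycle. One cycle more than \<open>m\<close>
  guarantees \<open>m\<close> complete cycles within it, and the incomplete cycle in front carries
  diagonality back. Divisibility of \<open>M\<close> by the period makes successive windows run
  through the same pivots.\<close>

lemma diagonalizing_window:
  assumes "diagonalizing n Q" "Q \<noteq> []" "in_range n Q"
  obtains M where "0 < M" "length Q dvd M"
    "\<And>j X Y. flat (map (cyclic_strategy Q) [j..<j + M]) X Y \<Longrightarrow> diag_on {1..n} X"
proof -
  obtain m where m: "\<And>X Y. flat (concat (replicate m Q)) X Y \<Longrightarrow> diag_on {1..n} X"
    using assms(1) unfolding diagonalizing_def by blast
  define N where "N = length Q"
  have N: "0 < N" using assms(2) by (simp add: N_def)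
  define M where "M = Suc m * N"
  have "diag_on {1..n} X" if fl: "flat (map (cyclic_strategy Q) [j..<j + M]) X Y" for j X Y
  proof -
    \<comment> \<open>\<open>l * N\<close> is the first multiple of the period strictly beyond
      \<open>j\<close>.\<close>
    define l where "l = Suc (j div N)"
    have j: "j \<le> l * N" "l * N \<le> j + N"
      using div_mult_mod_eq[of j N] mod_less_divisor[OF N, of j] unfolding l_def mult_Suc by linarith+
    have le: "l * N + m * N \<le> j + M" using j(2) unfolding M_def by simp
    have split: "[i..<k] = [i..<h] @ [h..<k]" if "i \<le> h" "h \<le> k" for i h k :: nat
      using upt_add_eq_append[of i h "k - h"] that by simp
    have "[j..<j + M] = [j..<l * N] @ [l * N..<l * N + m * N] @ [l * N + m * N..<j + M]"
      using j(1) le split[of j "l * N" "j + M"] split[of "l * N" "l * N + m * N" "j + M"] by simp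
    then obtain V W where V: "flat (map (cyclic_strategy Q) [j..<l * N]) X V"
      and W: "flat (map (cyclic_strategy Q) [l * N..<l * N + m * N]) V W"
      using fl by (auto simp: flat_append)
    have "diag_on {1..n} V" using W m map_cyclic_strategy_cycles[OF assms(2)] unfolding N_def by metis
    moreover have "cyclic_strategy Q k \<in> set Q" for k
      using N unfolding N_def cyclic_strategy_def by simp
    then have "in_range n (map (cyclic_strategy Q) [j..<l * N])" using assms(3) by auto
    ultimately show ?thesis using flat_diag_on_back[OF V] by blast
  qed
  moreover have "0 < M" "length Q dvd M" using N unfolding M_def N_def by auto
  ultimately show ?thesis using that by blast
qed

section \<open>Off-norm and compactness\<close>

text \<open>Bolzano-Weierstrass, one coordinate after the other. The index type is arbitrary so that
  all matrices of a window, all blocks of a window or the entries of a vector can be treated as one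
  family.\<close>

lemma subsequence_finite_family:
  fixes f :: "nat \<Rightarrow> 'i \<Rightarrow> complex"
  assumes "finite S" "\<And>l i. i \<in> S \<Longrightarrow> cmod (f l i) \<le> K i"
  obtains r g where "strict_mono r" "\<And>i. i \<in> S \<Longrightarrow> (\<lambda>l. f (r l) i) \<longlonglongrightarrow> g i"
proof -
  have "\<exists>r g. strict_mono (r :: nat \<Rightarrow> nat) \<and> (\<forall>i\<in>S. (\<lambda>l. f (r l) i) \<longlonglongrightarrow> g i)"
    using assms
  proof (induction S rule: finite_induct)
    case empty
    show ?case by (rule exI[of _ id]) (auto simp: strict_mono_def)
  next
    case (insert j S)
    then have "\<exists>r g. strict_mono (r :: nat \<Rightarrow> nat) \<and> (\<forall>i\<in>S. (\<lambda>l. f (r l) i) \<longlonglongrightarrow> g i)"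
      by simp
    then obtain r g where r: "strict_mono (r :: nat \<Rightarrow> nat)"
      "\<And>i. i \<in> S \<Longrightarrow> (\<lambda>l. f (r l) i) \<longlonglongrightarrow> g i" by blast
    have "\<forall>l. cmod (f (r l) j) \<le> K j" using insert.prems by auto
    from Bolzano_Weierstrass_complex_disc[OF this] obtain h z where
      h: "strict_mono (h :: nat \<Rightarrow> nat)" "\<forall>e>0. \<exists>N. \<forall>l\<ge>N. cmod (f (r (h l)) j - z) < e"
      by blast
    have "(\<lambda>l. f (r (h l)) j) \<longlonglongrightarrow> z" using h(2) by (simp add: LIMSEQ_iff)
    moreover have "(\<lambda>l. f (r (h l)) i) \<longlonglongrightarrow> g i" if "i \<in> S" for i
      using LIMSEQ_subseq_LIMSEQ[OF r(2)[OF that] h(1)] by (simp add: comp_def)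
    ultimately have "\<forall>i\<in>insert j S. (\<lambda>l. f ((r \<circ> h) l) i) \<longlonglongrightarrow> (g(j := z)) i"
      using insert.hyps by auto
    moreover have "strict_mono (r \<circ> h)" using r(1) h(1) by (rule strict_mono_o)
    ultimately show ?case by blast
  qed
  then show ?thesis using that by blast
qed

text \<open>While \<open>y\<close> exceeds \<epsilon> it falls by at least \<delta> per step, which
  a nonnegative sequence cannot do forever; once at or below \<epsilon> it is trapped there. As
  \<delta> and \<open>L\<close> may depend on \<epsilon>, the hypothesis is accessible to a
  compactness argument.\<close>

lemma tendsto_0_if_eventually_decreasing:
  fixes y :: "nat \<Rightarrow> real"
  assumes "\<And>l. 0 \<le> y l"
    and "\<And>\<epsilon>. 0 < \<epsilon> \<Longrightarrow> \<exists>\<delta>>0. \<exists>L. \<forall>l\<ge>L. y (Suc l) \<le> max \<epsilon> (y l - \<delta>)"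
  shows "y \<longlonglongrightarrow> 0"
proof (rule LIMSEQ_I)
  fix r :: real assume "0 < r"
  define \<epsilon> where "\<epsilon> = r / 2"
  have \<epsilon>: "0 < \<epsilon>" "\<epsilon> < r" using \<open>0 < r\<close> by (auto simp: \<epsilon>_def)
  obtain \<delta> L where \<delta>: "0 < \<delta>" and L: "\<And>l. l \<ge> L \<Longrightarrow> y (Suc l) \<le> max \<epsilon> (y l - \<delta>)"
    using assms(2)[OF \<epsilon>(1)] by blast
  have "\<exists>l\<ge>L. y l \<le> \<epsilon>"
  proof (rule ccontr)
    assume "\<not> ?thesis"
    then have big: "y l > \<epsilon>" if "l \<ge> L" for l using that by force
    have dec: "y (L + i) \<le> y L - real i * \<delta>" for i
    proof (induction i)
      case (Suc i)
      have "y (Suc (L + i)) \<le> y (L + i) - \<delta>"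
        using L[of "L + i"] big[of "Suc (L + i)"] by (simp add: max_def split: if_splits)
      then show ?case using Suc by (simp add: algebra_simps)
    qed simp
    obtain i :: nat where "y L < real i * \<delta>" using reals_Archimedean3[OF \<delta>] by blast
    then show False using dec[of i] assms(1)[of "L + i"] by linarith
  qed
  then obtain l0 where l0: "l0 \<ge> L" "y l0 \<le> \<epsilon>" by blast
  have "y l \<le> \<epsilon>" if "l \<ge> l0" for l
    using that
  proof (induction l rule: dec_induct)
    case (step l)
    then show ?case using L[of l] l0(1) \<delta> by (simp add: max_def split: if_splits)
  qed (use l0 in simp)
  then show "\<exists>no. \<forall>l\<ge>no. norm (y l - 0) < r"
    using \<epsilon>(2) assms(1) by (intro exI[of _ l0]) (auto intro: le_less_trans)
qed

lemma tendsto_if_residues: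
  fixes f :: "nat \<Rightarrow> real"
  assumes "0 < M" "\<And>j. j < M \<Longrightarrow> (\<lambda>l. f (l * M + j)) \<longlonglongrightarrow> z"
  shows "f \<longlonglongrightarrow> z"
proof (rule tendstoI)
  fix e :: real assume "0 < e"
  then have "\<forall>j\<in>{..<M}. \<forall>\<^sub>F l in sequentially. dist (f (l * M + j)) z < e"
    using assms(2) tendstoD by blast
  then have "\<forall>\<^sub>F l in sequentially. \<forall>j\<in>{..<M}. dist (f (l * M + j)) z < e"
    by (simp add: eventually_ball_finite)
  then obtain L where L: "\<And>l j. l \<ge> L \<Longrightarrow> j < M \<Longrightarrow> dist (f (l * M + j)) z < e"
    unfolding eventually_sequentially by blast
  have "dist (f k) z < e" if "k \<ge> L * M" for k
  proof -
    have "L \<le> k div M" using that assms(1) by (simp add: less_eq_div_iff_mult_less_eq)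
    from L[OF this, of "k mod M"] show ?thesis using assms(1) by simp
  qed
  then show "\<forall>\<^sub>F k in sequentially. dist (f k) z < e" unfolding eventually_sequentially by blast
qed

section \<open>The squared off-norm and its change under unitary plane congruences\<close>

definition off2 :: "nat \<Rightarrow> cmat \<Rightarrow> real" where
  "off2 n X = (\<Sum>r\<in>{1..n}. \<Sum>s\<in>{1..n}. if r = s then 0 else (cmod (X r s))\<^sup>2)"

lemma off2_nonneg: "0 \<le> off2 n X"
  unfolding off2_def by (intro sum_nonneg) auto

lemma off2_entry:
  assumes "r \<in> {1..n}" "s \<in> {1..n}" "r \<noteq> s"
  shows "(cmod (X r s))\<^sup>2 \<le> off2 n X"
proof -
  have "(cmod (X r s))\<^sup>2 \<le> (\<Sum>s\<in>{1..n}. if r = s then 0 else (cmod (X r s))\<^sup>2)"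
    using assms member_le_sum[of s "{1..n}" "\<lambda>s. if r = s then 0 else (cmod (X r s))\<^sup>2"] by auto
  also have "\<dots> \<le> off2 n X"
    unfolding off2_def
    using assms by (intro member_le_sum[where f = "\<lambda>r. \<Sum>s\<in>{1..n}. if r = s then 0 else (cmod (X r s))\<^sup>2"]
        sum_nonneg) auto
  finally show ?thesis .
qed

lemma off2_tendsto_entry:
  assumes "(\<lambda>k. off2 n (X k)) \<longlonglongrightarrow> 0" "\<And>k. f k \<in> {1..n} \<and> g k \<in> {1..n} \<and> f k \<noteq> g k"
  shows "(\<lambda>k. X k (f k) (g k)) \<longlonglongrightarrow> 0"
proof -
  have "(\<lambda>k. (cmod (X k (f k) (g k)))\<^sup>2) \<longlonglongrightarrow> 0"
    using assms(1) by (rule tendsto_sandwich[OF _ _ tendsto_const, rotated 2])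
      (use assms(2) in \<open>auto intro!: always_eventually off2_entry\<close>)
  then have "(\<lambda>k. sqrt ((cmod (X k (f k) (g k)))\<^sup>2)) \<longlonglongrightarrow> sqrt 0" by (rule tendsto_real_sqrt)
  then show ?thesis by (simp add: tendsto_norm_zero_iff)
qed

text \<open>A plane congruence acts separately on these three groups: the pivot entry, the rest of
  the two pivot columns, and the entries that meet no pivot index. The factors 2 account for the
  mirrored entries.\<close>

lemma off2_split:
  assumes "herm X" "p \<in> {1..n}" "q \<in> {1..n}" "p \<noteq> q"
  defines "R \<equiv> {1..n} - {p, q}"
  shows "off2 n X = 2 * (cmod (X p q))\<^sup>2 + 2 * (\<Sum>r\<in>R. (cmod (X r p))\<^sup>2 + (cmod (X r q))\<^sup>2)
    + (\<Sum>r\<in>R. \<Sum>s\<in>R. if r = s then 0 else (cmod (X r s))\<^sup>2)"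
proof -
  have split: "(\<Sum>r\<in>{1..n}. f r) = f p + f q + (\<Sum>r\<in>R. f r)" for f :: "nat \<Rightarrow> real"
  proof -
    have eq: "{1..n} - {p} - {q} = R" unfolding R_def by auto
    have "(\<Sum>r\<in>{1..n}. f r) = f p + (\<Sum>r\<in>{1..n} - {p}. f r)"
      using assms by (intro sum.remove) auto
    also have "(\<Sum>r\<in>{1..n} - {p}. f r) = f q + (\<Sum>r\<in>{1..n} - {p} - {q}. f r)"
      using assms by (intro sum.remove) auto
    finally show ?thesis unfolding eq by simp
  qed
  have nR: "p \<notin> R" "q \<notin> R" by (auto simp: R_def)
  have sym: "cmod (X r s) = cmod (X s r)" for r s
    using hermD[OF assms(1), of r s] by simp
  have "(\<Sum>s\<in>R. if p = s then 0 else (cmod (X p s))\<^sup>2) = (\<Sum>r\<in>R. (cmod (X r p))\<^sup>2)"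
    "(\<Sum>s\<in>R. if q = s then 0 else (cmod (X q s))\<^sup>2) = (\<Sum>r\<in>R. (cmod (X r q))\<^sup>2)"
    using nR sym by (auto intro!: sum.cong)
  moreover have "(\<Sum>r\<in>R. (if r = p then 0 else (cmod (X r p))\<^sup>2) + (if r = q then 0 else (cmod (X r q))\<^sup>2)
      + (\<Sum>s\<in>R. if r = s then 0 else (cmod (X r s))\<^sup>2)) =
    (\<Sum>r\<in>R. (cmod (X r p))\<^sup>2 + (cmod (X r q))\<^sup>2)
    + (\<Sum>r\<in>R. \<Sum>s\<in>R. if r = s then 0 else (cmod (X r s))\<^sup>2)"
    unfolding sum.distrib[symmetric] using nR by (intro sum.cong) auto
  moreover have "cmod (X q p) = cmod (X p q)" by (rule sym)
  ultimately show ?thesis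
    unfolding off2_def split using assms(4) by (simp add: sum.distrib)
qed

text \<open>Orthogonality of the columns gives |a||b| = |c||d|, and with the normalizations this
  forces |a| = |d|, hence unit rows. Orthogonality of the rows is obtained after multiplication by
  \<open>d\<close>.\<close>

lemma unitary2_rows:
  fixes a b c d :: complex
  assumes "(cmod a)\<^sup>2 + (cmod c)\<^sup>2 = 1" "(cmod b)\<^sup>2 + (cmod d)\<^sup>2 = 1" "cnj a * b + cnj c * d = 0" "d \<noteq> 0"
  shows "(cmod a)\<^sup>2 + (cmod b)\<^sup>2 = 1" "(cmod c)\<^sup>2 + (cmod d)\<^sup>2 = 1" "a * cnj c + b * cnj d = 0"
    "a * d - b * c \<noteq> 0"
proof -
  have "cnj a * b = - (cnj c * d)" using assms(3) by (simp add: eq_neg_iff_add_eq_0)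
  then have "cmod a * cmod b = cmod c * cmod d"
    by (metis complex_mod_cnj norm_minus_cancel norm_mult)
  then have "(cmod a)\<^sup>2 * (cmod b)\<^sup>2 = (cmod c)\<^sup>2 * (cmod d)\<^sup>2"
    by (metis power_mult_distrib)
  moreover have "(cmod c)\<^sup>2 = 1 - (cmod a)\<^sup>2" "(cmod b)\<^sup>2 = 1 - (cmod d)\<^sup>2" using assms by auto
  ultimately have ad: "(cmod a)\<^sup>2 = (cmod d)\<^sup>2" by (simp add: algebra_simps)
  then show "(cmod a)\<^sup>2 + (cmod b)\<^sup>2 = 1" "(cmod c)\<^sup>2 + (cmod d)\<^sup>2 = 1" using assms by auto
  have "a * cnj a = d * cnj d" using ad by (metis complex_norm_square)
  have "(a * cnj c + b * cnj d) * d = a * (cnj c * d) + b * (d * cnj d)" by (simp add: algebra_simps)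
  also have "\<dots> = - (a * cnj a) * b + b * (d * cnj d)"
    using assms(3) by (simp add: algebra_simps eq_neg_iff_add_eq_0)
      (metis add.commute add_eq_0_iff distrib_left mult.left_commute mult_zero_right)
  also have "\<dots> = 0" using \<open>a * cnj a = d * cnj d\<close> by simp
  finally show "a * cnj c + b * cnj d = 0" using assms(4) by simp
  show "a * d - b * c \<noteq> 0"
  proof
    \<comment> \<open>A zero determinant would make \<open>d\<close> times the squared norm of the
      first column vanish.\<close>
    assume "a * d - b * c = 0"
    then have "d * (a * cnj a) = c * (cnj a * b)" by (simp add: algebra_simps)
    also have "\<dots> = - (d * (c * cnj c))" using \<open>cnj a * b = - (cnj c * d)\<close> by simp
    finally have "d * (a * cnj a + c * cnj c) = 0" by (simp add: algebra_simps)
    moreover have "a * cnj a + c * cnj c = 1"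
      using assms(1) by (metis complex_norm_square of_real_1 of_real_add)
    ultimately show False using assms(4) by simp
  qed
qed

lemma unitary2_norm:
  fixes a b c d x y :: complex
  assumes "(cmod a)\<^sup>2 + (cmod b)\<^sup>2 = 1" "(cmod c)\<^sup>2 + (cmod d)\<^sup>2 = 1" "a * cnj c + b * cnj d = 0"
  shows "(cmod (x * a + y * c))\<^sup>2 + (cmod (x * b + y * d))\<^sup>2 = (cmod x)\<^sup>2 + (cmod y)\<^sup>2"
proof -
  have 1: "a * cnj a + b * cnj b = 1" "c * cnj c + d * cnj d = 1"
    using assms by (metis complex_norm_square of_real_1 of_real_add)+
  have 2: "c * cnj a + d * cnj b = 0"
    using arg_cong[OF assms(3), of cnj] by (simp add: algebra_simps)
  have "complex_of_real ((cmod (x * a + y * c))\<^sup>2 + (cmod (x * b + y * d))\<^sup>2)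
    = (x * a + y * c) * cnj (x * a + y * c) + (x * b + y * d) * cnj (x * b + y * d)"
    by (simp only: complex_norm_square of_real_add)
  also have "\<dots> = x * cnj x * (a * cnj a + b * cnj b) + y * cnj y * (c * cnj c + d * cnj d)
    + x * cnj y * (a * cnj c + b * cnj d) + y * cnj x * (c * cnj a + d * cnj b)"
    by (simp add: algebra_simps)
  also have "\<dots> = complex_of_real ((cmod x)\<^sup>2 + (cmod y)\<^sup>2)"
    unfolding 1 2 assms(3) by (simp only: complex_norm_square of_real_add) simp
  finally show ?thesis by (simp only: of_real_eq_iff)
qed

text \<open>The classical energy identity of Jacobi's method: unitarity preserves each pair of
  entries in the pivot columns, entries away from the pivot are untouched, and the pivot entry and
  its mirror image are lost.\<close>

lemma off2_pcong:
  assumes "herm X" "p \<in> {1..n}" "q \<in> {1..n}" "p \<noteq> q"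
    and u: "(cmod a)\<^sup>2 + (cmod c)\<^sup>2 = 1" "(cmod b)\<^sup>2 + (cmod d)\<^sup>2 = 1" "cnj a * b + cnj c * d = 0" "d \<noteq> 0"
    and Y: "Y = pcong a b c d p q X" "Y p q = 0"
  shows "off2 n Y + 2 * (cmod (X p q))\<^sup>2 = off2 n X"
proof -
  let ?R = "{1..n} - {p, q}"
  have hY: "herm Y" unfolding Y by (rule herm_pcong[OF assms(1)])
  have "(cmod (Y r p))\<^sup>2 + (cmod (Y r q))\<^sup>2 = (cmod (X r p))\<^sup>2 + (cmod (X r q))\<^sup>2" if "r \<in> ?R" for r
    using unitary2_norm[OF unitary2_rows(1-3)[OF u]] that assms(4) unfolding Y(1)
    by (simp add: pcong_col1 pcong_col2)
  then have "(\<Sum>r\<in>?R. (cmod (Y r p))\<^sup>2 + (cmod (Y r q))\<^sup>2) = (\<Sum>r\<in>?R. (cmod (X r p))\<^sup>2 + (cmod (X r q))\<^sup>2)"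
    by (rule sum.cong[OF refl])
  moreover have "(\<Sum>r\<in>?R. \<Sum>s\<in>?R. if r = s then 0 else (cmod (Y r s))\<^sup>2) =
      (\<Sum>r\<in>?R. \<Sum>s\<in>?R. if r = s then 0 else (cmod (X r s))\<^sup>2)"
    unfolding Y(1) by (intro sum.cong refl) (simp add: pcong_outside)
  ultimately show ?thesis
    unfolding off2_split[OF assms(1-4)] off2_split[OF hY assms(2-4)] using Y(2) by simp
qed

lemma tendsto_pcong:
  assumes "(\<lambda>i. a i) \<longlonglongrightarrow> a'" "(\<lambda>i. b i) \<longlonglongrightarrow> b'" "(\<lambda>i. c i) \<longlonglongrightarrow> c'" "(\<lambda>i. d i) \<longlonglongrightarrow> d'"
    and X: "\<And>r s. r \<in> R \<Longrightarrow> s \<in> R \<Longrightarrow> (\<lambda>i. X i r s) \<longlonglongrightarrow> X' r s"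
    and R: "p \<in> R" "q \<in> R" "r \<in> R" "s \<in> R"
  shows "(\<lambda>i. pcong (a i) (b i) (c i) (d i) p q (X i) r s) \<longlonglongrightarrow> pcong a' b' c' d' p q X' r s"
  unfolding pcong_def Let_def
  by (auto intro!: tendsto_intros assms)

lemma tendsto_off2:
  assumes "\<And>r s. r \<in> {1..n} \<Longrightarrow> s \<in> {1..n} \<Longrightarrow> (\<lambda>i. X i r s) \<longlonglongrightarrow> X' r s"
  shows "(\<lambda>i. off2 n (X i)) \<longlonglongrightarrow> off2 n X'"
  unfolding off2_def by (auto intro!: tendsto_intros assms)

lemma off2_diag_on: "diag_on {1..n} X \<Longrightarrow> off2 n X = 0"
  unfolding off2_def diag_on_def by (intro sum.neutral ballI) auto

lemma flat_chain:
  assumes "\<And>t. t < M \<Longrightarrow> flat_step (J (j + t)) (X t) (X (Suc t))"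
  shows "flat (map J [j..<j + M]) (X 0) (X M)"
  using assms
proof (induction M)
  case (Suc M)
  then show ?case by (auto simp: flat_append)
qed simp

text \<open>A step of the process lowers \<open>off2\<close> by twice the squared pivot, up to an error that tends
  to zero. Were the decrease over a window not bounded away from zero, a limit of windows would
  be a flat window with nonzero \<open>off2\<close>.\<close>

lemma jacobi_process_offdiag:
  fixes X :: "nat \<Rightarrow> cmat" and a b c d :: "nat \<Rightarrow> complex" and Q :: "(nat \<times> nat) list"
  defines "p \<equiv> \<lambda>k. fst (cyclic_strategy Q k)" and "q \<equiv> \<lambda>k. snd (cyclic_strategy Q k)"
  assumes diagonalizing: "diagonalizing n Q" and Q: "Q \<noteq> []" "set Q \<subseteq> pivot_set n"
    and herm: "\<And>k. hermitian_n n (X k)"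
    and bdd: "\<And>k r s. r \<in> {1..n} \<Longrightarrow> s \<in> {1..n} \<Longrightarrow> cmod (X k r s) \<le> K"
    and step: "\<And>k r s. r \<in> {1..n} \<Longrightarrow> s \<in> {1..n} \<Longrightarrow>
      X (Suc k) r s = pcong (a k) (b k) (c k) (d k) (p k) (q k) (X k) r s"
    and piv: "\<And>k. X (Suc k) (p k) (q k) = 0"
    and u1: "(\<lambda>k. (cmod (a k))\<^sup>2 + (cmod (c k))\<^sup>2) \<longlonglongrightarrow> 1"
    and u2: "(\<lambda>k. (cmod (b k))\<^sup>2 + (cmod (d k))\<^sup>2) \<longlonglongrightarrow> 1"
    and u3: "(\<lambda>k. cnj (a k) * b k + cnj (c k) * d k) \<longlonglongrightarrow> 0"
    and low: "\<forall>\<^sub>F k in sequentially. 1 / 2 \<le> cmod (a k)" "\<forall>\<^sub>F k in sequentially. 1 / 2 \<le> cmod (d k)"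
  shows "(\<lambda>k. off2 n (X k)) \<longlonglongrightarrow> 0"
proof -
  define R where "R = {1..n}"
  have finR: "finite R" by (simp add: R_def)
  have pq: "p k \<in> R" "q k \<in> R" "p k \<noteq> q k" for k
  proof -
    have "cyclic_strategy Q k \<in> set Q" using Q(1) by (simp add: cyclic_strategy_def)
    then have "cyclic_strategy Q k \<in> pivot_set n" using Q(2) by blast
    then show "p k \<in> R" "q k \<in> R" "p k \<noteq> q k"
      unfolding p_def q_def R_def pivot_set_def by (auto simp: case_prod_beta)
  qed
  have "in_range n Q" using Q(2) unfolding pivot_set_def by auto
  then obtain M where M: "0 < M" "length Q dvd M"
    and win: "\<And>j X Y. flat (map (cyclic_strategy Q) [j..<j + M]) X Y \<Longrightarrow> diag_on {1..n} X"
    using diagonalizing_window[OF diagonalizing Q(1)] by blast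
  have periodic: "cyclic_strategy Q (l * M + j) = cyclic_strategy Q j" for l j
  proof -
    obtain m where m: "M = length Q * m" using M(2) by blast
    have "(l * M + j) mod length Q = j mod length Q"
      unfolding m by (metis mod_mult_self3 mult.assoc mult.commute)
    then show ?thesis unfolding cyclic_strategy_def by simp
  qed
  obtain U where U: "\<And>k. cmod (a k) \<le> U" "\<And>k. cmod (b k) \<le> U" "\<And>k. cmod (c k) \<le> U" "\<And>k. cmod (d k) \<le> U"
  proof -
    obtain U1 where U1: "\<And>k. norm ((cmod (a k))\<^sup>2 + (cmod (c k))\<^sup>2) \<le> U1"
      using convergent_imp_Bseq[OF convergentI[OF u1]] unfolding Bseq_def by blast
    obtain U2 where U2: "\<And>k. norm ((cmod (b k))\<^sup>2 + (cmod (d k))\<^sup>2) \<le> U2"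
      using convergent_imp_Bseq[OF convergentI[OF u2]] unfolding Bseq_def by blast
    have le: "x \<le> max U1 U2 + 1" if "x\<^sup>2 + y\<^sup>2 \<le> max U1 U2" "0 \<le> x" for x y :: real
    proof -
      have "x\<^sup>2 \<le> max U1 U2" using that(1) zero_le_power2[of y] by linarith
      \<comment> \<open>This turns bounds on squares into bounds on moduli without a square
        root.\<close>
      moreover have "2 * x \<le> x\<^sup>2 + 1" using zero_le_power2[of "x - 1"] by (simp add: power2_diff)
      moreover have "0 \<le> max U1 U2" using \<open>x\<^sup>2 \<le> max U1 U2\<close> zero_le_power2[of x] by linarith
      ultimately show ?thesis by linarith
    qed
    show ?thesis
    proof (rule that[of "max U1 U2 + 1"])
      fix k
      have 1: "(cmod (a k))\<^sup>2 + (cmod (c k))\<^sup>2 \<le> max U1 U2" using U1[of k] by simp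
      have 2: "(cmod (b k))\<^sup>2 + (cmod (d k))\<^sup>2 \<le> max U1 U2" using U2[of k] by simp
      show "cmod (a k) \<le> max U1 U2 + 1" "cmod (b k) \<le> max U1 U2 + 1"
        using le[OF 1] le[OF 2] by auto
      show "cmod (c k) \<le> max U1 U2 + 1" "cmod (d k) \<le> max U1 U2 + 1"
        using le[of "cmod (c k)" "cmod (a k)"] le[of "cmod (d k)" "cmod (b k)"] 1 2 by (auto simp: add.commute)
    qed
  qed
  \<comment> \<open>With the residue \<open>j\<close> fixed, all windows run through the same
    pivots, so that limits of windows make sense.\<close>
  have "(\<lambda>l. off2 n (X (l * M + j))) \<longlonglongrightarrow> 0" for j
  proof (rule tendsto_0_if_eventually_decreasing)
    show "0 \<le> off2 n (X (l * M + j))" for l by (rule off2_nonneg)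
    fix \<epsilon> :: real assume \<epsilon>: "0 < \<epsilon>"
    let ?y = "\<lambda>l. off2 n (X (l * M + j))"
    show "\<exists>\<delta>>0. \<exists>L. \<forall>l\<ge>L. ?y (Suc l) \<le> max \<epsilon> (?y l - \<delta>)"
    proof (rule ccontr)
      assume contra: "\<not> ?thesis"
      \<comment> \<open>The failure is used with \<delta> = 1 / (i + 1) and L = i: this yields
        arbitrarily late windows whose end value exceeds \<epsilon> while the loss stays below 1 /
        (i + 1).\<close>
      have "\<exists>l\<ge>i. ?y (Suc l) > \<epsilon> \<and> ?y (Suc l) > ?y l - 1 / real (Suc i)" for i
      proof -
        have "0 < 1 / real (Suc i)" by simp
        then have "\<not> (\<exists>L. \<forall>l\<ge>L. ?y (Suc l) \<le> max \<epsilon> (?y l - 1 / real (Suc i)))" using contra by blast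
        then obtain l where "l \<ge> i" "\<not> ?y (Suc l) \<le> max \<epsilon> (?y l - 1 / real (Suc i))" by blast
        then show ?thesis by (intro exI[of _ l]) (simp add: max_def split: if_splits)
      qed
      then obtain \<sigma> where \<sigma>: "\<And>i. \<sigma> i \<ge> i" "\<And>i. ?y (Suc (\<sigma> i)) > \<epsilon>"
        "\<And>i. ?y (Suc (\<sigma> i)) > ?y (\<sigma> i) - 1 / real (Suc i)" by metis
      define \<kappa> where "\<kappa> = (\<lambda>i. \<sigma> i * M + j)"
      have \<kappa>_ge: "i \<le> \<kappa> i" for i
      proof -
        have "i \<le> \<sigma> i * M" using \<sigma>(1)[of i] M(1) by (metis One_nat_def Suc_leI le_trans mult.right_neutral mult_le_mono2)
        then show ?thesis by (simp add: \<kappa>_def)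
      qed
      \<comment> \<open>One family for all M + 1 matrices of a window; below, \<open>f2\<close>
        collects the blocks, the codes 0, 1, 2, 3 standing for \<open>a\<close>, \<open>b\<close>,
        \<open>c\<close>, \<open>d\<close>.\<close>
      define f1 where "f1 = (\<lambda>i (t, r, s). X (\<kappa> i + t) r s)"
      have fin1: "finite ({..M} \<times> R \<times> R)" and fin2: "finite ({..M} \<times> {..3::nat})" using finR by auto
      have "cmod (f1 i x) \<le> K" if "x \<in> {..M} \<times> R \<times> R" for i x
        using that bdd unfolding f1_def R_def by auto
      then obtain r1 g1 where r1: "strict_mono r1"
        and g1: "\<And>x. x \<in> {..M} \<times> R \<times> R \<Longrightarrow> (\<lambda>i. f1 (r1 i) x) \<longlonglongrightarrow> g1 x"
        using subsequence_finite_family[OF fin1, of f1 "\<lambda>_. K"] by blast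
      define f2 where "f2 = (\<lambda>i (t, w::nat). if w = 0 then a (\<kappa> (r1 i) + t) else if w = 1 then b (\<kappa> (r1 i) + t)
         else if w = 2 then c (\<kappa> (r1 i) + t) else d (\<kappa> (r1 i) + t))"
      have "cmod (f2 i x) \<le> U" if "x \<in> {..M} \<times> {..3}" for i x
        using U unfolding f2_def by (auto split: prod.splits)
      then obtain r2 g2 where r2: "strict_mono r2"
        and g2: "\<And>x. x \<in> {..M} \<times> {..3} \<Longrightarrow> (\<lambda>i. f2 (r2 i) x) \<longlonglongrightarrow> g2 x"
        using subsequence_finite_family[OF fin2, of f2 "\<lambda>_. U"] by blast
      define \<rho> where "\<rho> = r1 \<circ> r2"
      have \<rho>: "strict_mono \<rho>" unfolding \<rho>_def using r1 r2 by (rule strict_mono_o)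
      define \<theta> where "\<theta> = (\<lambda>i. \<kappa> (\<rho> i))"
      have \<theta>_ge: "i \<le> \<theta> i" for i
        using \<kappa>_ge[of "\<rho> i"] strict_mono_imp_increasing[OF \<rho>, of i] unfolding \<theta>_def by linarith
      have \<theta>_lim: "filterlim (\<lambda>i. \<theta> i + t) sequentially sequentially" for t
        by (rule filterlim_at_top_mono[OF filterlim_ident]) (auto intro!: always_eventually trans_le_add1 \<theta>_ge)
      \<comment> \<open>Zero outside the index range makes the limits symmetric on all index pairs,
        and the step relation holds there too because the pivots lie in \<open>R\<close>.\<close>
      define XL where "XL = (\<lambda>t r s. if r \<in> R \<and> s \<in> R then g1 (t, r, s) else 0)"
      have limX: "(\<lambda>i. X (\<theta> i + t) r s) \<longlonglongrightarrow> XL t r s" if "t \<le> M" "r \<in> R" "s \<in> R" for t r s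
      proof -
        have "(\<lambda>i. f1 (r1 i) (t, r, s)) \<longlonglongrightarrow> g1 (t, r, s)" using that by (intro g1) auto
        from LIMSEQ_subseq_LIMSEQ[OF this r2] show ?thesis
          using that by (simp add: f1_def XL_def \<theta>_def \<rho>_def comp_def)
      qed
      define al bl cl dl where "al = (\<lambda>t. g2 (t, 0))" and "bl = (\<lambda>t. g2 (t, 1))"
        and "cl = (\<lambda>t. g2 (t, 2))" and "dl = (\<lambda>t. g2 (t, 3))"
      have limu: "(\<lambda>i. a (\<theta> i + t)) \<longlonglongrightarrow> al t" "(\<lambda>i. b (\<theta> i + t)) \<longlonglongrightarrow> bl t"
        "(\<lambda>i. c (\<theta> i + t)) \<longlonglongrightarrow> cl t" "(\<lambda>i. d (\<theta> i + t)) \<longlonglongrightarrow> dl t" if "t < M" for t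
        using g2[of "(t, 0)"] g2[of "(t, 1)"] g2[of "(t, 2)"] g2[of "(t, 3)"] that
        by (simp_all add: f2_def \<theta>_def \<rho>_def al_def bl_def cl_def dl_def comp_def)
      have strat: "cyclic_strategy Q (\<theta> i + t) = cyclic_strategy Q (j + t)" for i t
        unfolding \<theta>_def \<kappa>_def using periodic[of "\<sigma> (\<rho> i)" "j + t"] by (simp add: add.assoc)
      have hXL: "herm (XL t)" if "t \<le> M" for t
        unfolding herm_def
      proof (intro allI)
        fix r s
        show "XL t s r = cnj (XL t r s)"
        proof (cases "r \<in> R \<and> s \<in> R")
          case True
          have "(\<lambda>i. cnj (X (\<theta> i + t) r s)) \<longlonglongrightarrow> cnj (XL t r s)"
            using limX that True by (intro tendsto_cnj) auto
          moreover have "X k s r = cnj (X k r s)" for k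
            using herm[of k] True unfolding hermitian_n_def R_def by blast
          ultimately have "(\<lambda>i. X (\<theta> i + t) s r) \<longlonglongrightarrow> cnj (XL t r s)" by (simp only:)
          then show ?thesis using limX[OF that, of s r] True by (intro LIMSEQ_unique[of "\<lambda>i. X (\<theta> i + t) s r"]) auto
        qed (auto simp: XL_def)
      qed
      have stepL: "XL (Suc t) = pcong (al t) (bl t) (cl t) (dl t) (p (j + t)) (q (j + t)) (XL t)"
        if t: "t < M" for t
      proof (intro ext)
        fix r s
        let ?P = "pcong (al t) (bl t) (cl t) (dl t) (p (j + t)) (q (j + t)) (XL t)"
        show "XL (Suc t) r s = ?P r s"
        proof (cases "r \<in> R \<and> s \<in> R")
          case True
          have "(\<lambda>i. pcong (a (\<theta> i + t)) (b (\<theta> i + t)) (c (\<theta> i + t)) (d (\<theta> i + t))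
              (p (j + t)) (q (j + t)) (X (\<theta> i + t)) r s) \<longlonglongrightarrow> ?P r s"
            using t True by (intro tendsto_pcong[where R = R] limu limX pq) auto
          moreover have "pcong (a (\<theta> i + t)) (b (\<theta> i + t)) (c (\<theta> i + t)) (d (\<theta> i + t))
              (p (j + t)) (q (j + t)) (X (\<theta> i + t)) r s = X (\<theta> i + Suc t) r s" for i
            using step[of r s "\<theta> i + t"] True strat unfolding p_def q_def R_def by simp
          ultimately have "(\<lambda>i. X (\<theta> i + Suc t) r s) \<longlonglongrightarrow> ?P r s" by simp
          moreover have "(\<lambda>i. X (\<theta> i + Suc t) r s) \<longlonglongrightarrow> XL (Suc t) r s" using t True by (intro limX) auto
          ultimately show ?thesis using LIMSEQ_unique by blast
        next
          case False
          have "XL t r s = 0" if "r \<notin> R \<or> s \<notin> R" for r s using that by (auto simp: XL_def)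
          then show ?thesis
            using False pq[of "j + t"] unfolding pcong_def Let_def XL_def by auto
        qed
      qed
      have pivL: "XL (Suc t) (p (j + t)) (q (j + t)) = 0" if "t < M" for t
      proof -
        have "(\<lambda>i. X (\<theta> i + Suc t) (p (j + t)) (q (j + t))) \<longlonglongrightarrow> XL (Suc t) (p (j + t)) (q (j + t))"
          using that pq by (intro limX) auto
        moreover have "X (\<theta> i + Suc t) (p (j + t)) (q (j + t)) = 0" for i
          using piv[of "\<theta> i + t"] strat[of i t] unfolding p_def q_def by simp
        ultimately show ?thesis by (simp add: LIMSEQ_const_iff)
      qed
      have uL: "(cmod (al t))\<^sup>2 + (cmod (cl t))\<^sup>2 = 1" "(cmod (bl t))\<^sup>2 + (cmod (dl t))\<^sup>2 = 1"
          "cnj (al t) * bl t + cnj (cl t) * dl t = 0" if t: "t < M" for t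
      proof -
        have "(\<lambda>i. (cmod (a (\<theta> i + t)))\<^sup>2 + (cmod (c (\<theta> i + t)))\<^sup>2) \<longlonglongrightarrow> (cmod (al t))\<^sup>2 + (cmod (cl t))\<^sup>2"
          by (intro tendsto_intros limu t)
        then show "(cmod (al t))\<^sup>2 + (cmod (cl t))\<^sup>2 = 1"
          using filterlim_compose[OF u1 \<theta>_lim[of t]] by (rule LIMSEQ_unique)
        have "(\<lambda>i. (cmod (b (\<theta> i + t)))\<^sup>2 + (cmod (d (\<theta> i + t)))\<^sup>2) \<longlonglongrightarrow> (cmod (bl t))\<^sup>2 + (cmod (dl t))\<^sup>2"
          by (intro tendsto_intros limu t)
        then show "(cmod (bl t))\<^sup>2 + (cmod (dl t))\<^sup>2 = 1"
          using filterlim_compose[OF u2 \<theta>_lim[of t]] by (rule LIMSEQ_unique)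
        have "(\<lambda>i. cnj (a (\<theta> i + t)) * b (\<theta> i + t) + cnj (c (\<theta> i + t)) * d (\<theta> i + t))
          \<longlonglongrightarrow> cnj (al t) * bl t + cnj (cl t) * dl t"
          by (intro tendsto_intros limu t)
        then show "cnj (al t) * bl t + cnj (cl t) * dl t = 0"
          using filterlim_compose[OF u3 \<theta>_lim[of t]] by (rule LIMSEQ_unique)
      qed
      have nz: "al t \<noteq> 0" "dl t \<noteq> 0" if t: "t < M" for t
      proof -
        have "\<forall>\<^sub>F i in sequentially. 1 / 2 \<le> cmod (a (\<theta> i + t))"
          "\<forall>\<^sub>F i in sequentially. 1 / 2 \<le> cmod (d (\<theta> i + t))"
          using low \<theta>_lim[of t] unfolding filterlim_iff by blast+
        then have "1 / 2 \<le> cmod (al t)" "1 / 2 \<le> cmod (dl t)"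
          using tendsto_lowerbound[OF tendsto_norm[OF limu(1)[OF t]]]
            tendsto_lowerbound[OF tendsto_norm[OF limu(4)[OF t]]] trivial_limit_sequentially by blast+
        then show "al t \<noteq> 0" "dl t \<noteq> 0" by auto
      qed
      \<comment> \<open>The limit blocks are exactly unitary, so the energy identity holds with no
        error term.\<close>
      have energy: "off2 n (XL (Suc t)) + 2 * (cmod (XL t (p (j + t)) (q (j + t))))\<^sup>2 = off2 n (XL t)"
        if t: "t < M" for t
        using off2_pcong[OF hXL _ _ pq(3) uL[OF t] nz(2)[OF t] stepL[OF t] pivL[OF t]] t pq
        unfolding R_def by auto
      have total: "off2 n (XL m) + (\<Sum>t<m. 2 * (cmod (XL t (p (j + t)) (q (j + t))))\<^sup>2) = off2 n (XL 0)"
        if "m \<le> M" for m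
        using that
      proof (induction m)
        case (Suc m)
        then show ?case using energy[of m] by simp
      qed simp
      have "(\<lambda>i. off2 n (X (\<theta> i + 0))) \<longlonglongrightarrow> off2 n (XL 0)"
        using limX unfolding R_def by (intro tendsto_off2) blast+
      then have limy: "(\<lambda>i. ?y (\<sigma> (\<rho> i))) \<longlonglongrightarrow> off2 n (XL 0)"
        by (simp add: \<theta>_def \<kappa>_def)
      have "(\<lambda>i. off2 n (X (\<theta> i + M))) \<longlonglongrightarrow> off2 n (XL M)"
        using limX unfolding R_def by (intro tendsto_off2) blast+
      then have limyS: "(\<lambda>i. ?y (Suc (\<sigma> (\<rho> i)))) \<longlonglongrightarrow> off2 n (XL M)"
        by (simp add: \<theta>_def \<kappa>_def add_ac)
      have \<epsilon>_le: "\<epsilon> \<le> off2 n (XL M)"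
        using \<sigma>(2) by (intro tendsto_lowerbound[OF limyS]) (auto intro!: always_eventually less_imp_le)
      have "(\<lambda>i. 1 / real (Suc (\<rho> i))) \<longlonglongrightarrow> 0"
        using LIMSEQ_subseq_LIMSEQ[OF LIMSEQ_inverse_real_of_nat \<rho>] by (simp add: comp_def inverse_eq_divide)
      from tendsto_diff[OF limy this]
      have "(\<lambda>i. ?y (\<sigma> (\<rho> i)) - 1 / real (Suc (\<rho> i))) \<longlonglongrightarrow> off2 n (XL 0)" by simp
      \<comment> \<open>The loss bounds 1 / (i + 1) tend to zero, so the limit window loses nothing;
        its loss being twice the sum of the squared pivots, every limit pivot vanishes.\<close>
      then have "off2 n (XL 0) \<le> off2 n (XL M)"
        using \<sigma>(3) by (intro LIMSEQ_le[OF _ limyS]) (auto intro!: exI[of _ 0] less_imp_le)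
      then have "(\<Sum>t<M. 2 * (cmod (XL t (p (j + t)) (q (j + t))))\<^sup>2) \<le> 0" using total[of M] by simp
      moreover have "0 \<le> (\<Sum>t<M. 2 * (cmod (XL t (p (j + t)) (q (j + t))))\<^sup>2)" by (intro sum_nonneg) auto
      ultimately have "(\<Sum>t<M. 2 * (cmod (XL t (p (j + t)) (q (j + t))))\<^sup>2) = 0" by linarith
      then have zero: "XL t (p (j + t)) (q (j + t)) = 0" if "t < M" for t
        using that by (subst (asm) sum_nonneg_eq_0_iff) auto
      have "flat_step (cyclic_strategy Q (j + t)) (XL t) (XL (Suc t))" if t: "t < M" for t
        using flat_stepI[OF pq(3) hXL zero[OF t] pivL[OF t] nz[OF t] unitary2_rows(4)[OF uL[OF t] nz(2)[OF t]]
          stepL[OF t]] t unfolding p_def q_def by simp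
      then have "diag_on {1..n} (XL 0)" using win flat_chain[of M "cyclic_strategy Q" j XL] by blast
      then have "off2 n (XL 0) = 0" by (rule off2_diag_on)
      \<comment> \<open>\<open>off2\<close> is zero at the start of the limit window, does not grow
        along it and is at least \<epsilon> at its end.\<close>
      then show False using total[of M] \<open>0 \<le> (\<Sum>t<M. _ t)\<close> \<epsilon>_le \<epsilon> by simp
    qed
  qed
  then show ?thesis
    using tendsto_if_residues[OF M(1), of "\<lambda>k. off2 n (X k)"] by blast
qed

section \<open>The two-dimensional step\<close>

definition sesq :: "complex \<Rightarrow> complex \<Rightarrow> complex \<Rightarrow> complex \<Rightarrow> complex \<Rightarrow> complex \<Rightarrow> complex \<Rightarrow> complex \<Rightarrow> complex" where
  "sesq g11 g12 g21 g22 v1 v2 w1 w2 = cnj v1 * (g11 * w1 + g12 * w2) + cnj v2 * (g21 * w1 + g22 * w2)"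

text \<open>The form of G at Cv and Cw is the form of the congruent matrix at v and w, the pairs
  (c11, c21) and (c12, c22) being the columns of C. This lets the block CJ be treated in two
  stages.\<close>

lemma sesq_comp:
  "sesq g11 g12 g21 g22 (c11 * v1 + c12 * v2) (c21 * v1 + c22 * v2) (c11 * w1 + c12 * w2) (c21 * w1 + c22 * w2)
   = sesq (sesq g11 g12 g21 g22 c11 c21 c11 c21) (sesq g11 g12 g21 g22 c11 c21 c12 c22)
          (sesq g11 g12 g21 g22 c12 c22 c11 c21) (sesq g11 g12 g21 g22 c12 c22 c12 c22) v1 v2 w1 w2"
  unfolding sesq_def by (simp add: algebra_simps)

lemma sesq_hermitian:
  assumes "Im g11 = 0" "Im g22 = 0" "g21 = cnj g12"
  shows "sesq g11 g12 g21 g22 w1 w2 v1 v2 = cnj (sesq g11 g12 g21 g22 v1 v2 w1 w2)"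
proof -
  have "cnj g11 = g11" "cnj g22 = g22" using assms by (simp_all add: complex_eq_iff)
  then show ?thesis using assms(3) unfolding sesq_def by (simp add: algebra_simps)
qed

lemma cj_phi_bounds: "\<bar>cj_phi m11 m12 m22\<bar> \<le> pi / 4"
proof -
  have "\<bar>arctan x / 2\<bar> \<le> pi / 4" for x using arctan_bounded[of x] by (auto simp: abs_if)
  then show ?thesis unfolding cj_phi_def by auto
qed

text \<open>The angle is at most pi/4, and 7/10 is a rational number below sqrt 2 / 2. It leaves
  room for a perturbation of 1/5 above the bound 1/2 that the Jacobi process asks for.\<close>

lemma cos_cj_phi: "7 / 10 \<le> cos (cj_phi m11 m12 m22)"
proof -
  let ?\<phi> = "cj_phi m11 m12 m22"
  have "cos (pi / 4) \<le> cos \<bar>?\<phi>\<bar>"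
    using cj_phi_bounds[of m11 m12 m22] pi_gt_zero by (intro cos_monotone_0_pi_le) auto
  moreover have "(7 / 5 :: real) \<le> sqrt 2" by (rule real_le_rsqrt) (simp add: power2_eq_square)
  ultimately show ?thesis by (simp add: cos_45)
qed

text \<open>The equation for tan (2 \<phi>) without denominators, so that it covers equal diagonal
  entries too, where \<phi> is pi/4 or m12 is zero.\<close>

lemma cj_phi_annihilates:
  fixes m11 m12 m22 :: complex
  defines "\<phi> \<equiv> cj_phi m11 m12 m22"
  shows "cmod m12 * ((cos \<phi>)\<^sup>2 - (sin \<phi>)\<^sup>2) = (Re m11 - Re m22) * sin \<phi> * cos \<phi>"
proof (cases "Re m11 = Re m22")
  case True
  then show ?thesis unfolding \<phi>_def cj_phi_def by (simp add: sin_45 cos_45)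
next
  case False
  define t where "t = 2 * cmod m12 / (Re m11 - Re m22)"
  have \<phi>: "2 * \<phi> = arctan t" unfolding \<phi>_def cj_phi_def t_def using False by simp
  have "sin (2 * \<phi>) = t * cos (2 * \<phi>)"
    unfolding \<phi> using tan_arctan[of t] cos_arctan_not_zero[of t] unfolding tan_def
    by (simp add: field_simps)
  then have "(Re m11 - Re m22) * sin (2 * \<phi>) = 2 * cmod m12 * cos (2 * \<phi>)"
    using False unfolding t_def by (simp add: field_simps)
  then show ?thesis by (simp add: sin_double cos_double)
qed

text \<open>Everything rests on |b|^2 = 1 - \<beta>^2. The first three claims say that C brings the
  pivot block of \<open>B\<close> to the identity. The last one records the triangular shape, whose
  off-diagonal entry tends to zero with b; it is the source of the lower bounds for the diagonal of
  the block.\<close>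

lemma cj_C_props:
  fixes A B :: cmat and i j :: nat
  assumes b: "cmod (B i j) < 1" and C: "cj_C A B i j = (c11, c12, c21, c22)"
  defines "\<beta> \<equiv> sqrt (1 - (cmod (B i j))\<^sup>2)"
  shows "sesq 1 (B i j) (cnj (B i j)) 1 c11 c21 c11 c21 = 1"
    and "sesq 1 (B i j) (cnj (B i j)) 1 c11 c21 c12 c22 = 0"
    and "sesq 1 (B i j) (cnj (B i j)) 1 c12 c22 c12 c22 = 1"
    and "c11 * c22 - c12 * c21 = complex_of_real (1 / \<beta>)"
    and "(c11 = 1 \<and> cmod c12 = cmod (B i j) / \<beta> \<and> c21 = 0 \<and> c22 = complex_of_real (1 / \<beta>)) \<or>
         (c22 = 1 \<and> cmod c21 = cmod (B i j) / \<beta> \<and> c12 = 0 \<and> c11 = complex_of_real (1 / \<beta>))"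
proof -
  let ?b = "B i j"
  have "(cmod ?b)\<^sup>2 < 1" using b by (simp add: abs_square_less_1)
  then have \<beta>: "0 < \<beta>" "\<beta>\<^sup>2 = 1 - (cmod ?b)\<^sup>2" unfolding \<beta>_def by auto
  have b2: "?b * cnj ?b = 1 - complex_of_real \<beta> * complex_of_real \<beta>"
    using \<beta>(2) by (metis add_diff_cancel_left' complex_norm_square diff_add_cancel of_real_1 of_real_diff of_real_mult power2_eq_square)
  have nz: "complex_of_real \<beta> \<noteq> 0" using \<beta>(1) by simp
  have alt: "(c11, c12, c21, c22) = (1, - ?b / \<beta>, 0, 1 / \<beta>) \<or>
    (c11, c12, c21, c22) = (1 / \<beta>, 0, - cnj ?b / \<beta>, 1)"
    using C unfolding cj_C_def \<beta>_def by (auto simp: Let_def split: if_splits)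
  have "sesq 1 ?b (cnj ?b) 1 c11 c21 c11 c21 = 1 \<and> sesq 1 ?b (cnj ?b) 1 c11 c21 c12 c22 = 0 \<and>
    sesq 1 ?b (cnj ?b) 1 c12 c22 c12 c22 = 1"
    using alt
  proof
    assume "(c11, c12, c21, c22) = (1, - ?b / \<beta>, 0, 1 / \<beta>)"
    then have c: "c11 = 1" "c12 = - ?b / \<beta>" "c21 = 0" "c22 = 1 / \<beta>" by auto
    have "c12 + ?b * c22 = 0" unfolding c by simp
    moreover have "cnj ?b * c12 + c22 = complex_of_real \<beta>"
    proof -
      have "cnj ?b * c12 + c22 = (1 - ?b * cnj ?b) / \<beta>" unfolding c by (simp add: diff_divide_distrib)
      then show ?thesis unfolding b2 using nz by simp
    qed
    moreover have "cnj c22 * complex_of_real \<beta> = 1" unfolding c using nz by simp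
    ultimately show ?thesis unfolding sesq_def by (simp add: c(1,3))
  next
    assume "(c11, c12, c21, c22) = (1 / \<beta>, 0, - cnj ?b / \<beta>, 1)"
    then have c: "c11 = 1 / \<beta>" "c12 = 0" "c21 = - cnj ?b / \<beta>" "c22 = 1" by auto
    have "cnj ?b * c11 + c21 = 0" "cnj c11 * ?b + cnj c21 = 0" unfolding c by simp_all
    moreover have "c11 + ?b * c21 = complex_of_real \<beta>"
    proof -
      have "c11 + ?b * c21 = (1 - ?b * cnj ?b) / \<beta>" unfolding c by (simp add: diff_divide_distrib)
      then show ?thesis unfolding b2 using nz by simp
    qed
    moreover have "cnj c11 * complex_of_real \<beta> = 1" unfolding c using nz by simp
    ultimately show ?thesis unfolding sesq_def by (simp add: c(2,4))
  qed
  then show "sesq 1 ?b (cnj ?b) 1 c11 c21 c11 c21 = 1"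
    "sesq 1 ?b (cnj ?b) 1 c11 c21 c12 c22 = 0"
    "sesq 1 ?b (cnj ?b) 1 c12 c22 c12 c22 = 1" by auto
  show "c11 * c22 - c12 * c21 = complex_of_real (1 / \<beta>)" using alt by auto
  show "(c11 = 1 \<and> cmod c12 = cmod ?b / \<beta> \<and> c21 = 0 \<and> c22 = complex_of_real (1 / \<beta>)) \<or>
         (c22 = 1 \<and> cmod c21 = cmod ?b / \<beta> \<and> c12 = 0 \<and> c11 = complex_of_real (1 / \<beta>))"
    using alt \<beta>(1) by (auto simp: norm_divide)
qed

text \<open>C normalizes the block of \<open>B\<close>, and the unitary J preserves this while
  diagonalizing the block of \<open>A\<close>. A diagonal entry of CJ is cos \<phi> times 1 or 1 /
  \<beta>, which is at least 1, plus a term of modulus at most |b| / \<beta>.\<close>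

lemma cj_Zhat_props:
  fixes A B :: cmat and i j :: nat
  assumes A: "Im (A i i) = 0" "Im (A j j) = 0" "A j i = cnj (A i j)"
    and b: "cmod (B i j) < 1"
    and Z: "cj_Zhat A B i j = (z11, z12, z21, z22)"
  defines "\<beta> \<equiv> sqrt (1 - (cmod (B i j))\<^sup>2)"
  shows "sesq 1 (B i j) (cnj (B i j)) 1 z11 z21 z11 z21 = 1"
    and "sesq 1 (B i j) (cnj (B i j)) 1 z11 z21 z12 z22 = 0"
    and "sesq 1 (B i j) (cnj (B i j)) 1 z12 z22 z12 z22 = 1"
    and "sesq (A i i) (A i j) (A j i) (A j j) z11 z21 z12 z22 = 0"
    and "z11 * z22 - z12 * z21 = complex_of_real (1 / \<beta>)"
    and "7 / 10 - cmod (B i j) / \<beta> \<le> cmod z11"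
    and "7 / 10 - cmod (B i j) / \<beta> \<le> cmod z22"
proof -
  obtain c11 c12 c21 c22 where C: "cj_C A B i j = (c11, c12, c21, c22)" by (metis prod_cases4)
  note Cp = cj_C_props[OF b C, folded \<beta>_def]
  let ?sA = "sesq (A i i) (A i j) (A j i) (A j j)"
  let ?sB = "sesq 1 (B i j) (cnj (B i j)) 1"
  define m11 m12 m21 m22 where "m11 = ?sA c11 c21 c11 c21" and "m12 = ?sA c11 c21 c12 c22"
    and "m21 = ?sA c12 c22 c11 c21" and "m22 = ?sA c12 c22 c12 c22"
  have M: "cj_M A B i j = (m11, m12, m21, m22)"
    unfolding cj_M_def C m11_def m12_def m21_def m22_def sesq_def by (simp add: Let_def)
  have mh: "m21 = cnj m12" "m11 = cnj m11" "m22 = cnj m22"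
    unfolding m11_def m12_def m21_def m22_def by (rule sesq_hermitian[OF A])+
  define \<phi> where "\<phi> = cj_phi m11 m12 m22"
  define co si where "co = complex_of_real (cos \<phi>)" and "si = complex_of_real (sin \<phi>)"
  \<comment> \<open>The phase of \<open>m12\<close>; the factorization into modulus and phase is
    valid at \<open>m12 = 0\<close> as well.\<close>
  define e where "e = cis (Arg m12)"
  have e: "cis (- Arg m12) = cnj e" "e * cnj e = 1" "m12 = complex_of_real (cmod m12) * e"
    using rcis_cmod_Arg[of m12] unfolding e_def rcis_def by (simp_all add: cis_cnj cis_mult)
  have cosi: "co * co + si * si = 1" "cnj co = co" "cnj si = si"
    unfolding co_def si_def by (simp_all flip: of_real_mult of_real_add add: sin_cos_squared_add3)
  define j11 j12 j21 j22 where "j11 = co" and "j12 = - e * si" and "j21 = cnj e * si" and "j22 = co"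
  have z: "z11 = c11 * j11 + c12 * j21" "z12 = c11 * j12 + c12 * j22"
      "z21 = c21 * j11 + c22 * j21" "z22 = c21 * j12 + c22 * j22"
    using Z unfolding cj_Zhat_def C M
    by (simp_all add: Let_def j11_def j12_def j21_def j22_def co_def si_def e(1) \<phi>_def flip: e_def)
  have "?sB c12 c22 c11 c21 = cnj (?sB c11 c21 c12 c22)" by (rule sesq_hermitian) auto
  \<comment> \<open>In the coordinates given by C, the form of the pivot block of \<open>B\<close>
    is the standard inner product, so only the orthonormality of the columns of J remains.\<close>
  then have I: "?sB (c11 * v1 + c12 * v2) (c21 * v1 + c22 * v2) (c11 * w1 + c12 * w2) (c21 * w1 + c22 * w2)
      = cnj v1 * w1 + cnj v2 * w2" for v1 v2 w1 w2
    unfolding sesq_comp Cp(1-3) by (simp add: Cp(2) sesq_def)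
  \<comment> \<open>Cancellation of \<open>e\<close> against its conjugate at the places where the
    normal form for products puts them.\<close>
  have ee: "e * (x * (y * cnj e)) = x * y" "e * (x * cnj e) = x" "e * (cnj e * x) = x"
      "e * (x * (cnj e * y)) = x * y" "e * (x * (y * (cnj e * w))) = x * (y * w)"
      "e * (x * (y * (w * cnj e))) = x * (y * w)" for x y w
  proof -
    have "e * (x * (y * cnj e)) = x * y * (e * cnj e)" "e * (x * cnj e) = x * (e * cnj e)"
      "e * (cnj e * x) = x * (e * cnj e)" "e * (x * (cnj e * y)) = x * y * (e * cnj e)"
      "e * (x * (y * (cnj e * w))) = x * (y * w) * (e * cnj e)"
      "e * (x * (y * (w * cnj e))) = x * (y * w) * (e * cnj e)"
      by (simp_all only: mult_ac)
    then show "e * (x * (y * cnj e)) = x * y" "e * (x * cnj e) = x" "e * (cnj e * x) = x"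
      "e * (x * (cnj e * y)) = x * y" "e * (x * (y * (cnj e * w))) = x * (y * w)"
      "e * (x * (y * (w * cnj e))) = x * (y * w)"
      by (simp_all only: e(2) mult_1_right)
  qed
  show "?sB z11 z21 z11 z21 = 1" "?sB z11 z21 z12 z22 = 0" "?sB z12 z22 z12 z22 = 1"
    unfolding z I j11_def j12_def j21_def j22_def using cosi
    by (simp_all add: mult_ac ee add.commute)
  have "?sA z11 z21 z12 z22 = sesq m11 m12 m21 m22 j11 j21 j12 j22"
    unfolding z sesq_comp m11_def m12_def m21_def m22_def ..
  \<comment> \<open>The phase chosen in J makes \<open>e\<close> a common factor; what is left is a
    real equation for \<phi>.\<close>
  also have "\<dots> = e * (complex_of_real (cmod m12) * (co * co - si * si) - (m11 - m22) * si * co)"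
  proof -
    have "m21 = complex_of_real (cmod m12) * cnj e" using mh(1) e(3) by (metis complex_cnj_complex_of_real complex_cnj_mult)
    then show ?thesis
      unfolding sesq_def j11_def j12_def j21_def j22_def
      by (subst e(3)) (simp add: cosi algebra_simps ee)
  qed
  also have "complex_of_real (cmod m12) * (co * co - si * si) - (m11 - m22) * si * co = 0"
  proof -
    have "m11 - m22 = complex_of_real (Re m11 - Re m22)"
      using mh(2,3) by (simp add: complex_eq_iff)
    then show ?thesis
      using arg_cong[OF cj_phi_annihilates[of m12 m11 m22], of complex_of_real]
      unfolding co_def si_def \<phi>_def by (simp add: power2_eq_square)
  qed
  finally show "?sA z11 z21 z12 z22 = 0" by simp
  have "z11 * z22 - z12 * z21 = (c11 * c22 - c12 * c21) * (j11 * j22 - j12 * j21)"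
    unfolding z by (simp add: algebra_simps)
  also have "j11 * j22 - j12 * j21 = 1"
    unfolding j11_def j12_def j21_def j22_def using cosi e(2) by (simp add: mult_ac ee)
  finally show "z11 * z22 - z12 * z21 = complex_of_real (1 / \<beta>)" using Cp(4) by simp
  have "(cmod (B i j))\<^sup>2 < 1" using b by (simp add: abs_square_less_1)
  then have \<beta>: "0 < \<beta>" "\<beta> \<le> 1" unfolding \<beta>_def by (auto simp: real_sqrt_le_1_iff)
  have cop: "7 / 10 \<le> cmod co" using cos_cj_phi[of m11 m12 m22] unfolding co_def \<phi>_def by simp
  have "cmod si \<le> 1" unfolding si_def by simp
  moreover have "cmod e = 1" unfolding e_def by simp
  ultimately have j: "cmod j12 \<le> 1" "cmod j21 \<le> 1"
    unfolding j12_def j21_def by (simp_all add: norm_mult)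
  have "cmod (complex_of_real (1 / \<beta>) * co) \<ge> 7 / 10"
  proof -
    have "1 \<le> 1 / \<beta>" using \<beta> by simp
    then have "7 / 10 * 1 \<le> cmod co * (1 / \<beta>)" using cop by (intro mult_mono) auto
    then show ?thesis using \<beta>(1) by (simp add: norm_mult norm_divide)
  qed
  moreover have "7 / 10 - cmod x \<le> cmod (co + x * y)" if "cmod y \<le> 1" for x y
  proof -
    have "cmod co - cmod (x * y) \<le> cmod (co + x * y)" using norm_diff_ineq by blast
    moreover have "cmod (x * y) \<le> cmod x" using that by (simp add: norm_mult mult_left_le)
    ultimately show ?thesis using cop by linarith
  qed
  moreover have "0 \<le> cmod (B i j) / \<beta>" using \<beta> by simp
  ultimately show "7 / 10 - cmod (B i j) / \<beta> \<le> cmod z11" "7 / 10 - cmod (B i j) / \<beta> \<le> cmod z22"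
    using Cp(5) j unfolding z j11_def j22_def
    by (elim disjE, auto simp: add.commute intro: order_trans) (metis add.commute)+
qed

section \<open>Determinants\<close>

definition plane_mat :: "complex \<Rightarrow> complex \<Rightarrow> complex \<Rightarrow> complex \<Rightarrow> nat \<Rightarrow> nat \<Rightarrow> cmat" where
  "plane_mat a b c d p q = (\<lambda>r s. if r = p \<and> s = p then a else if r = p \<and> s = q then b
     else if r = q \<and> s = p then c else if r = q \<and> s = q then d else if r = s then 1 else 0)"

lemma mmult_assoc: "mmult n (mmult n X Y) W = mmult n X (mmult n Y W)"
proof (intro ext)
  fix i j
  have "mmult n (mmult n X Y) W i j = (\<Sum>k = 1..n. \<Sum>l = 1..n. X i l * Y l k * W k j)"
    unfolding mmult_def by (simp add: sum_distrib_right)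
  also have "\<dots> = (\<Sum>l = 1..n. \<Sum>k = 1..n. X i l * Y l k * W k j)" by (rule sum.swap)
  also have "\<dots> = mmult n X (mmult n Y W) i j"
    unfolding mmult_def by (simp add: sum_distrib_left mult.assoc)
  finally show "mmult n (mmult n X Y) W i j = mmult n X (mmult n Y W) i j" .
qed

lemma cadj_mmult: "cadj (mmult n X Y) = mmult n (cadj Y) (cadj X)"
  unfolding cadj_def mmult_def by (simp add: mult.commute)

lemma cadj_cadj: "cadj (cadj X) = X"
  unfolding cadj_def by simp

lemma mmult_plane_mat:
  assumes "p \<in> {1..n}" "q \<in> {1..n}" "p \<noteq> q" "s \<in> {1..n}"
  shows "mmult n X (plane_mat a b c d p q) r s =
    (if s = p then X r p * a + X r q * c else if s = q then X r p * b + X r q * d else X r s)"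
proof (cases "s \<in> {p, q}")
  case True
  have "mmult n X (plane_mat a b c d p q) r s = (\<Sum>k\<in>{p, q}. X r k * plane_mat a b c d p q k s)"
    unfolding mmult_def
    by (rule sum.mono_neutral_right) (use assms True in \<open>auto simp: plane_mat_def\<close>)
  then show ?thesis using True assms(3) by (auto simp: plane_mat_def)
next
  case False
  have "mmult n X (plane_mat a b c d p q) r s = (\<Sum>k\<in>{s}. X r k * plane_mat a b c d p q k s)"
    unfolding mmult_def
    by (rule sum.mono_neutral_right) (use assms False in \<open>auto simp: plane_mat_def\<close>)
  then show ?thesis using False by (auto simp: plane_mat_def)
qed

lemma mmult_cadj_plane_mat:
  assumes "p \<in> {1..n}" "q \<in> {1..n}" "p \<noteq> q" "r \<in> {1..n}"
  shows "mmult n (cadj (plane_mat a b c d p q)) X r s =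
    (if r = p then cnj a * X p s + cnj c * X q s else if r = q then cnj b * X p s + cnj d * X q s else X r s)"
proof -
  have "mmult n (cadj (plane_mat a b c d p q)) X r s = cnj (mmult n (cadj X) (plane_mat a b c d p q) s r)"
    by (metis cadj_cadj cadj_def cadj_mmult)
  then show ?thesis unfolding mmult_plane_mat[OF assms] by (simp add: cadj_def mult.commute)
qed

text \<open>The bridge between matrix products over 1..n, in which the method is stated, and the
  dimension-free \<open>pcong\<close>.\<close>

lemma mmult_plane_mat_pcong:
  assumes "p \<in> {1..n}" "q \<in> {1..n}" "p \<noteq> q" "r \<in> {1..n}" "s \<in> {1..n}"
  shows "mmult n (mmult n (cadj (plane_mat a b c d p q)) X) (plane_mat a b c d p q) r s =
    pcong a b c d p q X r s"
  unfolding mmult_assoc mmult_cadj_plane_mat[OF assms(1-4)] mmult_plane_mat[OF assms(1-3,5)]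
    pcong_def Let_def ..

lemma cadj_plane_mat:
  "p \<noteq> q \<Longrightarrow> cadj (plane_mat a b c d p q) = plane_mat (cnj a) (cnj c) (cnj b) (cnj d) p q"
  unfolding cadj_def plane_mat_def by (auto simp: fun_eq_iff)

section \<open>Determinants over the index range 1..n\<close>

lemma cdet_leibniz:
  "cdet n X = (\<Sum>\<pi> | \<pi> permutes {0..<n}. of_int (sign \<pi>) * (\<Prod>i = 0..<n. X (Suc i) (Suc (\<pi> i))))"
proof -
  have "cdet n X = (\<Sum>\<pi> | \<pi> permutes {0..<n}. of_int (sign \<pi>) *
      (\<Prod>i = 0..<n. (mat n n (\<lambda>(i, j). X (Suc i) (Suc j))) $$ (i, \<pi> i)))"
    unfolding cdet_def by (rule det_def') simp
  also have "\<dots> = (\<Sum>\<pi> | \<pi> permutes {0..<n}. of_int (sign \<pi>) * (\<Prod>i = 0..<n. X (Suc i) (Suc (\<pi> i))))"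
  proof (intro sum.cong refl arg_cong2[of _ _ _ _ "(*)"] prod.cong)
    fix \<pi> i assume "\<pi> \<in> {\<pi>. \<pi> permutes {0..<n}}" "i \<in> {0..<n}"
    then have "i < n" "\<pi> i < n" using permutes_in_image[of \<pi> "{0..<n}" i] by auto
    then show "mat n n (\<lambda>(i, j). X (Suc i) (Suc j)) $$ (i, \<pi> i) = X (Suc i) (Suc (\<pi> i))" by simp
  qed
  finally show ?thesis .
qed

lemma cdet_cong:
  assumes "\<And>i j. i \<in> {1..n} \<Longrightarrow> j \<in> {1..n} \<Longrightarrow> X i j = Y i j"
  shows "cdet n X = cdet n Y"
proof -
  have "mat n n (\<lambda>(i, j). X (Suc i) (Suc j)) = mat n n (\<lambda>(i, j). Y (Suc i) (Suc j))"
    by (rule cong_mat) (use assms in auto)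
  then show ?thesis unfolding cdet_def by simp
qed

lemma cdet_mmult: "cdet n (mmult n X Y) = cdet n X * cdet n Y"
proof -
  have "mat n n (\<lambda>(i, j). mmult n X Y (Suc i) (Suc j)) =
      mat n n (\<lambda>(i, j). X (Suc i) (Suc j)) * mat n n (\<lambda>(i, j). Y (Suc i) (Suc j))"
    by (rule eq_matI)
      (auto simp: mmult_def scalar_prod_def sum.atLeast1_atMost_eq atLeast0LessThan[symmetric])
  then show ?thesis unfolding cdet_def by (simp add: det_mult[where n = n])
qed

lemma cdet_diagonal:
  assumes "\<And>i j. i \<in> {1..n} \<Longrightarrow> j \<in> {1..n} \<Longrightarrow> i \<noteq> j \<Longrightarrow> X i j = 0"
  shows "cdet n X = (\<Prod>i = 1..n. X i i)"
proof -
  let ?M = "mat n n (\<lambda>(i, j). X (Suc i) (Suc j))"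
  have "upper_triangular ?M" using assms by (auto simp: upper_triangular_def)
  then have "cdet n X = prod_list (diag_mat ?M)"
    unfolding cdet_def by (rule det_upper_triangular[of _ n]) simp
  also have "\<dots> = (\<Prod>i = 0..<n. X (Suc i) (Suc i))" unfolding prod_list_diag_prod by simp
  also have "\<dots> = (\<Prod>i = 1..n. X i i)" by (simp add: prod.atLeast1_atMost_eq atLeast0LessThan)
  finally show ?thesis .
qed

text \<open>A permutation other than the identity and the transposition of the two pivot indices
  moves some further index. The row of that index is a unit row, so the Leibniz term is
  zero.\<close>

lemma cdet_plane_mat:
  assumes "p \<in> {1..n}" "q \<in> {1..n}" "p \<noteq> q"
  shows "cdet n (plane_mat a b c d p q) = a * d - b * c"
proof -
  let ?Z = "plane_mat a b c d p q"
  obtain P Q where P: "p = Suc P" "P < n" and Q: "q = Suc Q" "Q < n"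
    using assms by (metis atLeastAtMost_iff Suc_le_D One_nat_def Suc_le_lessD)
  have PQ: "P \<noteq> Q" using assms P Q by simp
  let ?t = "Transposition.transpose P Q"
  let ?f = "\<lambda>\<pi>. of_int (sign \<pi>) * (\<Prod>i = 0..<n. ?Z (Suc i) (Suc (\<pi> i)))"
  have "cdet n ?Z = (\<Sum>\<pi>\<in>{id, ?t}. ?f \<pi>)"
    unfolding cdet_leibniz
  proof (rule sum.mono_neutral_right)
    show "finite {\<pi>. \<pi> permutes {0..<n}}" by (simp add: finite_permutations)
    show "{id, ?t} \<subseteq> {\<pi>. \<pi> permutes {0..<n}}"
      using P Q by (auto intro: permutes_swap_id permutes_id)
    show "\<forall>\<pi>\<in>{\<pi>. \<pi> permutes {0..<n}} - {id, ?t}. ?f \<pi> = 0"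
    proof
      fix \<pi> assume \<pi>: "\<pi> \<in> {\<pi>. \<pi> permutes {0..<n}} - {id, ?t}"
      then have "\<not> \<pi> permutes {P, Q}" by (simp add: permutes_doubleton_iff)
      then obtain i where i: "i \<in> {0..<n} - {P, Q}" "\<pi> i \<noteq> i"
        using permutes_superset[of \<pi> "{0..<n}" "{P, Q}"] \<pi> by blast
      then have "?Z (Suc i) (Suc (\<pi> i)) = 0" by (auto simp: plane_mat_def P Q)
      then have "(\<Prod>i = 0..<n. ?Z (Suc i) (Suc (\<pi> i))) = 0" using i(1) by (intro prod_zero) auto
      then show "?f \<pi> = 0" by simp
    qed
  qed
  also have "\<dots> = ?f id + ?f ?t"
  proof -
    have "id \<noteq> ?t" using PQ by (metis id_apply transpose_apply_first)
    then show ?thesis by simp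
  qed
  also have "?f id = a * d"
  proof -
    have "(\<Prod>i = 0..<n. ?Z (Suc i) (Suc (id i))) = (\<Prod>i\<in>{P, Q}. ?Z (Suc i) (Suc (id i)))"
      by (rule prod.mono_neutral_right) (use P Q in \<open>auto simp: plane_mat_def\<close>)
    then show ?thesis using PQ by (simp add: plane_mat_def P Q)
  qed
  also have "?f ?t = - (b * c)"
  proof -
    have "(\<Prod>i = 0..<n. ?Z (Suc i) (Suc (?t i))) = (\<Prod>i\<in>{P, Q}. ?Z (Suc i) (Suc (?t i)))"
    proof (rule prod.mono_neutral_right)
      show "\<forall>i\<in>{0..<n} - {P, Q}. ?Z (Suc i) (Suc (?t i)) = 1"
        by (auto simp: plane_mat_def P Q transpose_apply_other)
    qed (use P Q in auto)
    then show ?thesis using PQ by (simp add: plane_mat_def P Q sign_swap_id)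
  qed
  finally show ?thesis by simp
qed

text \<open>Each of the n! Leibniz terms has modulus at most 1. This crude form of Hadamard's
  inequality suffices for a bounded monotone sequence of determinants.\<close>

lemma cdet_bounded:
  assumes "\<And>i j. i \<in> {1..n} \<Longrightarrow> j \<in> {1..n} \<Longrightarrow> cmod (X i j) \<le> 1"
  shows "cmod (cdet n X) \<le> fact n"
proof -
  have "cmod (cdet n X) \<le> (\<Sum>\<pi> | \<pi> permutes {0..<n}. 1)"
    unfolding cdet_leibniz
  proof (rule sum_norm_le)
    fix \<pi> assume "\<pi> \<in> {\<pi>. \<pi> permutes {0..<n}}"
    then have "\<pi> i < n" if "i < n" for i
      using permutes_in_image[of \<pi> "{0..<n}" i] that by simp
    then have "cmod (X (Suc i) (Suc (\<pi> i))) \<le> 1" if "i < n" for i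
      using that by (intro assms) (auto simp: Suc_le_eq)
    then have "cmod (\<Prod>i = 0..<n. X (Suc i) (Suc (\<pi> i))) \<le> 1"
      by (subst prod_norm[symmetric]) (intro prod_le_1, auto)
    then show "cmod (of_int (sign \<pi>) * (\<Prod>i = 0..<n. X (Suc i) (Suc (\<pi> i)))) \<le> 1"
      by (simp add: norm_mult sign_def)
  qed
  also have "\<dots> = fact n" using card_permutations[of "{0..<n}" n] by simp
  finally show ?thesis .
qed

lemma tendsto_cdet:
  assumes "\<And>i j. i \<in> {1..n} \<Longrightarrow> j \<in> {1..n} \<Longrightarrow> (\<lambda>k. X k i j) \<longlonglongrightarrow> Y i j"
  shows "(\<lambda>k. cdet n (X k)) \<longlonglongrightarrow> cdet n Y"
  unfolding cdet_leibniz
proof (intro tendsto_sum tendsto_mult tendsto_const tendsto_prod)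
  fix \<pi> i assume "\<pi> \<in> {\<pi>. \<pi> permutes {0..<n}}" "i \<in> {0..<n}"
  then have "i < n" "\<pi> i < n" using permutes_in_image[of \<pi> "{0..<n}" i] by auto
  then show "(\<lambda>k. X k (Suc i) (Suc (\<pi> i))) \<longlonglongrightarrow> Y (Suc i) (Suc (\<pi> i))"
    by (intro assms) auto
qed

lemma cdet_eq_0_iff:
  "cdet n X = 0 \<longleftrightarrow> (\<exists>x. (\<exists>i\<in>{1..n}. x i \<noteq> 0) \<and> (\<forall>i\<in>{1..n}. (\<Sum>j = 1..n. X i j * x j) = 0))"
proof -
  let ?M = "mat n n (\<lambda>(i, j). X (Suc i) (Suc j))"
  have Mv: "(?M *\<^sub>v v) $ i = (\<Sum>j = 1..n. X (Suc i) j * v $ (j - 1))" if "v \<in> carrier_vec n" "i < n" for v i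
    using that by (auto simp: scalar_prod_def sum.atLeast1_atMost_eq atLeast0LessThan)
  have iff: "cdet n X = 0 \<longleftrightarrow> (\<exists>v. v \<in> carrier_vec n \<and> v \<noteq> 0\<^sub>v n \<and> ?M *\<^sub>v v = 0\<^sub>v n)"
    unfolding cdet_def by (rule det_0_iff_vec_prod_zero_field) simp
  show ?thesis
  proof
    assume "cdet n X = 0"
    then obtain v where v: "v \<in> carrier_vec n" "v \<noteq> 0\<^sub>v n" "?M *\<^sub>v v = 0\<^sub>v n" using iff by blast
    have "v = 0\<^sub>v n" if "\<forall>l<n. v $ l = 0" using v(1) that by (intro eq_vecI) auto
    then obtain l where l: "l < n" "v $ l \<noteq> 0" using v(2) by blast
    then have "\<exists>i\<in>{1..n}. v $ (i - 1) \<noteq> 0" by (intro bexI[of _ "Suc l"]) auto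
    moreover have "(\<Sum>j = 1..n. X i j * v $ (j - 1)) = 0" if "i \<in> {1..n}" for i
    proof -
      have "i - 1 < n" "Suc (i - 1) = i" using that by auto
      then show ?thesis using Mv[OF v(1), of "i - 1"] v(3) by simp
    qed
    ultimately show "\<exists>x. (\<exists>i\<in>{1..n}. x i \<noteq> 0) \<and> (\<forall>i\<in>{1..n}. (\<Sum>j = 1..n. X i j * x j) = 0)"
      by (intro exI[of _ "\<lambda>i. v $ (i - 1)"]) blast
  next
    assume "\<exists>x. (\<exists>i\<in>{1..n}. x i \<noteq> 0) \<and> (\<forall>i\<in>{1..n}. (\<Sum>j = 1..n. X i j * x j) = 0)"
    then obtain x i where x: "i \<in> {1..n}" "x i \<noteq> 0"
      and 0: "\<And>i. i \<in> {1..n} \<Longrightarrow> (\<Sum>j = 1..n. X i j * x j) = 0" by blast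
    define v where "v = vec n (\<lambda>l. x (Suc l))"
    have v: "v \<in> carrier_vec n" by (simp add: v_def)
    have "v $ (i - 1) \<noteq> 0\<^sub>v n $ (i - 1)" using x by (auto simp: v_def)
    then have "v \<noteq> 0\<^sub>v n" by metis
    moreover have "?M *\<^sub>v v = 0\<^sub>v n"
    proof (rule eq_vecI)
      fix l assume "l < dim_vec (0\<^sub>v n)"
      then have l: "l < n" by simp
      have "(?M *\<^sub>v v) $ l = (\<Sum>j = 1..n. X (Suc l) j * x j)"
        unfolding Mv[OF v l] by (intro sum.cong) (auto simp: v_def)
      also have "\<dots> = 0" using l by (intro 0) auto
      finally show "(?M *\<^sub>v v) $ l = 0\<^sub>v n $ l" using l by simp
    qed simp
    ultimately show "cdet n X = 0" using iff v by blast
  qed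
qed

lemma pos_def_cdet_nonzero:
  assumes "pos_def_n n B"
  shows "cdet n B \<noteq> 0"
proof
  assume "cdet n B = 0"
  then obtain x where x: "\<exists>i\<in>{1..n}. x i \<noteq> 0" "\<And>i. i \<in> {1..n} \<Longrightarrow> (\<Sum>j = 1..n. B i j * x j) = 0"
    unfolding cdet_eq_0_iff by blast
  have "(\<Sum>i = 1..n. \<Sum>j = 1..n. cnj (x i) * B i j * x j) = (\<Sum>i = 1..n. cnj (x i) * (\<Sum>j = 1..n. B i j * x j))"
    by (simp add: sum_distrib_left mult.assoc)
  also have "\<dots> = 0" using x(2) by simp
  finally have "Re (\<Sum>i = 1..n. \<Sum>j = 1..n. cnj (x i) * B i j * x j) = 0" by simp
  moreover have "0 < Re (\<Sum>i = 1..n. \<Sum>j = 1..n. cnj (x i) * B i j * x j)"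
    using assms x(1) unfolding pos_def_n_def by blast
  ultimately show False by simp
qed

section \<open>Congruence and positive definiteness\<close>

definition congruence :: "nat \<Rightarrow> cmat \<Rightarrow> cmat \<Rightarrow> cmat" where
  "congruence n F X = mmult n (mmult n (cadj F) X) F"

abbreviation eq_on :: "nat \<Rightarrow> cmat \<Rightarrow> cmat \<Rightarrow> bool" where
  "eq_on n X Y \<equiv> \<forall>r\<in>{1..n}. \<forall>s\<in>{1..n}. X r s = Y r s"

lemma congruence_entry: "congruence n F X r s = (\<Sum>l = 1..n. \<Sum>m = 1..n. cnj (F l r) * X l m * F m s)"
proof -
  have "congruence n F X r s = (\<Sum>m = 1..n. \<Sum>l = 1..n. cnj (F l r) * X l m * F m s)"
    unfolding congruence_def mmult_def cadj_def by (simp add: sum_distrib_right)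
  also have "\<dots> = (\<Sum>l = 1..n. \<Sum>m = 1..n. cnj (F l r) * X l m * F m s)" by (rule sum.swap)
  finally show ?thesis .
qed

text \<open>A congruence reads its matrix on 1..n only, so agreement there gives equality of
  functions, which can be used for rewriting.\<close>

lemma congruence_eq_on: "eq_on n X Y \<Longrightarrow> congruence n F X = congruence n F Y"
  unfolding fun_eq_iff congruence_entry by (intro allI sum.cong) auto

lemma congruence_comp: "congruence n G (congruence n F X) = congruence n (mmult n F G) X"
  unfolding congruence_def cadj_mmult by (simp only: mmult_assoc)

lemma congruence_diff: "congruence n F (\<lambda>i j. X i j - z * Y i j) r s = congruence n F X r s - z * congruence n F Y r s"
  unfolding congruence_entry by (simp add: algebra_simps sum_subtractf sum_distrib_left)

lemma cadj_congruence: "cadj (congruence n F X) = congruence n F (cadj X)"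
  unfolding congruence_def cadj_mmult cadj_cadj by (simp only: mmult_assoc)

lemma hermitian_n_cadj: "hermitian_n n X \<longleftrightarrow> eq_on n (cadj X) X"
proof
  assume "hermitian_n n X"
  then show "eq_on n (cadj X) X"
    unfolding hermitian_n_def cadj_def by (metis complex_cnj_cnj)
next
  assume "eq_on n (cadj X) X"
  then show "hermitian_n n X" unfolding hermitian_n_def cadj_def by metis
qed

lemma hermitian_eq_on: "hermitian_n n X \<Longrightarrow> eq_on n X Y \<Longrightarrow> hermitian_n n Y"
  unfolding hermitian_n_def by metis

lemma hermitian_congruence: "hermitian_n n X \<Longrightarrow> hermitian_n n (congruence n F X)"
  unfolding hermitian_n_cadj cadj_congruence using congruence_eq_on[of n "cadj X" X F] by simp

lemma cdet_congruence: "cdet n (congruence n F X) = cdet n (cadj F) * cdet n X * cdet n F"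
  unfolding congruence_def cdet_mmult ..

text \<open>The quadratic form at \<open>x\<close> is an entry of the congruence with the matrix all
  of whose columns are \<open>x\<close>; the position 0 0 is arbitrary. Preservation of definiteness
  thus becomes an instance of \<open>congruence_comp\<close>.\<close>

lemma pos_def_n_iff:
  "pos_def_n n B \<longleftrightarrow> hermitian_n n B \<and>
    (\<forall>x. (\<exists>i\<in>{1..n}. x i \<noteq> 0) \<longrightarrow> 0 < Re (congruence n (\<lambda>i j. x i) B 0 0))"
  unfolding pos_def_n_def congruence_entry ..

lemma pos_def_congruence:
  assumes "pos_def_n n B" "cdet n F \<noteq> 0"
  shows "pos_def_n n (congruence n F B)"
  unfolding pos_def_n_iff
proof (intro conjI allI impI)
  show "hermitian_n n (congruence n F B)" using assms(1) hermitian_congruence unfolding pos_def_n_def by blast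
  fix x :: "nat \<Rightarrow> complex" assume x: "\<exists>i\<in>{1..n}. x i \<noteq> 0"
  define y where "y = (\<lambda>i. \<Sum>j = 1..n. F i j * x j)"
  have "\<exists>i\<in>{1..n}. y i \<noteq> 0" using assms(2) x unfolding cdet_eq_0_iff y_def by blast
  then have "0 < Re (congruence n (\<lambda>i j. y i) B 0 0)" using assms(1) unfolding pos_def_n_iff by blast
  then show "0 < Re (congruence n (\<lambda>i j. x i) (congruence n F B) 0 0)"
    unfolding congruence_comp y_def mmult_def .
qed

lemma pos_def_eq_on:
  assumes "pos_def_n n X" "eq_on n X Y"
  shows "pos_def_n n Y"
proof -
  have "hermitian_n n Y" using assms hermitian_eq_on unfolding pos_def_n_def by blast
  then show ?thesis using assms congruence_eq_on[OF assms(2)] unfolding pos_def_n_iff by simp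
qed

lemma pos_def_diag:
  assumes "pos_def_n n B" "r \<in> {1..n}"
  shows "0 < Re (B r r)" "Im (B r r) = 0"
proof -
  define x where "x = (\<lambda>i. if i = r then 1 else 0 :: complex)"
  have "\<exists>i\<in>{1..n}. x i \<noteq> 0" using assms(2) by (auto simp: x_def)
  then have "0 < Re (\<Sum>i = 1..n. \<Sum>j = 1..n. cnj (x i) * B i j * x j)"
    using assms(1) unfolding pos_def_n_def by blast
  also have "(\<Sum>i = 1..n. \<Sum>j = 1..n. cnj (x i) * B i j * x j) = (\<Sum>i = 1..n. if i = r then B i r else 0)"
    using assms(2) by (intro sum.cong refl) (simp add: x_def if_distrib[of "\<lambda>z. _ * z"] cong: if_cong)
  also have "\<dots> = B r r" using assms(2) by simp
  finally show "0 < Re (B r r)" .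
  have "B r r = cnj (B r r)" using assms unfolding pos_def_n_def hermitian_n_def by blast
  then show "Im (B r r) = 0" by (simp add: complex_eq_iff)
qed

lemma pos_def_offdiag:
  assumes B: "pos_def_n n B" and r: "r \<in> {1..n}" "s \<in> {1..n}" "r \<noteq> s" and d: "B r r = 1" "B s s = 1"
  shows "cmod (B r s) < 1"
proof -
  let ?b = "B r s"
  \<comment> \<open>Among the vectors supported on \<open>r\<close> and \<open>s\<close> with entry
    1 at \<open>s\<close>, this one minimizes the form; the minimum is 1 - |b|^2.\<close>
  define x where "x = (\<lambda>i. if i = r then - ?b else if i = s then 1 else 0)"
  have split: "(\<Sum>i = 1..n. f i) = f r + f s" if "\<And>i. i \<notin> {r, s} \<Longrightarrow> f i = 0" for f :: "nat \<Rightarrow> complex"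
  proof -
    have "(\<Sum>i = 1..n. f i) = (\<Sum>i\<in>{r, s}. f i)" by (rule sum.mono_neutral_right) (use r that in auto)
    then show ?thesis using r(3) by simp
  qed
  have x: "x r = - ?b" "x s = 1" "\<And>i. i \<notin> {r, s} \<Longrightarrow> x i = 0" using r by (auto simp: x_def)
  have "\<exists>i\<in>{1..n}. x i \<noteq> 0" using x r by (intro bexI[of _ s]) auto
  then have "0 < Re (\<Sum>i = 1..n. \<Sum>j = 1..n. cnj (x i) * B i j * x j)"
    using B unfolding pos_def_n_def by blast
  also have "(\<Sum>i = 1..n. \<Sum>j = 1..n. cnj (x i) * B i j * x j) =
      (\<Sum>i = 1..n. cnj (x i) * B i r * x r + cnj (x i) * B i s * x s)"
    using x(3) by (intro sum.cong refl split) auto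
  also have "\<dots> = (cnj (x r) * B r r * x r + cnj (x r) * B r s * x s) +
      (cnj (x s) * B s r * x r + cnj (x s) * B s s * x s)"
    using x(3) by (intro split) auto
  also have "\<dots> = 1 - ?b * cnj ?b"
  proof -
    have "B s r = cnj ?b" using B r unfolding pos_def_n_def hermitian_n_def by blast
    then show ?thesis by (simp add: x d algebra_simps)
  qed
  also have "\<dots> = complex_of_real (1 - (cmod ?b)\<^sup>2)" by (simp only: of_real_diff of_real_1 complex_norm_square)
  finally have "(cmod ?b)\<^sup>2 < 1" by simp
  then show ?thesis by (simp add: abs_square_less_1)
qed

text \<open>Compactness of the unit sphere: otherwise unit vectors with form values below 1 / (m +
  1) would accumulate at a unit vector where the form is not positive. The bound stands in for the
  smallest eigenvalue.\<close>

lemma pos_def_lower_bound: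
  assumes B: "pos_def_n n B"
  obtains \<mu> where "0 < \<mu>"
    "\<And>x. \<mu> * (\<Sum>i = 1..n. (cmod (x i))\<^sup>2) \<le> Re (\<Sum>i = 1..n. \<Sum>j = 1..n. cnj (x i) * B i j * x j)"
proof -
  let ?q = "\<lambda>x. Re (\<Sum>i = 1..n. \<Sum>j = 1..n. cnj (x i) * B i j * x j)"
  let ?s = "\<lambda>x :: nat \<Rightarrow> complex. \<Sum>i = 1..n. (cmod (x i))\<^sup>2"
  have "\<exists>\<mu>>0. \<forall>x. \<mu> * ?s x \<le> ?q x"
  proof (rule ccontr)
    assume contra: "\<not> ?thesis"
    have "\<exists>y. ?s y = 1 \<and> ?q y < 1 / real (Suc m)" for m
    proof -
      have "0 < 1 / real (Suc m)" by simp
      then obtain x where x: "?q x < 1 / real (Suc m) * ?s x" using contra by (meson not_le)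
      have "?s x \<noteq> 0"
      proof
        assume s: "?s x = 0"
        then have "\<forall>i\<in>{1..n}. x i = 0" by (subst (asm) sum_nonneg_eq_0_iff) auto
        then have "?q x = 0" by simp
        then show False using x s by simp
      qed
      moreover have "0 \<le> ?s x" by (intro sum_nonneg) auto
      ultimately have s: "0 < ?s x" by linarith
      define y where "y = (\<lambda>i. complex_of_real (1 / sqrt (?s x)) * x i)"
      have "?s y = (\<Sum>i = 1..n. (cmod (x i))\<^sup>2 / ?s x)"
        using s by (intro sum.cong refl) (simp add: y_def norm_mult norm_divide power_divide)
      also have "\<dots> = 1" using s by (simp flip: sum_divide_distrib)
      finally have "?s y = 1" .
      moreover have "?q y = ?q x / ?s x"
      proof -
        have sq: "complex_of_real (sqrt (?s x)) * complex_of_real (sqrt (?s x)) = complex_of_real (?s x)"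
          using s by (simp flip: of_real_mult)
        have "(\<Sum>i = 1..n. \<Sum>j = 1..n. cnj (y i) * B i j * y j) =
          (\<Sum>i = 1..n. \<Sum>j = 1..n. cnj (x i) * B i j * x j / complex_of_real (?s x))"
          unfolding y_def by (intro sum.cong refl) (simp only: sq[symmetric], simp)
        also have "\<dots> = (\<Sum>i = 1..n. \<Sum>j = 1..n. cnj (x i) * B i j * x j) / complex_of_real (?s x)"
          by (simp add: sum_divide_distrib)
        finally show ?thesis by (simp only: Re_divide_of_real)
      qed
      moreover have "?q x / ?s x < 1 / real (Suc m)" using x s by (simp only: pos_divide_less_eq)
      ultimately have "?s y = 1 \<and> ?q y < 1 / real (Suc m)" by (intro conjI) (simp_all only:)
      then show ?thesis by (rule exI[of _ y])
    qed
    then have "\<exists>y. \<forall>m. ?s (y m) = 1 \<and> ?q (y m) < 1 / real (Suc m)" by (intro choice allI)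
    then obtain y where y: "\<And>m. ?s (y m) = 1" "\<And>m. ?q (y m) < 1 / real (Suc m)" by blast
    have y1: "cmod (y m i) \<le> 1" if "i \<in> {1..n}" for m i
    proof -
      have "(cmod (y m i))\<^sup>2 \<le> ?s (y m)" using that by (intro member_le_sum) auto
      then have "(cmod (y m i))\<^sup>2 \<le> 1\<^sup>2" unfolding y(1) by simp
      then show ?thesis by (rule power2_le_imp_le) simp
    qed
    obtain r g where r: "strict_mono r" and g: "\<And>i. i \<in> {1..n} \<Longrightarrow> (\<lambda>m. y (r m) i) \<longlonglongrightarrow> g i"
      using subsequence_finite_family[of "{1..n}" y "\<lambda>_. 1"] y1 by blast
    have "(\<lambda>m. ?s (y (r m))) \<longlonglongrightarrow> ?s g" by (intro tendsto_intros g)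
    then have "?s g = 1" unfolding y(1) by (simp only: LIMSEQ_const_iff)
    then have "\<exists>i\<in>{1..n}. g i \<noteq> 0" by (rule contrapos_pp) simp
    then have pos: "0 < ?q g" using B unfolding pos_def_n_def by blast
    have "(\<lambda>m. ?q (y (r m))) \<longlonglongrightarrow> ?q g" by (intro tendsto_intros g)
    moreover have "(\<lambda>m. 1 / real (Suc (r m))) \<longlonglongrightarrow> 0"
      using LIMSEQ_subseq_LIMSEQ[OF LIMSEQ_inverse_real_of_nat r] by (simp add: comp_def inverse_eq_divide)
    ultimately have "?q g \<le> 0"
      by (rule LIMSEQ_le) (intro exI[of _ 0] allI impI less_imp_le y(2))
    then show False using pos by simp
  qed
  then show ?thesis using that by blast
qed

text \<open>The columns of \<open>F\<close> are unit vectors for the inner product of \<open>B\<close>, hence bounded.\<close>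

lemma congruence_bounded:
  assumes "pos_def_n n B"
  obtains K where "\<And>F r s. r \<in> {1..n} \<Longrightarrow> s \<in> {1..n} \<Longrightarrow> congruence n F B r r = 1 \<Longrightarrow> congruence n F B s s = 1 \<Longrightarrow>
    cmod (congruence n F A r s) \<le> K"
proof -
  obtain \<mu> where \<mu>: "0 < \<mu>"
    "\<And>x. \<mu> * (\<Sum>i = 1..n. (cmod (x i))\<^sup>2) \<le> Re (\<Sum>i = 1..n. \<Sum>j = 1..n. cnj (x i) * B i j * x j)"
    using pos_def_lower_bound[OF assms] by blast
  \<comment> \<open>A column of B-norm 1 has Euclidean norm at most this number.\<close>
  define c where "c = sqrt (1 / \<mu>)"
  have c: "0 \<le> c" using \<mu>(1) by (simp add: c_def)
  have col: "cmod (F l r) \<le> c" if "congruence n F B r r = 1" "l \<in> {1..n}" for F l r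
  proof -
    have "\<mu> * (cmod (F l r))\<^sup>2 \<le> \<mu> * (\<Sum>i = 1..n. (cmod (F i r))\<^sup>2)"
      using \<mu>(1) that(2) by (intro mult_left_mono member_le_sum[where f = "\<lambda>i. (cmod (F i r))\<^sup>2"]) auto
    also have "\<dots> \<le> Re (congruence n F B r r)" using \<mu>(2)[of "\<lambda>i. F i r"] unfolding congruence_entry .
    also have "\<dots> = 1" using that(1) by simp
    finally have "(cmod (F l r))\<^sup>2 \<le> 1 / \<mu>" using \<mu>(1) by (simp add: field_simps)
    then show ?thesis unfolding c_def by (rule real_le_rsqrt)
  qed
  show ?thesis
  proof (rule that)
    fix F r s assume rs: "congruence n F B r r = 1" "congruence n F B s s = 1"
    show "cmod (congruence n F A r s) \<le> (\<Sum>l = 1..n. \<Sum>m = 1..n. c * cmod (A l m) * c)"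
      unfolding congruence_entry
    proof (intro sum_norm_le)
      fix l m assume "l \<in> {1..n}" "m \<in> {1..n}"
      then have "cmod (F l r) \<le> c" "cmod (F m s) \<le> c" using col rs by blast+
      then show "cmod (cnj (F l r) * A l m * F m s) \<le> c * cmod (A l m) * c"
        unfolding norm_mult complex_mod_cnj using c by (intro mult_mono) auto
    qed
  qed
qed

text \<open>The initial scaling is itself a nonsingular congruence, so it can serve as the first
  factor of the accumulated transformation.\<close>

lemma cj_scale_congruence:
  assumes "pos_def_n n B"
  defines "D \<equiv> \<lambda>i j. if i = j then complex_of_real (1 / sqrt (Re (B i i))) else 0"
  shows "eq_on n (cj_scale B X) (congruence n D X)" "cdet n D \<noteq> 0"
proof -
  show "eq_on n (cj_scale B X) (congruence n D X)"
  proof (intro ballI)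
    fix r s assume rs: "r \<in> {1..n}" "s \<in> {1..n}"
    have "congruence n D X r s = (\<Sum>l = 1..n. if l = r then cnj (D r r) * X r s * D s s else 0)"
      unfolding congruence_entry
    proof (intro sum.cong refl)
      fix l assume "l \<in> {1..n}"
      have "(\<Sum>m = 1..n. cnj (D l r) * X l m * D m s) = (\<Sum>m = 1..n. if m = s then cnj (D l r) * X l s * D s s else 0)"
        by (intro sum.cong refl) (auto simp: D_def)
      also have "\<dots> = cnj (D l r) * X l s * D s s" using rs by simp
      finally show "(\<Sum>m = 1..n. cnj (D l r) * X l m * D m s) = (if l = r then cnj (D r r) * X r s * D s s else 0)"
        by (auto simp: D_def)
    qed
    also have "\<dots> = cj_scale B X r s" using rs by (simp add: D_def cj_scale_def)
    finally show "cj_scale B X r s = congruence n D X r s" ..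
  qed
  have "cdet n D = (\<Prod>i = 1..n. D i i)" by (rule cdet_diagonal) (simp add: D_def)
  also have "\<dots> \<noteq> 0" using pos_def_diag(1)[OF assms(1)] by (fastforce simp: D_def)
  finally show "cdet n D \<noteq> 0" .
qed

section \<open>Limits of diagonals\<close>

text \<open>Let \<delta> separate the points of \<open>F\<close>. A sequence that stays within
  \<delta>/4 of \<open>F\<close> and moves by less than \<delta>/4 per step cannot pass from one
  point to another.\<close>

lemma tendsto_if_near_finite_set:
  fixes x :: "nat \<Rightarrow> complex"
  assumes F: "finite F"
    and near: "\<And>\<epsilon>. 0 < \<epsilon> \<Longrightarrow> \<forall>\<^sub>F k in sequentially. \<exists>f\<in>F. dist (x k) f < \<epsilon>"
    and inc: "(\<lambda>k. x (Suc k) - x k) \<longlonglongrightarrow> 0"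
  shows "\<exists>f. x \<longlonglongrightarrow> f"
proof -
  have "\<exists>\<delta>>0. \<forall>f\<in>F. \<forall>g\<in>F. f \<noteq> g \<longrightarrow> \<delta> \<le> dist f g"
  proof -
    \<comment> \<open>The element 1 keeps the minimum defined when \<open>F\<close> has fewer than
      two points.\<close>
    let ?S = "insert 1 ((\<lambda>(f, g). dist f g) ` {(f, g). f \<in> F \<and> g \<in> F \<and> f \<noteq> g})"
    have "finite {(f, g). f \<in> F \<and> g \<in> F \<and> f \<noteq> g}"
      by (rule finite_subset[of _ "F \<times> F"]) (use F in auto)
    then have S: "finite ?S" by simp
    have "0 < Min ?S" using S by (subst Min_gr_iff) auto
    moreover have "\<forall>f\<in>F. \<forall>g\<in>F. f \<noteq> g \<longrightarrow> Min ?S \<le> dist f g"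
      using S by (auto intro!: Min_le)
    ultimately show ?thesis by blast
  qed
  then obtain \<delta> where \<delta>: "0 < \<delta>" "\<And>f g. f \<in> F \<Longrightarrow> g \<in> F \<Longrightarrow> dist f g < \<delta> \<Longrightarrow> f = g"
    by (meson not_le)
  have "\<forall>\<^sub>F k in sequentially. dist (x (Suc k) - x k) 0 < \<delta> / 4"
    using tendstoD[OF inc, of "\<delta> / 4"] \<delta>(1) by simp
  moreover have "\<forall>\<^sub>F k in sequentially. \<exists>f\<in>F. dist (x k) f < \<delta> / 4" using near[of "\<delta> / 4"] \<delta>(1) by simp
  ultimately have "\<forall>\<^sub>F k in sequentially. dist (x (Suc k) - x k) 0 < \<delta> / 4 \<and> (\<exists>f\<in>F. dist (x k) f < \<delta> / 4)"
    by (rule eventually_conj)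
  then obtain K where K: "\<And>k. k \<ge> K \<Longrightarrow> dist (x (Suc k)) (x k) < \<delta> / 4"
    "\<And>k. k \<ge> K \<Longrightarrow> \<exists>f\<in>F. dist (x k) f < \<delta> / 4"
    unfolding eventually_sequentially by (auto simp: dist_norm)
  obtain f where f: "f \<in> F" "dist (x K) f < \<delta> / 4" using K(2)[of K] by auto
  have same: "g = f" if "g \<in> F" "dist (x k) g < \<delta> / 4" "dist (x k) f < \<delta> / 2" for g k
  proof -
    have "dist g f \<le> dist (x k) g + dist (x k) f" using dist_triangle2[of g f "x k"] by (simp add: dist_commute)
    then show ?thesis using \<delta>(2)[OF that(1) f(1)] that \<delta>(1) by linarith
  qed
  have close: "dist (x k) f < \<delta> / 4" if "k \<ge> K" for k
    using that
  proof (induction k rule: dec_induct)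
    case base
    show ?case by (rule f(2))
  next
    case (step k)
    have "dist (x (Suc k)) f \<le> dist (x (Suc k)) (x k) + dist (x k) f" by (rule dist_triangle)
    then have h: "dist (x (Suc k)) f < \<delta> / 2" using K(1)[of k] step by linarith
    obtain g where "g \<in> F" "dist (x (Suc k)) g < \<delta> / 4" using K(2)[of "Suc k"] step by auto
    then show ?case using same h by metis
  qed
  have "x \<longlonglongrightarrow> f"
  proof (rule tendstoI)
    fix e :: real assume "0 < e"
    then have "0 < min e (\<delta> / 4)" using \<delta>(1) by simp
    from near[OF this] eventually_ge_at_top[of K] show "\<forall>\<^sub>F k in sequentially. dist (x k) f < e"
    proof eventually_elim
      case (elim k)
      then obtain g where g: "g \<in> F" "dist (x k) g < e" "dist (x k) g < \<delta> / 4" by auto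
      then have "g = f" using same[OF g(1,3)] close[OF elim(2)] \<delta>(1) by linarith
      then show ?case using g by simp
    qed
  qed
  then show ?thesis by blast
qed

section \<open>Diagonal increments of nearly unitary steps\<close>

lemma null_mult_bounded:
  fixes f g :: "nat \<Rightarrow> complex"
  assumes "f \<longlonglongrightarrow> 0" "\<forall>\<^sub>F k in sequentially. cmod (g k) \<le> K"
  shows "(\<lambda>k. f k * g k) \<longlonglongrightarrow> 0"
proof (rule tendsto_0_le[OF assms(1)])
  show "\<forall>\<^sub>F k in sequentially. norm (f k * g k) \<le> norm (f k) * K"
    using assms(2) by eventually_elim (simp add: norm_mult mult_left_mono)
qed

lemma null_cancel_bounded_below:
  fixes f g :: "nat \<Rightarrow> complex"
  assumes "(\<lambda>k. f k * g k) \<longlonglongrightarrow> 0" "\<forall>\<^sub>F k in sequentially. 1 / 2 \<le> cmod (g k)"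
  shows "f \<longlonglongrightarrow> 0"
proof (rule tendsto_0_le[OF assms(1)])
  show "\<forall>\<^sub>F k in sequentially. norm (f k) \<le> norm (f k * g k) * 2"
    using assms(2)
  proof eventually_elim
    case (elim k)
    then have "cmod (f k) * (1 / 2) \<le> cmod (f k) * cmod (g k)" by (intro mult_left_mono) auto
    then show ?case by (simp add: norm_mult)
  qed
qed

text \<open>Up to null terms the increment is |c|^2 (y - x). Annihilation of the pivot together with
  near orthogonality of the columns makes \<open>cnj c * (y - x) * d\<close> a null sequence, and
  \<open>d\<close> can be cancelled as it stays away from zero. So either \<open>c\<close> is small
  or the two diagonal entries are close; no gap between eigenvalues is presupposed.\<close>

lemma pivot_diagonal_increment:
  fixes a b c d x y w w' :: "nat \<Rightarrow> complex"
  assumes u1: "(\<lambda>k. cnj (a k) * a k + cnj (c k) * c k - 1) \<longlonglongrightarrow> 0"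
    and u3: "(\<lambda>k. cnj (a k) * b k + cnj (c k) * d k) \<longlonglongrightarrow> 0"
    and low: "\<forall>\<^sub>F k in sequentially. 1 / 2 \<le> cmod (d k)"
    and bdd: "\<forall>\<^sub>F k in sequentially. cmod (a k) \<le> U \<and> cmod (b k) \<le> U \<and> cmod (c k) \<le> U \<and> cmod (d k) \<le> U"
    and x: "\<And>k. cmod (x k) \<le> K" and w: "w \<longlonglongrightarrow> 0" "w' \<longlonglongrightarrow> 0"
    and zero: "\<And>k. sesq (x k) (w k) (w' k) (y k) (a k) (c k) (b k) (d k) = 0"
  shows "(\<lambda>k. sesq (x k) (w k) (w' k) (y k) (a k) (c k) (a k) (c k) - x k) \<longlonglongrightarrow> 0"
proof -
  have prod: "\<forall>\<^sub>F k in sequentially. cmod (f k * g k) \<le> U * U"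
    if "\<forall>\<^sub>F k in sequentially. cmod (f k) \<le> U" "\<forall>\<^sub>F k in sequentially. cmod (g k) \<le> U" for f g :: "nat \<Rightarrow> complex"
    using that
  proof eventually_elim
    case (elim k)
    then have "0 \<le> U" using norm_ge_zero order_trans by blast
    then show ?case using elim unfolding norm_mult by (intro mult_mono) auto
  qed
  have bd: "\<forall>\<^sub>F k in sequentially. cmod (cnj (a k)) \<le> U" "\<forall>\<^sub>F k in sequentially. cmod (b k) \<le> U"
     "\<forall>\<^sub>F k in sequentially. cmod (cnj (c k)) \<le> U" "\<forall>\<^sub>F k in sequentially. cmod (d k) \<le> U"
     "\<forall>\<^sub>F k in sequentially. cmod (a k) \<le> U" "\<forall>\<^sub>F k in sequentially. cmod (c k) \<le> U"
    using bdd by (auto elim: eventually_mono)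
  have xb: "\<forall>\<^sub>F k in sequentially. cmod (x k) \<le> K" using x by simp
  have "(\<lambda>k. - ((cnj (a k) * b k + cnj (c k) * d k) * x k + w k * (cnj (a k) * d k) + w' k * (cnj (c k) * b k))) \<longlonglongrightarrow> - (0 + 0 + 0)"
    by (intro tendsto_minus tendsto_add null_mult_bounded[OF u3 xb] null_mult_bounded[OF w(1) prod]
        null_mult_bounded[OF w(2) prod] bd)
  moreover have "- ((cnj (a k) * b k + cnj (c k) * d k) * x k + w k * (cnj (a k) * d k) + w' k * (cnj (c k) * b k))
      = cnj (c k) * (y k - x k) * d k" for k
    using zero[of k] unfolding sesq_def by (simp add: algebra_simps add_eq_0_iff)
  ultimately have "(\<lambda>k. cnj (c k) * (y k - x k) * d k) \<longlonglongrightarrow> 0" by simp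
  from null_cancel_bounded_below[OF this low]
  have "(\<lambda>k. cnj (c k) * (y k - x k)) \<longlonglongrightarrow> 0" .
  from null_mult_bounded[OF this bd(6)]
  have c2: "(\<lambda>k. cnj (c k) * (y k - x k) * c k) \<longlonglongrightarrow> 0" .
  have "(\<lambda>k. (cnj (a k) * a k + cnj (c k) * c k - 1) * x k + cnj (c k) * (y k - x k) * c k
      + w k * (cnj (a k) * c k) + w' k * (cnj (c k) * a k)) \<longlonglongrightarrow> 0 + 0 + 0 + 0"
    by (intro tendsto_add null_mult_bounded[OF u1 xb] c2 null_mult_bounded[OF w(1) prod]
        null_mult_bounded[OF w(2) prod] bd)
  moreover have "(cnj (a k) * a k + cnj (c k) * c k - 1) * x k + cnj (c k) * (y k - x k) * c k
      + w k * (cnj (a k) * c k) + w' k * (cnj (c k) * a k)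
      = sesq (x k) (w k) (w' k) (y k) (a k) (c k) (a k) (c k) - x k" for k
    unfolding sesq_def by (simp add: algebra_simps)
  ultimately show ?thesis by simp
qed

lemma sesq_swap: "sesq g11 g12 g21 g22 v1 v2 w1 w2 = sesq g22 g21 g12 g11 v2 v1 w2 w1"
  unfolding sesq_def by (simp add: algebra_simps)

text \<open>For the squared Euclidean norm s of (a, c), the cross terms amount to at most |b| s.
  With |b| \<le> 1/2 this first bounds s by 2, and inserting that bound gives the estimate linear in
  |b|.\<close>

lemma sesq_near_identity:
  fixes a b c :: complex
  assumes "sesq 1 b (cnj b) 1 a c a c = 1" "cmod b \<le> 1 / 2"
  shows "(cmod a)\<^sup>2 + (cmod c)\<^sup>2 \<le> 2" "\<bar>(cmod a)\<^sup>2 + (cmod c)\<^sup>2 - 1\<bar> \<le> 2 * cmod b"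
proof -
  define s where "s = (cmod a)\<^sup>2 + (cmod c)\<^sup>2"
  have s0: "0 \<le> s" by (simp add: s_def)
  have "complex_of_real s = a * cnj a + c * cnj c" unfolding s_def by (simp only: of_real_add complex_norm_square)
  then have "complex_of_real (s - 1) = - (cnj a * b * c + cnj c * cnj b * a)"
    using assms(1) unfolding sesq_def by (simp add: algebra_simps add_eq_0_iff)
  then have "\<bar>s - 1\<bar> = cmod (cnj a * b * c + cnj c * cnj b * a)"
    by (metis norm_minus_cancel norm_of_real real_norm_def)
  also have "\<dots> \<le> cmod (cnj a * b * c) + cmod (cnj c * cnj b * a)" by (rule norm_triangle_ineq)
  also have "\<dots> = cmod b * (2 * cmod a * cmod c)" by (simp add: norm_mult)
  also have "\<dots> \<le> cmod b * s"
    unfolding s_def using sum_squares_bound[of "cmod a" "cmod c"] by (intro mult_left_mono) auto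
  finally have 1: "\<bar>s - 1\<bar> \<le> cmod b * s" .
  also have "\<dots> \<le> 1 / 2 * s" using assms(2) s0 by (rule mult_right_mono)
  finally have s2: "s \<le> 2" by linarith
  then show "(cmod a)\<^sup>2 + (cmod c)\<^sup>2 \<le> 2" unfolding s_def .
  have "cmod b * s \<le> cmod b * 2" using s2 by (intro mult_left_mono) auto
  then show "\<bar>(cmod a)\<^sup>2 + (cmod c)\<^sup>2 - 1\<bar> \<le> 2 * cmod b" using 1 unfolding s_def by linarith
qed

lemma sesq_near_identity_cross:
  fixes a b c d e :: complex
  assumes "sesq 1 b (cnj b) 1 a c e d = 0" "(cmod a)\<^sup>2 + (cmod c)\<^sup>2 \<le> 2" "(cmod e)\<^sup>2 + (cmod d)\<^sup>2 \<le> 2"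
  shows "cmod (cnj a * e + cnj c * d) \<le> 2 * cmod b"
proof -
  have "sesq 1 b (cnj b) 1 a c e d = (cnj a * e + cnj c * d) + (cnj a * b * d + cnj c * cnj b * e)"
    unfolding sesq_def by (simp add: algebra_simps)
  then have "cnj a * e + cnj c * d = - (cnj a * b * d + cnj c * cnj b * e)"
    using assms(1) by (simp only: eq_neg_iff_add_eq_0)
  then have "cmod (cnj a * e + cnj c * d) = cmod (cnj a * b * d + cnj c * cnj b * e)"
    by (metis norm_minus_cancel)
  also have "\<dots> \<le> cmod (cnj a * b * d) + cmod (cnj c * cnj b * e)" by (rule norm_triangle_ineq)
  also have "\<dots> = cmod b * (cmod a * cmod d + cmod c * cmod e)" by (simp add: norm_mult algebra_simps)
  also have "\<dots> \<le> cmod b * 2"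
  proof (intro mult_left_mono)
    show "cmod a * cmod d + cmod c * cmod e \<le> 2"
      using sum_squares_bound[of "cmod a" "cmod d"] sum_squares_bound[of "cmod c" "cmod e"] assms(2,3)
      by linarith
  qed simp
  finally show ?thesis by simp
qed

text \<open>For each fixed \<open>z\<close> the determinant identity passes to the limit by
  continuity, and on the diagonal limits the determinants are products.\<close>

lemma pencil_limit:
  assumes id: "\<And>k z. cdet n (\<lambda>i j. A' k i j - z * B' k i j) * cdet n B =
      cdet n (B' k) * cdet n (\<lambda>i j. A i j - z * B i j)"
    and limA: "\<And>i j. i \<in> {1..n} \<Longrightarrow> j \<in> {1..n} \<Longrightarrow> (\<lambda>k. A' k i j) \<longlonglongrightarrow> L i j"
    and limB: "\<And>i j. i \<in> {1..n} \<Longrightarrow> j \<in> {1..n} \<Longrightarrow> (\<lambda>k. B' k i j) \<longlonglongrightarrow> idm i j"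
    and L: "is_diagonal_n n L"
  shows "diag_of_eigenvalues n A B L"
  unfolding diag_of_eigenvalues_def
proof (intro conjI allI L)
  fix z
  have "(\<lambda>k. cdet n (\<lambda>i j. A' k i j - z * B' k i j) * cdet n B) \<longlonglongrightarrow> cdet n (\<lambda>i j. L i j - z * idm i j) * cdet n B"
    by (intro tendsto_intros tendsto_cdet limA limB)
  moreover have "(\<lambda>k. cdet n (B' k) * cdet n (\<lambda>i j. A i j - z * B i j)) \<longlonglongrightarrow>
      cdet n idm * cdet n (\<lambda>i j. A i j - z * B i j)"
    by (intro tendsto_intros tendsto_cdet limB)
  ultimately have "cdet n (\<lambda>i j. L i j - z * idm i j) * cdet n B = cdet n idm * cdet n (\<lambda>i j. A i j - z * B i j)"
    unfolding id by (rule LIMSEQ_unique)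
  moreover have "cdet n idm = 1" by (subst cdet_diagonal) (auto simp: idm_def)
  moreover have "cdet n (\<lambda>i j. L i j - z * idm i j) = (\<Prod>i = 1..n. L i i - z)"
    using L by (subst cdet_diagonal) (auto simp: idm_def is_diagonal_n_def)
  ultimately show "cdet n (\<lambda>i j. A i j - z * B i j) = cdet n B * (\<Prod>i = 1..n. L i i - z)"
    by (simp add: mult.commute)
qed

lemma pcong_pivot_sesq:
  assumes "p \<noteq> q"
  shows "pcong a b c d p q X p p = sesq (X p p) (X p q) (X q p) (X q q) a c a c"
    and "pcong a b c d p q X p q = sesq (X p p) (X p q) (X q p) (X q q) a c b d"
    and "pcong a b c d p q X q q = sesq (X p p) (X p q) (X q p) (X q q) b d b d"
  using assms unfolding pcong_def Let_def sesq_def by (simp_all add: algebra_simps)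

section \<open>The Cholesky-Jacobi iteration\<close>

locale cj_iteration =
  fixes n :: nat and A B :: cmat and Q :: "(nat \<times> nat) list"
  assumes n: "2 \<le> n" and hermA: "hermitian_n n A" and posB: "pos_def_n n B" and QC: "Q \<in> C_sg n"
begin

definition AA :: "nat \<Rightarrow> cmat" where "AA k = fst (cj_seq n (cyclic_strategy Q) A B k)"
definition BB :: "nat \<Rightarrow> cmat" where "BB k = snd (cj_seq n (cyclic_strategy Q) A B k)"
definition p :: "nat \<Rightarrow> nat" where "p k = fst (cyclic_strategy Q k)"
definition q :: "nat \<Rightarrow> nat" where "q k = snd (cyclic_strategy Q k)"
definition za :: "nat \<Rightarrow> complex" where "za k = fst (cj_Zhat (AA k) (BB k) (p k) (q k))"
definition zb :: "nat \<Rightarrow> complex" where "zb k = fst (snd (cj_Zhat (AA k) (BB k) (p k) (q k)))"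
definition zc :: "nat \<Rightarrow> complex" where "zc k = fst (snd (snd (cj_Zhat (AA k) (BB k) (p k) (q k))))"
definition zd :: "nat \<Rightarrow> complex" where "zd k = snd (snd (snd (cj_Zhat (AA k) (BB k) (p k) (q k))))"
definition Z :: "nat \<Rightarrow> cmat" where "Z k = plane_mat (za k) (zb k) (zc k) (zd k) (p k) (q k)"
definition piv :: "nat \<Rightarrow> complex" where "piv k = BB k (p k) (q k)"

section \<open>Pivots, blocks and the invariant of the iteration\<close>

lemma ordering: "is_ordering n Q"
  using QC unfolding C_sg_def by blast

lemma Q_nonempty: "Q \<noteq> []" and Q_pivots: "set Q \<subseteq> pivot_set n"
proof -
  have "(1, 2) \<in> pivot_set n" using n unfolding pivot_set_def by auto
  then show "Q \<noteq> []" "set Q \<subseteq> pivot_set n" using ordering unfolding is_ordering_def by auto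
qed

lemma pivot_range: "p k \<in> {1..n}" "q k \<in> {1..n}" "p k \<noteq> q k"
proof -
  have "cyclic_strategy Q k \<in> pivot_set n"
    using Q_nonempty Q_pivots unfolding cyclic_strategy_def by (meson mod_less_divisor length_greater_0_conv nth_mem subsetD)
  then show "p k \<in> {1..n}" "q k \<in> {1..n}" "p k \<noteq> q k"
    unfolding p_def q_def pivot_set_def by (auto simp: case_prod_beta)
qed

lemma Zhat: "cj_Zhat (AA k) (BB k) (p k) (q k) = (za k, zb k, zc k, zd k)"
  unfolding za_def zb_def zc_def zd_def by simp

lemma AA_Suc: "AA (Suc k) = congruence n (Z k) (AA k)" and BB_Suc: "BB (Suc k) = congruence n (Z k) (BB k)"
proof -
  have "cj_Z (AA k) (BB k) (p k) (q k) = Z k"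
    unfolding cj_Z_def Zhat Z_def plane_mat_def by simp
  then show "AA (Suc k) = congruence n (Z k) (AA k)" "BB (Suc k) = congruence n (Z k) (BB k)"
    unfolding AA_def BB_def p_def q_def congruence_def by (simp_all add: cj_step_def Let_def case_prod_beta)
qed

lemma congruence_Z_pcong:
  assumes "r \<in> {1..n}" "s \<in> {1..n}"
  shows "congruence n (Z k) X r s = pcong (za k) (zb k) (zc k) (zd k) (p k) (q k) X r s"
  unfolding congruence_def Z_def by (rule mmult_plane_mat_pcong[OF pivot_range assms])

text \<open>One common \<open>F\<close> for both matrices ties \<open>AA\<close> to
  \<open>BB\<close>: it gives the pencil identity and, through the unit diagonal of
  \<open>BB\<close>, the bound on \<open>AA\<close>. Equality is claimed on 1..n only, since the
  initial scaling is a congruence just there.\<close>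

definition invariant :: "nat \<Rightarrow> bool" where
  "invariant k \<longleftrightarrow> hermitian_n n (AA k) \<and> pos_def_n n (BB k) \<and> (\<forall>r\<in>{1..n}. BB k r r = 1) \<and>
    (\<exists>F. eq_on n (AA k) (congruence n F A) \<and> eq_on n (BB k) (congruence n F B))"

lemma invariant_piv: "invariant k \<Longrightarrow> cmod (piv k) < 1"
  unfolding piv_def invariant_def using pos_def_offdiag[of n "BB k"] pivot_range by blast

lemma invariant_step:
  assumes "invariant k"
  shows "sesq 1 (piv k) (cnj (piv k)) 1 (za k) (zc k) (za k) (zc k) = 1"
    and "sesq 1 (piv k) (cnj (piv k)) 1 (za k) (zc k) (zb k) (zd k) = 0"
    and "sesq 1 (piv k) (cnj (piv k)) 1 (zb k) (zd k) (zb k) (zd k) = 1"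
    and "sesq (AA k (p k) (p k)) (AA k (p k) (q k)) (AA k (q k) (p k)) (AA k (q k) (q k))
      (za k) (zc k) (zb k) (zd k) = 0"
    and "za k * zd k - zb k * zc k = complex_of_real (1 / sqrt (1 - (cmod (piv k))\<^sup>2))"
    and "7 / 10 - cmod (piv k) / sqrt (1 - (cmod (piv k))\<^sup>2) \<le> cmod (za k)"
    and "7 / 10 - cmod (piv k) / sqrt (1 - (cmod (piv k))\<^sup>2) \<le> cmod (zd k)"
proof -
  have h: "AA k s r = cnj (AA k r s)" if "r \<in> {1..n}" "s \<in> {1..n}" for r s
    using assms that unfolding invariant_def hermitian_n_def by blast
  have "Im (AA k r r) = 0" if "r \<in> {1..n}" for r using h[OF that that] by (simp add: complex_eq_iff)
  then have 1: "Im (AA k (p k) (p k)) = 0" "Im (AA k (q k) (q k)) = 0" using pivot_range by blast+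
  note * = cj_Zhat_props[OF 1 h[OF pivot_range(1,2)] invariant_piv[OF assms, unfolded piv_def] Zhat]
  show "sesq 1 (piv k) (cnj (piv k)) 1 (za k) (zc k) (za k) (zc k) = 1"
    "sesq 1 (piv k) (cnj (piv k)) 1 (za k) (zc k) (zb k) (zd k) = 0"
    "sesq 1 (piv k) (cnj (piv k)) 1 (zb k) (zd k) (zb k) (zd k) = 1"
    "sesq (AA k (p k) (p k)) (AA k (p k) (q k)) (AA k (q k) (p k)) (AA k (q k) (q k))
      (za k) (zc k) (zb k) (zd k) = 0"
    "za k * zd k - zb k * zc k = complex_of_real (1 / sqrt (1 - (cmod (piv k))\<^sup>2))"
    "7 / 10 - cmod (piv k) / sqrt (1 - (cmod (piv k))\<^sup>2) \<le> cmod (za k)"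
    "7 / 10 - cmod (piv k) / sqrt (1 - (cmod (piv k))\<^sup>2) \<le> cmod (zd k)"
    unfolding piv_def by (fact *)+
qed

lemma invariant_BB:
  assumes "invariant k"
  shows "BB k (p k) (p k) = 1" "BB k (q k) (q k) = 1" "BB k (q k) (p k) = cnj (piv k)"
  using assms pivot_range[of k] unfolding invariant_def pos_def_n_def hermitian_n_def piv_def by blast+

lemma invariant_sqrt:
  assumes "invariant k"
  shows "0 < 1 - (cmod (piv k))\<^sup>2"
  using invariant_piv[OF assms] by (simp add: abs_square_less_1)

lemma cdet_Z:
  assumes "invariant k"
  shows "cdet n (Z k) = complex_of_real (1 / sqrt (1 - (cmod (piv k))\<^sup>2))" (is "_ = complex_of_real ?t")
    and "cdet n (cadj (Z k)) = complex_of_real (1 / sqrt (1 - (cmod (piv k))\<^sup>2))"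
proof -
  show "cdet n (Z k) = complex_of_real ?t"
    unfolding Z_def cdet_plane_mat[OF pivot_range] by (rule invariant_step(5)[OF assms])
  have "cdet n (cadj (Z k)) = cnj (za k * zd k - zb k * zc k)"
    unfolding Z_def cadj_plane_mat[OF pivot_range(3)] cdet_plane_mat[OF pivot_range] by (simp add: mult.commute)
  then show "cdet n (cadj (Z k)) = complex_of_real ?t" unfolding invariant_step(5)[OF assms] by simp
qed

lemma invariant_Suc:
  assumes inv: "invariant k"
  shows "invariant (Suc k)"
  unfolding invariant_def
proof (intro conjI)
  show "hermitian_n n (AA (Suc k))"
    unfolding AA_Suc using inv unfolding invariant_def by (intro hermitian_congruence) blast
  have "cdet n (Z k) \<noteq> 0" unfolding cdet_Z[OF inv] using invariant_sqrt[OF inv] by simp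
  then show "pos_def_n n (BB (Suc k))"
    unfolding BB_Suc using inv unfolding invariant_def by (intro pos_def_congruence) blast+
  show "\<forall>r\<in>{1..n}. BB (Suc k) r r = 1"
  proof
    fix r assume r: "r \<in> {1..n}"
    note pr = pivot_range[of k]
    have eq: "BB (Suc k) r r = pcong (za k) (zb k) (zc k) (zd k) (p k) (q k) (BB k) r r"
      unfolding BB_Suc by (rule congruence_Z_pcong[OF r r])
    consider "r = p k" | "r = q k" | "r \<notin> {p k, q k}" by blast
    then show "BB (Suc k) r r = 1"
    proof cases
      case 1
      then show ?thesis unfolding eq
        using pcong_pivot_sesq(1)[OF pr(3)] invariant_step(1)[OF inv] invariant_BB[OF inv]
        by (simp flip: piv_def)
    next
      case 2
      then show ?thesis unfolding eq
        using pcong_pivot_sesq(3)[OF pr(3)] invariant_step(3)[OF inv] invariant_BB[OF inv]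
        by (simp flip: piv_def)
    next
      case 3
      then show ?thesis unfolding eq using inv r unfolding invariant_def by (simp add: pcong_outside)
    qed
  qed
  obtain F where F: "eq_on n (AA k) (congruence n F A)" "eq_on n (BB k) (congruence n F B)"
    using inv unfolding invariant_def by blast
  show "\<exists>F. eq_on n (AA (Suc k)) (congruence n F A) \<and> eq_on n (BB (Suc k)) (congruence n F B)"
    unfolding AA_Suc BB_Suc congruence_eq_on[OF F(1)] congruence_eq_on[OF F(2)] congruence_comp by blast
qed

lemma invariant: "invariant k"
proof (induction k)
  case 0
  define D where "D = (\<lambda>i j. if i = j then complex_of_real (1 / sqrt (Re (B i i))) else 0)"
  note D = cj_scale_congruence[OF posB, folded D_def]
  have AA0: "AA 0 = cj_scale B A" and BB0: "BB 0 = cj_scale B B" unfolding AA_def BB_def by simp_all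
  have sym: "eq_on n (congruence n D X) (cj_scale B X)" for X using D(1)[of X] by metis
  show ?case
    unfolding invariant_def AA0 BB0
  proof (intro conjI)
    show "hermitian_n n (cj_scale B A)"
      by (rule hermitian_eq_on[OF hermitian_congruence[OF hermA] sym])
    show "pos_def_n n (cj_scale B B)"
      by (rule pos_def_eq_on[OF pos_def_congruence[OF posB D(2)] sym])
    show "\<forall>r\<in>{1..n}. cj_scale B B r r = 1"
    proof
      fix r assume r: "r \<in> {1..n}"
      note d = pos_def_diag[OF posB r]
      have "B r r = complex_of_real (Re (B r r))" using d(2) by (simp add: complex_eq_iff)
      moreover have "complex_of_real (sqrt (Re (B r r))) * complex_of_real (sqrt (Re (B r r))) = complex_of_real (Re (B r r))"
        using d(1) by (simp flip: of_real_mult)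
      ultimately show "cj_scale B B r r = 1" using d(1) unfolding cj_scale_def
        by (metis divide_self less_irrefl of_real_eq_0_iff)
    qed
    show "\<exists>F. eq_on n (cj_scale B A) (congruence n F A) \<and> eq_on n (cj_scale B B) (congruence n F B)"
      using D(1) by blast
  qed
qed (rule invariant_Suc)

text \<open>The pencil and \<open>BB\<close> acquire the same determinant factor from
  \<open>F\<close>; cross multiplication eliminates it without a division.\<close>

lemma pencil_identity:
  "cdet n (\<lambda>i j. AA k i j - z * BB k i j) * cdet n B = cdet n (BB k) * cdet n (\<lambda>i j. A i j - z * B i j)"
proof -
  obtain F where F: "eq_on n (AA k) (congruence n F A)" "eq_on n (BB k) (congruence n F B)"
    using invariant[of k] unfolding invariant_def by blast
  have "cdet n (\<lambda>i j. AA k i j - z * BB k i j) = cdet n (congruence n F (\<lambda>i j. A i j - z * B i j))"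
    using F by (intro cdet_cong) (simp add: congruence_diff)
  moreover have "cdet n (BB k) = cdet n (congruence n F B)" using F(2) by (intro cdet_cong) simp
  ultimately show ?thesis unfolding cdet_congruence by (simp add: mult_ac)
qed

lemma BB_bounded: "r \<in> {1..n} \<Longrightarrow> s \<in> {1..n} \<Longrightarrow> cmod (BB k r s) \<le> 1"
  using invariant[of k] pos_def_offdiag[of n "BB k" r s] unfolding invariant_def
  by (cases "r = s") (auto intro: less_imp_le)

lemma AA_bounded:
  obtains K where "\<And>k r s. r \<in> {1..n} \<Longrightarrow> s \<in> {1..n} \<Longrightarrow> cmod (AA k r s) \<le> K"
proof -
  obtain K where K: "\<And>F r s. r \<in> {1..n} \<Longrightarrow> s \<in> {1..n} \<Longrightarrow> congruence n F B r r = 1 \<Longrightarrow> congruence n F B s s = 1 \<Longrightarrow>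
    cmod (congruence n F A r s) \<le> K"
    using congruence_bounded[OF posB] by blast
  have "cmod (AA k r s) \<le> K" if rs: "r \<in> {1..n}" "s \<in> {1..n}" for k r s
  proof -
    obtain F where F: "eq_on n (AA k) (congruence n F A)" "eq_on n (BB k) (congruence n F B)"
      and d: "\<forall>r\<in>{1..n}. BB k r r = 1"
      using invariant[of k] unfolding invariant_def by blast
    have "congruence n F B r r = 1" "congruence n F B s s = 1" using F(2) d rs by metis+
    then have "cmod (congruence n F A r s) \<le> K" using K rs by blast
    then show ?thesis using F(1) rs by simp
  qed
  then show ?thesis using that by blast
qed

lemma piv_tendsto_0: "piv \<longlonglongrightarrow> 0"
proof -
  define D where "D = (\<lambda>k. cmod (cdet n (BB k)))"
  have pos: "0 < D k" for k
    using invariant[of k] pos_def_cdet_nonzero unfolding D_def invariant_def by simp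
  have step: "D (Suc k) * (1 - (cmod (piv k))\<^sup>2) = D k" for k
  proof -
    let ?e = "1 - (cmod (piv k))\<^sup>2"
    have e: "0 < ?e" by (rule invariant_sqrt[OF invariant])
    have "D (Suc k) = (1 / sqrt ?e) * D k * (1 / sqrt ?e)"
      unfolding D_def BB_Suc cdet_congruence cdet_Z[OF invariant] norm_mult norm_of_real using e by simp
    also have "\<dots> = D k / ?e" using e by simp
    finally show ?thesis using e by simp
  qed
  have "D k \<le> D (Suc k)" for k
  proof -
    have "D (Suc k) * (1 - (cmod (piv k))\<^sup>2) \<le> D (Suc k) * 1"
      using pos[of "Suc k"] by (intro mult_left_mono) auto
    then show ?thesis using step[of k] by simp
  qed
  then have "incseq D" by (rule incseq_SucI)
  moreover have "D k \<le> fact n" for k unfolding D_def by (rule cdet_bounded[OF BB_bounded])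
  ultimately obtain L where L: "D \<longlonglongrightarrow> L" "\<forall>k. D k \<le> L" using incseq_convergent by blast
  have "0 < L" using L(2) pos[of 0] by (meson less_le_trans)
  \<comment> \<open>Since the limit \<open>L\<close> is positive, ratios of consecutive determinants
    tend to 1, and such a ratio differs from 1 by exactly the squared pivot.\<close>
  have "(\<lambda>k. 1 - D k / D (Suc k)) \<longlonglongrightarrow> 1 - L / L"
    using L(1) LIMSEQ_Suc[OF L(1)] \<open>0 < L\<close> by (intro tendsto_intros) auto
  moreover have "1 - D k / D (Suc k) = (cmod (piv k))\<^sup>2" for k
    using step[of k] pos[of "Suc k"] by (simp add: field_simps)
  ultimately have "(\<lambda>k. (cmod (piv k))\<^sup>2) \<longlonglongrightarrow> 0" using \<open>0 < L\<close> by simp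
  then have "(\<lambda>k. sqrt ((cmod (piv k))\<^sup>2)) \<longlonglongrightarrow> sqrt 0" by (rule tendsto_real_sqrt)
  then show ?thesis by (simp add: tendsto_norm_zero_iff)
qed

section \<open>Asymptotic unitarity of the blocks\<close>

lemma eventually_piv_small: "\<forall>\<^sub>F k in sequentially. cmod (piv k) \<le> 1 / 2"
proof -
  have "\<forall>\<^sub>F k in sequentially. dist (piv k) 0 < 1 / 2" using tendstoD[OF piv_tendsto_0, of "1 / 2"] by simp
  then show ?thesis by eventually_elim simp
qed

lemma eventually_columns:
  "\<forall>\<^sub>F k in sequentially. (cmod (za k))\<^sup>2 + (cmod (zc k))\<^sup>2 \<le> 2 \<and> (cmod (zb k))\<^sup>2 + (cmod (zd k))\<^sup>2 \<le> 2"
  using eventually_piv_small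
  by eventually_elim (use sesq_near_identity(1) invariant_step(1,3)[OF invariant] in blast)

lemma unit_columns:
  "(\<lambda>k. (cmod (za k))\<^sup>2 + (cmod (zc k))\<^sup>2) \<longlonglongrightarrow> 1" "(\<lambda>k. (cmod (zb k))\<^sup>2 + (cmod (zd k))\<^sup>2) \<longlonglongrightarrow> 1"
proof -
  have *: "f \<longlonglongrightarrow> 1" if "\<forall>\<^sub>F k in sequentially. \<bar>f k - 1\<bar> \<le> 2 * cmod (piv k)" for f :: "nat \<Rightarrow> real"
  proof -
    have "(\<lambda>k. f k - 1) \<longlonglongrightarrow> 0"
      by (rule tendsto_0_le[OF piv_tendsto_0, where K = 2]) (use that in \<open>simp add: mult.commute\<close>)
    then show ?thesis by (rule LIM_zero_cancel)
  qed
  show "(\<lambda>k. (cmod (za k))\<^sup>2 + (cmod (zc k))\<^sup>2) \<longlonglongrightarrow> 1"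
    by (rule *, use eventually_piv_small in eventually_elim)
      (rule sesq_near_identity(2)[OF invariant_step(1)[OF invariant]])
  show "(\<lambda>k. (cmod (zb k))\<^sup>2 + (cmod (zd k))\<^sup>2) \<longlonglongrightarrow> 1"
    by (rule *, use eventually_piv_small in eventually_elim)
      (rule sesq_near_identity(2)[OF invariant_step(3)[OF invariant]])
qed

lemma orthogonal_columns: "(\<lambda>k. cnj (za k) * zb k + cnj (zc k) * zd k) \<longlonglongrightarrow> 0"
proof (rule tendsto_0_le[OF piv_tendsto_0])
  show "\<forall>\<^sub>F k in sequentially. norm (cnj (za k) * zb k + cnj (zc k) * zd k) \<le> norm (piv k) * 2"
    using eventually_columns
  proof eventually_elim
    case (elim k)
    then show ?case
      using sesq_near_identity_cross[OF invariant_step(2)[OF invariant]] by (simp add: mult.commute)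
  qed
qed

lemma eventually_diagonal_large:
  "\<forall>\<^sub>F k in sequentially. 1 / 2 \<le> cmod (za k)" "\<forall>\<^sub>F k in sequentially. 1 / 2 \<le> cmod (zd k)"
proof -
  have "(\<lambda>k. cmod (piv k) / sqrt (1 - (cmod (piv k))\<^sup>2)) \<longlonglongrightarrow> cmod 0 / sqrt (1 - (cmod 0)\<^sup>2)"
    by (intro tendsto_intros piv_tendsto_0) simp
  then have "(\<lambda>k. cmod (piv k) / sqrt (1 - (cmod (piv k))\<^sup>2)) \<longlonglongrightarrow> 0" by simp
  \<comment> \<open>1/5 is the room between 7/10 and the required 1/2.\<close>
  then have "\<forall>\<^sub>F k in sequentially. cmod (piv k) / sqrt (1 - (cmod (piv k))\<^sup>2) < 1 / 5"
    by (rule order_tendstoD) simp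
  then have "\<forall>\<^sub>F k in sequentially. 1 / 2 \<le> cmod (za k) \<and> 1 / 2 \<le> cmod (zd k)"
  proof eventually_elim
    case (elim k)
    then show ?case using invariant_step(6,7)[OF invariant, of k] by linarith
  qed
  then show "\<forall>\<^sub>F k in sequentially. 1 / 2 \<le> cmod (za k)" "\<forall>\<^sub>F k in sequentially. 1 / 2 \<le> cmod (zd k)"
    by (auto elim: eventually_mono)
qed

lemma AA_Suc_pivot: "AA (Suc k) (p k) (q k) = 0" and BB_Suc_pivot: "BB (Suc k) (p k) (q k) = 0"
proof -
  note pr = pivot_range[of k]
  show "AA (Suc k) (p k) (q k) = 0"
    unfolding AA_Suc congruence_Z_pcong[OF pr(1,2)] pcong_pivot_sesq(2)[OF pr(3)]
    by (rule invariant_step(4)[OF invariant])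
  show "BB (Suc k) (p k) (q k) = 0"
    unfolding BB_Suc congruence_Z_pcong[OF pr(1,2)] pcong_pivot_sesq(2)[OF pr(3)] invariant_BB[OF invariant]
    using invariant_step(2)[OF invariant, of k] unfolding piv_def .
qed

lemma off2_AA: "(\<lambda>k. off2 n (AA k)) \<longlonglongrightarrow> 0" and off2_BB: "(\<lambda>k. off2 n (BB k)) \<longlonglongrightarrow> 0"
proof -
  have diagonalizing: "diagonalizing n Q" using diagonalizing_C_sg[OF _ QC] n by simp
  note process = jacobi_process_offdiag[OF diagonalizing Q_nonempty Q_pivots, folded p_def q_def,
      OF _ _ _ _ unit_columns orthogonal_columns eventually_diagonal_large]
  obtain K where K: "\<And>k r s. r \<in> {1..n} \<Longrightarrow> s \<in> {1..n} \<Longrightarrow> cmod (AA k r s) \<le> K"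
    using AA_bounded by blast
  show "(\<lambda>k. off2 n (AA k)) \<longlonglongrightarrow> 0"
  proof (rule process[OF _ K])
    show "hermitian_n n (AA k)" for k using invariant[of k] unfolding invariant_def by blast
    show "AA (Suc k) r s = pcong (za k) (zb k) (zc k) (zd k) (p k) (q k) (AA k) r s"
      if "r \<in> {1..n}" "s \<in> {1..n}" for k r s unfolding AA_Suc by (rule congruence_Z_pcong[OF that])
    show "AA (Suc k) (p k) (q k) = 0" for k by (rule AA_Suc_pivot)
  qed
  show "(\<lambda>k. off2 n (BB k)) \<longlonglongrightarrow> 0"
  proof (rule process[OF _ BB_bounded])
    show "hermitian_n n (BB k)" for k using invariant[of k] unfolding invariant_def pos_def_n_def by blast
    show "BB (Suc k) r s = pcong (za k) (zb k) (zc k) (zd k) (p k) (q k) (BB k) r s"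
      if "r \<in> {1..n}" "s \<in> {1..n}" for k r s unfolding BB_Suc by (rule congruence_Z_pcong[OF that])
    show "BB (Suc k) (p k) (q k) = 0" for k by (rule BB_Suc_pivot)
  qed
qed

lemma BB_tendsto:
  assumes "r \<in> {1..n}" "s \<in> {1..n}"
  shows "(\<lambda>k. BB k r s) \<longlonglongrightarrow> idm r s"
proof (cases "r = s")
  case True
  then have "BB k r s = 1" for k using invariant[of k] assms unfolding invariant_def by blast
  then show ?thesis using True by (simp add: idm_def)
next
  case False
  then show ?thesis
    using off2_tendsto_entry[OF off2_BB, of "\<lambda>_. r" "\<lambda>_. s"] assms by (simp add: idm_def)
qed

lemma AA_offdiag_tendsto:
  "r \<in> {1..n} \<Longrightarrow> s \<in> {1..n} \<Longrightarrow> r \<noteq> s \<Longrightarrow> (\<lambda>k. AA k r s) \<longlonglongrightarrow> 0"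
  using off2_tendsto_entry[OF off2_AA, of "\<lambda>_. r" "\<lambda>_. s"] by simp

section \<open>Convergence of the diagonal of \<open>AA\<close>\<close>

lemma eventually_Z_bounded:
  "\<forall>\<^sub>F k in sequentially. cmod (za k) \<le> 2 \<and> cmod (zb k) \<le> 2 \<and> cmod (zc k) \<le> 2 \<and> cmod (zd k) \<le> 2"
  using eventually_columns
proof eventually_elim
  case (elim k)
  have "x \<le> 2 \<and> y \<le> 2" if "x\<^sup>2 + y\<^sup>2 \<le> 2" for x y :: real
  proof -
    have "x\<^sup>2 \<le> 2" "y\<^sup>2 \<le> 2" using that zero_le_power2[of x] zero_le_power2[of y] by linarith+
    then have "x\<^sup>2 \<le> 2\<^sup>2" "y\<^sup>2 \<le> 2\<^sup>2" by simp_all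
    then show ?thesis by (auto intro: power2_le_imp_le)
  qed
  then show ?case using elim by blast
qed

lemma AA_diag_increment:
  assumes r: "r \<in> {1..n}"
  shows "(\<lambda>k. AA (Suc k) r r - AA k r r) \<longlonglongrightarrow> 0"
proof -
  obtain K where K: "\<And>k r s. r \<in> {1..n} \<Longrightarrow> s \<in> {1..n} \<Longrightarrow> cmod (AA k r s) \<le> K"
    using AA_bounded by blast
  have w: "(\<lambda>k. AA k (p k) (q k)) \<longlonglongrightarrow> 0" "(\<lambda>k. AA k (q k) (p k)) \<longlonglongrightarrow> 0"
    using pivot_range by (auto intro!: off2_tendsto_entry[OF off2_AA] dest: sym)
  have cx: "complex_of_real ((cmod x)\<^sup>2 + (cmod y)\<^sup>2) = cnj x * x + cnj y * y" for x y
    by (simp only: of_real_add complex_norm_square mult.commute)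
  have u1: "(\<lambda>k. cnj (za k) * za k + cnj (zc k) * zc k - 1) \<longlonglongrightarrow> 0"
    using LIM_zero[OF tendsto_of_real[OF unit_columns(1), where 'a = complex]] unfolding cx of_real_1 .
  have u2: "(\<lambda>k. cnj (zd k) * zd k + cnj (zb k) * zb k - 1) \<longlonglongrightarrow> 0"
    using LIM_zero[OF tendsto_of_real[OF unit_columns(2), where 'a = complex]] unfolding cx of_real_1 by (simp add: add.commute)
  have u3: "(\<lambda>k. cnj (zd k) * zc k + cnj (zb k) * za k) \<longlonglongrightarrow> 0"
    using tendsto_cnj[OF orthogonal_columns] by (simp add: algebra_simps)
  have low: "\<forall>\<^sub>F k in sequentially. 1 / 2 \<le> cmod (za k)" by (rule eventually_diagonal_large)
  let ?s = "\<lambda>k. sesq (AA k (p k) (p k)) (AA k (p k) (q k)) (AA k (q k) (p k)) (AA k (q k) (q k))"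
  have P: "(\<lambda>k. ?s k (za k) (zc k) (za k) (zc k) - AA k (p k) (p k)) \<longlonglongrightarrow> 0"
    by (rule pivot_diagonal_increment[OF u1 orthogonal_columns eventually_diagonal_large(2)
        eventually_Z_bounded K[OF pivot_range(1) pivot_range(1)] w invariant_step(4)[OF invariant]])
  \<comment> \<open>The second pivot index is handled by the same lemma with the two indices
    interchanged, which needs the mirrored entry of the annihilation condition.\<close>
  have zero: "sesq (AA k (q k) (q k)) (AA k (q k) (p k)) (AA k (p k) (q k)) (AA k (p k) (p k))
      (zd k) (zb k) (zc k) (za k) = 0" for k
  proof -
    have "?s k (zb k) (zd k) (za k) (zc k) = cnj (?s k (za k) (zc k) (zb k) (zd k))"
    proof (rule sesq_hermitian)
      have h: "AA k s r = cnj (AA k r s)" if "r \<in> {1..n}" "s \<in> {1..n}" for r s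
        using invariant[of k] that unfolding invariant_def hermitian_n_def by blast
      show "AA k (q k) (p k) = cnj (AA k (p k) (q k))" using h pivot_range by blast
      have "Im (AA k r r) = 0" if "r \<in> {1..n}" for r using h[OF that that] by (simp add: complex_eq_iff)
      then show "Im (AA k (p k) (p k)) = 0" "Im (AA k (q k) (q k)) = 0" using pivot_range by blast+
    qed
    then show ?thesis unfolding invariant_step(4)[OF invariant] by (subst sesq_swap) simp
  qed
  have "\<forall>\<^sub>F k in sequentially. cmod (zd k) \<le> 2 \<and> cmod (zc k) \<le> 2 \<and> cmod (zb k) \<le> 2 \<and> cmod (za k) \<le> 2"
    using eventually_Z_bounded by eventually_elim blast
  from pivot_diagonal_increment[OF u2 u3 low this K[OF pivot_range(2) pivot_range(2)] w(2,1) zero]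
  have "(\<lambda>k. sesq (AA k (q k) (q k)) (AA k (q k) (p k)) (AA k (p k) (q k)) (AA k (p k) (p k))
      (zd k) (zb k) (zd k) (zb k) - AA k (q k) (q k)) \<longlonglongrightarrow> 0" .
  then have Qd: "(\<lambda>k. ?s k (zb k) (zd k) (zb k) (zd k) - AA k (q k) (q k)) \<longlonglongrightarrow> 0"
    by (subst sesq_swap)
  have incr: "AA (Suc k) r r - AA k r r =
      (if r = p k then ?s k (za k) (zc k) (za k) (zc k) - AA k (p k) (p k)
       else if r = q k then ?s k (zb k) (zd k) (zb k) (zd k) - AA k (q k) (q k) else 0)" for k
    unfolding AA_Suc congruence_Z_pcong[OF r r]
    using pcong_pivot_sesq[OF pivot_range(3)[of k]] by (auto simp: pcong_outside)
  \<comment> \<open>Whether \<open>r\<close> is the first, the second or no pivot index depends on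
    \<open>k\<close>; the sum of both increments dominates all three cases.\<close>
  have "(\<lambda>k. cmod (?s k (za k) (zc k) (za k) (zc k) - AA k (p k) (p k)) +
      cmod (?s k (zb k) (zd k) (zb k) (zd k) - AA k (q k) (q k))) \<longlonglongrightarrow> 0 + 0"
    by (intro tendsto_add tendsto_norm_zero P Qd)
  then have lim: "(\<lambda>k. cmod (?s k (za k) (zc k) (za k) (zc k) - AA k (p k) (p k)) +
      cmod (?s k (zb k) (zd k) (zb k) (zd k) - AA k (q k) (q k))) \<longlonglongrightarrow> 0" by simp
  show ?thesis
    by (rule tendsto_0_le[OF lim, where K = 1]) (simp add: incr)
qed

text \<open>The index map \<open>h\<close> only has to tend to infinity, so that the same statement
  serves for limit points and for the full sequence.\<close>

lemma diagonal_limit: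
  assumes h: "filterlim h sequentially sequentially"
    and L: "\<And>r. r \<in> {1..n} \<Longrightarrow> (\<lambda>k. AA (h k) r r) \<longlonglongrightarrow> l r"
  shows "diag_of_eigenvalues n A B (\<lambda>i j. if i = j then l i else 0)"
proof (rule pencil_limit[where A' = "\<lambda>k. AA (h k)" and B' = "\<lambda>k. BB (h k)"])
  show "cdet n (\<lambda>i j. AA (h k) i j - z * BB (h k) i j) * cdet n B =
      cdet n (BB (h k)) * cdet n (\<lambda>i j. A i j - z * B i j)" for k z
    by (rule pencil_identity)
  fix i j assume ij: "i \<in> {1..n}" "j \<in> {1..n}"
  show "(\<lambda>k. AA (h k) i j) \<longlonglongrightarrow> (if i = j then l i else 0)"
    using L[OF ij(1)] filterlim_compose[OF AA_offdiag_tendsto[OF ij] h] by (cases "i = j") auto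
  show "(\<lambda>k. BB (h k) i j) \<longlonglongrightarrow> idm i j"
    by (rule filterlim_compose[OF BB_tendsto[OF ij] h])
qed (auto simp: is_diagonal_n_def)

text \<open>All diagonal entries converge along the same subsequence, because the eigenvalue
  property concerns the diagonal as a whole.\<close>

lemma AA_diag_subsequence:
  assumes "\<And>k. k \<le> h k"
  obtains g l where "\<And>k. k \<le> g k" "\<And>r. r \<in> {1..n} \<Longrightarrow> (\<lambda>k. AA (h (g k)) r r) \<longlonglongrightarrow> l r"
    "diag_of_eigenvalues n A B (\<lambda>i j. if i = j then l i else 0)"
proof -
  obtain K where K: "\<And>k r s. r \<in> {1..n} \<Longrightarrow> s \<in> {1..n} \<Longrightarrow> cmod (AA k r s) \<le> K"
    using AA_bounded by blast
  obtain g l where g: "strict_mono g" and l: "\<And>r. r \<in> {1..n} \<Longrightarrow> (\<lambda>k. AA (h (g k)) r r) \<longlonglongrightarrow> l r"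
    using subsequence_finite_family[of "{1..n}" "\<lambda>k r. AA (h k) r r" "\<lambda>_. K"] K by blast
  have gk: "k \<le> g k" for k by (rule strict_mono_imp_increasing[OF g])
  have "k \<le> h (g k)" for k using gk[of k] assms[of "g k"] by linarith
  then have "filterlim (\<lambda>k. h (g k)) sequentially sequentially"
    by (intro filterlim_at_top_mono[OF filterlim_ident]) (auto intro!: always_eventually)
  from diagonal_limit[OF this l] show ?thesis using that[OF gk l] by blast
qed

text \<open>One limit point of the whole diagonal supplies the finite list of eigenvalues, so their
  existence comes from compactness. Any other limit point has the same characteristic polynomial,
  hence its entries occur in the list; small increments then single out one of them.\<close>

lemma AA_diag_convergent:
  assumes r: "r \<in> {1..n}"
  shows "\<exists>f. (\<lambda>k. AA k r r) \<longlonglongrightarrow> f"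
proof -
  obtain l where l: "diag_of_eigenvalues n A B (\<lambda>i j. if i = j then l i else 0)"
    by (rule AA_diag_subsequence[of "\<lambda>k. k", OF order_refl]) (rule that)
  have dB: "cdet n B \<noteq> 0" by (rule pos_def_cdet_nonzero[OF posB])
  show ?thesis
  proof (rule tendsto_if_near_finite_set[where F = "l ` {1..n}"])
    fix \<epsilon> :: real assume \<epsilon>: "0 < \<epsilon>"
    show "\<forall>\<^sub>F k in sequentially. \<exists>f\<in>l ` {1..n}. dist (AA k r r) f < \<epsilon>"
    proof (rule ccontr)
      assume "\<not> ?thesis"
      then have "\<forall>m. \<exists>k\<ge>m. \<not> (\<exists>f\<in>l ` {1..n}. dist (AA k r r) f < \<epsilon>)"
        unfolding eventually_sequentially by blast
      then obtain h where h: "\<And>m. m \<le> h m" "\<And>m. \<not> (\<exists>f\<in>l ` {1..n}. dist (AA (h m) r r) f < \<epsilon>)"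
        by metis
      obtain g l' where l': "\<And>r. r \<in> {1..n} \<Longrightarrow> (\<lambda>k. AA (h (g k)) r r) \<longlonglongrightarrow> l' r"
        "diag_of_eigenvalues n A B (\<lambda>i j. if i = j then l' i else 0)"
        by (rule AA_diag_subsequence[of h, OF h(1)]) (rule that)
      have char: "cdet n (\<lambda>i j. A i j - z * B i j) = cdet n B * (\<Prod>i = 1..n. m i - z)"
        if "diag_of_eigenvalues n A B (\<lambda>i j. if i = j then m i else 0)" for m z
        using that unfolding diag_of_eigenvalues_def by simp
      \<comment> \<open>Both factorizations of the pencil determinant are evaluated at z = l' r,
        where the second one vanishes.\<close>
      have "cdet n B * (\<Prod>i = 1..n. l i - l' r) = cdet n B * (\<Prod>i = 1..n. l' i - l' r)"
        unfolding char[OF l, symmetric] char[OF l'(2), symmetric] ..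
      then have "(\<Prod>i = 1..n. l i - l' r) = (\<Prod>i = 1..n. l' i - l' r)" using dB by simp
      also have "\<dots> = 0" using r by (intro prod_zero) auto
      finally obtain i where i: "i \<in> {1..n}" "l i = l' r" by (auto simp: prod_zero_iff)
      have "\<forall>\<^sub>F k in sequentially. dist (AA (h (g k)) r r) (l i) < \<epsilon>"
        using tendstoD[OF l'(1)[OF r] \<epsilon>] unfolding i(2) .
      then have "\<forall>\<^sub>F k in sequentially. False"
        by eventually_elim (use h(2) i(1) in blast)
      then show False by simp
    qed
  qed (use AA_diag_increment[OF r] in auto)
qed

lemma converges:
  "\<exists>\<Lambda>. diag_of_eigenvalues n A B \<Lambda> \<and>
    (\<forall>i\<in>{1..n}. \<forall>j\<in>{1..n}. (\<lambda>k. AA k i j) \<longlonglongrightarrow> \<Lambda> i j \<and> (\<lambda>k. BB k i j) \<longlonglongrightarrow> idm i j)"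
proof -
  obtain l where l: "\<And>r. r \<in> {1..n} \<Longrightarrow> (\<lambda>k. AA k r r) \<longlonglongrightarrow> l r"
    using AA_diag_convergent by metis
  have "diag_of_eigenvalues n A B (\<lambda>i j. if i = j then l i else 0)"
    using diagonal_limit[of "\<lambda>k. k"] l filterlim_ident by blast
  moreover have "(\<lambda>k. AA k i j) \<longlonglongrightarrow> (if i = j then l i else 0)" if "i \<in> {1..n}" "j \<in> {1..n}" for i j
    using l AA_offdiag_tendsto that by (cases "i = j") auto
  ultimately show ?thesis using BB_tendsto by blast
qed

end

theorem theorem4p1:
  fixes n :: nat and A B :: cmat and Q :: "(nat \<times> nat) list"
  assumes "2 \<le> n"
    and "hermitian_n n A"
    and "pos_def_n n B"
    and "Q \<in> C_sg n"
  shows "\<exists>\<Lambda>. diag_of_eigenvalues n A B \<Lambda> \<and>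
    (\<forall>i\<in>{1..n}. \<forall>j\<in>{1..n}.
       (\<lambda>k. fst (cj_seq n (cyclic_strategy Q) A B k) i j) \<longlonglongrightarrow> \<Lambda> i j \<and>
       (\<lambda>k. snd (cj_seq n (cyclic_strategy Q) A B k) i j) \<longlonglongrightarrow> idm i j)"
proof -
  interpret cj_iteration n A B Q using assms by unfold_locales
  show ?thesis using converges unfolding AA_def BB_def .
qed

end
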